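(* Let $\alpha\in(0,1)$, $d\ge 1$, and let $g=(g_1,\dots,g_d)^{\mathrm T}:\mathbb{R}^d\to\mathbb{R}^d$ be continuously differentiable with components of the form $$g_i(x)=h_i(x_1,\dots,x_{i-1})\,f_i(x_i),\qquad i=1,\dots,d,$$ where $h_i:\mathbb{R}^{i-1}\to\mathbb{R}$ and $f_i:\mathbb{R}\to\mathbb{R}$ (with $h_1$ a constant). Assume: (1) (dissipativity) there exist $a,b>0$ such that $\langle x,g(x)\rangle\le a-b\|x\|^2$ for all $x\in\mathbb{R}^d$; (2) (non-degeneracy) for each $i=1,\dots,d$, $f_i'(u)\neq 0$ for every $u\in\mathcal N(f_i):=\{u\in\mathbb{R}: f_i(u)=0\}$. Consider the Caputo fractional differential equation ${}^{C}\!D^{\alpha}_{0+}x(t)=g(x(t))$, $t\ge0$, in $\mathbb{R}^d$. Then: (i) The global attractor, attracting all solutions starting from a bounded set, is $$\mathcal A=[\min\mathcal N(f_1),\max\mathcal N(f_1)]\times\dots\times[\min\mathcal N(f_d),\max\mathcal N(f_d)].$$ (ii) Each solution converges, as $t\to\infty$, to an element of the set $\mathcal N(g):=\mathcal N(f_1)\times\dots\times\mathcal N(f_d)$, and the rate of convergence is $t^{-\alpha}$.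
   Context: A solution of ${}^{C}\!D^{\alpha}_{0+}x(t)=g(x(t))$ with $x(0)=\eta\in\mathbb{R}^d$ is a continuous function $x(\cdot,\eta):[0,\infty)\to\mathbb{R}^d$ satisfying $$x(t,\eta)=\eta+\frac{1}{\Gamma(\alpha)}\int_0^t (t-s)^{\alpha-1}g(x(s,\eta))\,ds,\qquad t\ge 0,$$ where $\Gamma$ is the Gamma function. Under the stated assumptions such a solution exists and is unique for every $\eta\in\mathbb{R}^d$. Here $\langle\cdot,\cdot\rangle$ and $\|\cdot\|$ are the Euclidean inner product and norm. For $B\subseteq\mathbb{R}^d$ put $x(t,B):=\{x(t,\eta):\eta\in B\}$. A nonempty compact set $\mathcal A\subset\mathbb{R}^d$ is the global attractor if $x(t,\mathcal A)=\mathcal A$ for all $t\ge0$ and, for every nonempty bounded $B\subset\mathbb{R}^d$, $\lim_{t\to\infty}\sup_{\eta\in B}\inf_{z\in\mathcal A}\|x(t,\eta)-z\|=0$. "The rate of convergence is $t^{-\alpha}$" means: for every $\eta\notin\mathcal N(g)$, with $x^*:=\lim_{t\to\infty}x(t,\eta)$, there are constants $c,C,T>0$ such that $c\,t^{-\alpha}\le\|x(t,\eta)-x^*\|\le C\,t^{-\alpha}$ for all $t\ge T$. (For $\eta\in\mathcal N(g)$ the solution is constant.) *)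

theory Defs
  imports "HOL-Analysis.Analysis"
begin

definition continuously_differentiable ::
    "('a::real_normed_vector \<Rightarrow> 'b::real_normed_vector) \<Rightarrow> bool" where
  "continuously_differentiable g \<longleftrightarrow>
     (\<exists>g' :: 'a \<Rightarrow> 'a \<Rightarrow>\<^sub>L 'b.
        (\<forall>x. (g has_derivative blinfun_apply (g' x)) (at x)) \<and> continuous_on UNIV g')"

definition dissipative :: "('a::real_inner \<Rightarrow> 'a) \<Rightarrow> bool" where
  "dissipative g \<longleftrightarrow>
     (\<exists>a>0. \<exists>b>0. \<forall>x. inner x (g x) \<le> a - b * (norm x)\<^sup>2)"

definition zeros :: "(real \<Rightarrow> real) \<Rightarrow> real set" where
  "zeros f = {u. f u = 0}"

definition zero_product :: "('n::finite \<Rightarrow> real \<Rightarrow> real) \<Rightarrow> (real ^ 'n) set" where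
  "zero_product f = {x. \<forall>i. x $ i \<in> zeros (f i)}"

text \<open>A function on \<open>[0,\<infinity>)\<close> is represented by a function on the reals whose
  values at negative arguments are irrelevant.  For \<open>0 < \<alpha> < 1\<close>, continuous \<open>x\<close> and continuous
  \<open>g\<close> the integrand is absolutely integrable, so the gauge integral is the Lebesgue integral;
  its value at the singularity \<open>s = t\<close> is \<open>0\<close> because \<open>0 powr _ = 0\<close>.\<close>

definition caputo_solution ::
    "real \<Rightarrow> ('a::euclidean_space \<Rightarrow> 'a) \<Rightarrow> 'a \<Rightarrow> (real \<Rightarrow> 'a) \<Rightarrow> bool" where
  "caputo_solution \<alpha> g \<eta> x \<longleftrightarrow>
     continuous_on {0..} x \<and>
     (\<forall>t\<ge>0. x t = \<eta> + (1 / Gamma \<alpha>) *\<^sub>R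
        integral {0..t} (\<lambda>s. (t - s) powr (\<alpha> - 1) *\<^sub>R g (x s)))"

text \<open>The description is over the value at time \<open>t\<close>, not over the whole function, since solutions
  are only unique on \<open>[0,\<infinity>)\<close>; for \<open>t < 0\<close> the value is meaningless.\<close>

definition caputo_flow ::
    "real \<Rightarrow> ('a::euclidean_space \<Rightarrow> 'a) \<Rightarrow> real \<Rightarrow> 'a \<Rightarrow> 'a" where
  "caputo_flow \<alpha> g t \<eta> = (THE y. \<exists>x. caputo_solution \<alpha> g \<eta> x \<and> x t = y)"

text \<open>The supremum is taken in the extended reals, so that it is \<open>\<infinity>\<close>, not an
  unspecified real number, should the distances be unbounded.\<close>

definition global_attractor ::
    "(real \<Rightarrow> 'a \<Rightarrow> 'a) \<Rightarrow> 'a::real_normed_vector set \<Rightarrow> bool" where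
  "global_attractor \<phi> A \<longleftrightarrow>
     A \<noteq> {} \<and> compact A \<and>
     (\<forall>t\<ge>0. \<phi> t ` A = A) \<and>
     (\<forall>B. B \<noteq> {} \<and> bounded B \<longrightarrow>
        ((\<lambda>t. SUP \<eta>\<in>B. ereal (INF z\<in>A. norm (\<phi> t \<eta> - z))) \<longlongrightarrow> 0) at_top)"

definition exact_rate ::
    "real \<Rightarrow> (real \<Rightarrow> 'a::real_normed_vector) \<Rightarrow> 'a \<Rightarrow> bool" where
  "exact_rate \<alpha> x l \<longleftrightarrow>
     (\<exists>c>0. \<exists>C>0. \<exists>T>0. \<forall>t\<ge>T.
        c * t powr (- \<alpha>) \<le> norm (x t - l) \<and> norm (x t - l) \<le> C * t powr (- \<alpha>))"

text \<open>Coordinates are indexed by a finite linear order, whose elements play the role of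
  \<open>1 < \<dots> < d\<close>.  The argument \<open>(x\<^sub>1, \<dots>, x\<^sub>i\<^sub>-\<^sub>1)\<close> of \<open>h i\<close> is the restriction
  of the coordinate function to the indices below \<open>i\<close>; for the least index this is the same
  empty tuple for all \<open>x\<close>, so that the corresponding factor is a constant.\<close>

definition triangular_product_form ::
    "(real ^ 'n::{finite,linorder} \<Rightarrow> real ^ 'n::{finite,linorder}) \<Rightarrow>
     ('n \<Rightarrow> ('n \<Rightarrow> real) \<Rightarrow> real) \<Rightarrow> ('n \<Rightarrow> real \<Rightarrow> real) \<Rightarrow> bool" where
  "triangular_product_form g h f \<longleftrightarrow>
     (\<forall>x i. g x $ i = h i (restrict (($) x) {..<i}) * f i (x $ i))"

end

theory Submission
  imports Defs
begin

text \<open>In a triangular field the components up to the \<open>i\<close>-th do not see the later coordinates.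
Dissipativity, tested on vectors whose coordinates after the \<open>i\<close>-th vanish, therefore forces every factor \<open>h i\<close> to be nonzero everywhere and
\<open>f i\<close> to point inwards near \<open>\<plusminus>\<infinity>\<close>. After a common change of sign, \<open>g x $ i = P i x * \<phi> i (x $ i)\<close>
with \<open>P i\<close> positive and continuous and \<open>\<phi> i\<close> having simple zeros only; this is the locale
\<open>product_field\<close>. Along a solution each coordinate \<open>y\<close> then satisfies a scalar equation
\<open>y = y0 + J (Q * \<phi>(y))\<close>, where \<open>J\<close> is the fractional integral and \<open>Q > 0\<close>.

If \<open>\<phi> y0 = 0\<close>, then \<open>y\<close> is constant. Otherwise \<open>\<phi>\<close> drives \<open>y\<close> from \<open>y0\<close> towards the next zero
\<open>u\<close>. The distance \<open>v = \<bar>y - u\<bar>\<close> satisfies \<open>v = v0 - J q\<close> with \<open>q\<close> between two positive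
multiples of \<open>v\<close>, because the zero \<open>u\<close> is simple. It can neither reach \<open>0\<close> nor exceed \<open>v0\<close> (lemma
\<open>trapped\<close>), and a comparison principle puts it between two solutions of the linear equation
\<open>e = 1 - \<kappa> * J e\<close>, which decay exactly like \<open>t powr (- \<alpha>)\<close>. This gives convergence and the rate.
The constants are uniform over bounded sets of initial values, so all of them are attracted
uniformly by the box spanned by the extreme zeros. The box is invariant since no coordinate passes
a zero; that the flow maps it onto itself follows from Brouwer's theorem.

The analytic core is the comparison principle for \<open>w = b + J (p - \<kappa> * w)\<close> with \<open>p \<ge> 0\<close> (lemma
\<open>comparison\<close>). A first-zero argument (lemma \<open>volterra_positive\<close>) works only for inhomogeneities
that decay no faster than the kernel \<open>t powr (\<alpha> - 1)\<close>. It applies to constants and to a softened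
version of the kernel; superposing shifted responses to the latter gives the response to
approximations of \<open>J p\<close>, and the softening is removed in the limit.\<close>

section \<open>The fractional integral\<close>

definition frac_int :: "real \<Rightarrow> (real \<Rightarrow> 'a::euclidean_space) \<Rightarrow> real \<Rightarrow> 'a" where
  "frac_int \<alpha> q t = (1 / Gamma \<alpha>) *\<^sub>R integral {0..t} (\<lambda>s. (t - s) powr (\<alpha> - 1) *\<^sub>R q s)"

locale fractional_order =
  fixes \<alpha> :: real
  assumes pos: "0 < \<alpha>" and less_one: "\<alpha> < 1"
begin

abbreviation "J \<equiv> frac_int \<alpha>"

lemma Gamma_pos: "Gamma \<alpha> > 0" "Gamma (\<alpha> + 1) > 0"
  using pos by (auto intro!: Gamma_real_pos)

lemma Gamma_nonzero: "Gamma \<alpha> \<noteq> 0" "Gamma (\<alpha> + 1) \<noteq> 0"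
  using Gamma_pos by (metis less_irrefl)+

lemma Gamma_Suc: "Gamma (\<alpha> + 1) = \<alpha> * Gamma \<alpha>"
  using pos Gamma_plus1[of \<alpha>] by (simp add: add.commute nonpos_Ints_def)

lemma reparam_range:
  assumes "0 \<le> r" "r \<le> 1" "0 \<le> (t::real)"
  shows "t * (1 - r powr (1 / \<alpha>)) \<in> {0..t}"
proof -
  have "r powr (1 / \<alpha>) \<le> 1" using assms pos by (simp add: powr_le1)
  then show ?thesis using assms by (auto intro!: mult_nonneg_nonneg mult_left_le)
qed

lemma continuous_on_reparam:
  "continuous_on (UNIV \<times> {0..1}) (\<lambda>(t::real, r). t * (1 - r powr (1 / \<alpha>)))"
  unfolding case_prod_unfold
  by (intro continuous_intros continuous_on_powr') (use pos in auto)

text \<open>The substitution \<open>r = ((t - s) / t) powr \<alpha>\<close> turns the singular integral into one of a continuous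
function over a fixed interval. Integrability of the singular integrand, its continuous dependence
on \<open>t\<close>, scaling of time and Fubini's theorem for continuous functions all come from this form.\<close>

lemma kernel_has_integral:
  fixes q :: "real \<Rightarrow> 'a::euclidean_space"
  assumes t: "0 \<le> t" and q: "continuous_on {0..t} q"
  shows "((\<lambda>s. (t - s) powr (\<alpha> - 1) *\<^sub>R q s) has_integral
           (t powr \<alpha> / \<alpha>) *\<^sub>R integral {0..1} (\<lambda>r. q (t * (1 - r powr (1 / \<alpha>))))) {0..t}"
proof (cases "t = 0")
  case True
  then show ?thesis using has_integral_refl(2)[of _ "0::real"] by simp
next
  case False
  then have t: "0 < t" using t by simp
  define u where "u = (\<lambda>s. ((t - s) / t) powr \<alpha>)"
  define u' where "u' = (\<lambda>s. \<alpha> * ((t - s) / t) powr (\<alpha> - 1) * (- 1 / t))"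
  define F where "F = (\<lambda>r. q (t * (1 - r powr (1 / \<alpha>))))"
  have u_range: "u ` {0..t} \<subseteq> {0..1}"
    unfolding u_def using t pos by (auto intro!: powr_le1)
  have contF: "continuous_on {0..1} F"
    unfolding F_def
    by (rule continuous_on_compose2[OF q])
       (use pos t reparam_range in \<open>auto intro!: continuous_intros continuous_on_powr'\<close>)
  have contu: "continuous_on {0..t} u"
    unfolding u_def using t pos
    by (intro continuous_intros continuous_on_powr') auto
  have deriv: "(u has_field_derivative u' s) (at s within {0..t})" if "s \<in> {0..t} - {t}" for s
  proof -
    have "(u has_field_derivative (\<alpha> * ((t - s) / t) powr (\<alpha> - 1) * (- 1 / t))) (at s)"
      unfolding u_def using that t
      by (auto intro!: derivative_eq_intros simp: field_simps)
    then show ?thesis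
      unfolding u'_def by (rule has_field_derivative_at_within)
  qed
  have "((\<lambda>s. u' s *\<^sub>R F (u s)) has_integral (integral {u 0..u t} F - integral {u t..u 0} F)) {0..t}"
    by (rule has_integral_substitution_general[where s = "{t}", OF _ _ u_range contF contu deriv]) (use t in auto)
  moreover have "u 0 = 1" "u t = 0" using t unfolding u_def by auto
  ultimately have "((\<lambda>s. u' s *\<^sub>R F (u s)) has_integral - integral {0..1} F) {0..t}"
    by simp
  from has_integral_cmul[OF this, of "- (t powr \<alpha> / \<alpha>)"]
  have "((\<lambda>s. - (t powr \<alpha> / \<alpha>) *\<^sub>R u' s *\<^sub>R F (u s)) has_integral (t powr \<alpha> / \<alpha>) *\<^sub>R integral {0..1} F) {0..t}"
    by simp
  moreover have "- (t powr \<alpha> / \<alpha>) *\<^sub>R u' s *\<^sub>R F (u s) = (t - s) powr (\<alpha> - 1) *\<^sub>R q s" if "s \<in> {0..t}" for s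
  proof -
    have "u s powr (1 / \<alpha>) = (t - s) / t"
      unfolding u_def using that t pos by (simp add: powr_powr)
    moreover have "t * (1 - (t - s) / t) = s"
      using t by (simp add: diff_divide_distrib right_diff_distrib)
    ultimately have "F (u s) = q s"
      unfolding F_def by (simp only:)
    moreover have "- (t powr \<alpha> / \<alpha>) * u' s = (t - s) powr (\<alpha> - 1)"
      unfolding u'_def using that t pos
      by (simp add: powr_divide powr_diff)
    ultimately show ?thesis by simp
  qed
  ultimately have "((\<lambda>s. (t - s) powr (\<alpha> - 1) *\<^sub>R q s) has_integral (t powr \<alpha> / \<alpha>) *\<^sub>R integral {0..1} F) {0..t}"
    by (rule has_integral_eq[rotated])
  then show ?thesis
    unfolding F_def .
qed

lemma kernel_integrable:
  fixes q :: "real \<Rightarrow> 'a::euclidean_space"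
  assumes "0 \<le> t" "continuous_on {0..t} q"
  shows "(\<lambda>s. (t - s) powr (\<alpha> - 1) *\<^sub>R q s) integrable_on {0..t}"
  using kernel_has_integral[OF assms] by blast

lemma frac_int_regularised:
  fixes q :: "real \<Rightarrow> 'a::euclidean_space"
  assumes "0 \<le> t" "continuous_on {0..t} q"
  shows "J q t = (t powr \<alpha> / Gamma (\<alpha> + 1)) *\<^sub>R integral {0..1} (\<lambda>r. q (t * (1 - r powr (1 / \<alpha>))))"
  using integral_unique[OF kernel_has_integral[OF assms]] Gamma_Suc
  by (simp add: frac_int_def mult.commute)

lemma continuous_on_reparam_compose:
  fixes q :: "real \<Rightarrow> 'a::euclidean_space"
  assumes "continuous_on {0..} q"
  shows "continuous_on ({0..} \<times> {0..1}) (\<lambda>(t, r). q (t * (1 - r powr (1 / \<alpha>))))"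
  unfolding case_prod_unfold
  apply (rule continuous_on_compose2[OF assms])
  using continuous_on_subset[OF continuous_on_reparam, of "{0..} \<times> {0..1}"]
   apply (simp add: case_prod_unfold)
  using reparam_range by auto

lemma continuous_on_frac_int:
  fixes q :: "real \<Rightarrow> 'a::euclidean_space"
  assumes "continuous_on {0..} q"
  shows "continuous_on {0..} (J q)"
proof -
  have "continuous_on {0..} (\<lambda>t. integral (cbox 0 1) (\<lambda>r. q (t * (1 - r powr (1 / \<alpha>)))))"
    by (rule integral_continuous_on_param) (use continuous_on_reparam_compose[OF assms] in simp)
  moreover have "continuous_on {0..} (\<lambda>t. t powr \<alpha> / Gamma (\<alpha> + 1))"
    unfolding divide_inverse using pos
    by (intro continuous_on_mult continuous_on_const continuous_on_powr' continuous_on_id) auto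
  ultimately have "continuous_on {0..} (\<lambda>t. (t powr \<alpha> / Gamma (\<alpha> + 1)) *\<^sub>R
      integral (cbox 0 1) (\<lambda>r. q (t * (1 - r powr (1 / \<alpha>)))))"
    by (rule continuous_on_scaleR[rotated])
  then show ?thesis
  proof (rule continuous_on_eq)
    fix t :: real
    assume "t \<in> {0..}"
    then show "(t powr \<alpha> / Gamma (\<alpha> + 1)) *\<^sub>R integral (cbox 0 1) (\<lambda>r. q (t * (1 - r powr (1 / \<alpha>)))) = J q t"
      using frac_int_regularised[of t q] continuous_on_subset[OF assms, of "{0..t}"] by simp
  qed
qed

lemma frac_int_zero_time [simp]: "J q 0 = 0"
  by (simp add: frac_int_def)

lemma frac_int_cong:
  "(\<And>s. 0 \<le> s \<Longrightarrow> s \<le> t \<Longrightarrow> q s = q' s) \<Longrightarrow> J q t = J q' t"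
  unfolding frac_int_def by (auto intro!: arg_cong2[where f = scaleR] integral_cong)

lemma frac_int_add:
  fixes p q :: "real \<Rightarrow> 'a::euclidean_space"
  assumes "0 \<le> t" "continuous_on {0..t} p" "continuous_on {0..t} q"
  shows "J (\<lambda>s. p s + q s) t = J p t + J q t"
  using integral_add[OF kernel_integrable[OF assms(1,2)] kernel_integrable[OF assms(1,3)]]
  by (simp add: frac_int_def scaleR_add_right)

lemma frac_int_diff:
  fixes p q :: "real \<Rightarrow> 'a::euclidean_space"
  assumes "0 \<le> t" "continuous_on {0..t} p" "continuous_on {0..t} q"
  shows "J (\<lambda>s. p s - q s) t = J p t - J q t"
  using integral_diff[OF kernel_integrable[OF assms(1,2)] kernel_integrable[OF assms(1,3)]]
  by (simp add: frac_int_def scaleR_diff_right)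

lemma frac_int_cmult: "J (\<lambda>s. c * q s :: real) t = c * J q t"
proof -
  have "integral {0..t} (\<lambda>s. (t - s) powr (\<alpha> - 1) * (c * q s)) =
        integral {0..t} (\<lambda>s. c * ((t - s) powr (\<alpha> - 1) * q s))"
    by (simp add: mult.left_commute)
  then show ?thesis by (simp add: frac_int_def)
qed

lemma frac_int_mono:
  fixes p q :: "real \<Rightarrow> real"
  assumes "0 \<le> t" "continuous_on {0..t} p" "continuous_on {0..t} q"
    and "\<And>s. 0 \<le> s \<Longrightarrow> s \<le> t \<Longrightarrow> p s \<le> q s"
  shows "J p t \<le> J q t"
proof -
  have "integral {0..t} (\<lambda>s. (t - s) powr (\<alpha> - 1) *\<^sub>R p s) \<le> integral {0..t} (\<lambda>s. (t - s) powr (\<alpha> - 1) *\<^sub>R q s)"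
    by (rule integral_le[OF kernel_integrable[OF assms(1,2)] kernel_integrable[OF assms(1,3)]])
       (use assms(4) in \<open>auto intro!: mult_left_mono\<close>)
  then show ?thesis using Gamma_pos by (auto simp: frac_int_def intro!: divide_right_mono)
qed

lemma frac_int_const:
  fixes c :: "'a::euclidean_space"
  assumes "0 \<le> t" shows "J (\<lambda>s. c) t = (t powr \<alpha> / Gamma (\<alpha> + 1)) *\<^sub>R c"
  using frac_int_regularised[OF assms, of "\<lambda>_. c"] by simp

lemma frac_int_nonneg:
  fixes q :: "real \<Rightarrow> real"
  assumes "0 \<le> t" "continuous_on {0..t} q" "\<And>s. 0 \<le> s \<Longrightarrow> s \<le> t \<Longrightarrow> 0 \<le> q s"
  shows "0 \<le> J q t"
  using frac_int_mono[OF assms(1) continuous_on_const assms(2), of 0] assms frac_int_const[of t "0::real"]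
  by simp

lemma norm_frac_int_le:
  fixes p :: "real \<Rightarrow> 'a::euclidean_space" and q :: "real \<Rightarrow> real"
  assumes "0 \<le> t" "continuous_on {0..t} p" "continuous_on {0..t} q"
    and "\<And>s. 0 \<le> s \<Longrightarrow> s \<le> t \<Longrightarrow> norm (p s) \<le> q s"
  shows "norm (J p t) \<le> J q t"
proof -
  have "norm (integral {0..t} (\<lambda>s. (t - s) powr (\<alpha> - 1) *\<^sub>R p s)) \<le>
        integral {0..t} (\<lambda>s. (t - s) powr (\<alpha> - 1) *\<^sub>R q s)"
    by (rule integral_norm_bound_integral[OF kernel_integrable[OF assms(1,2)] kernel_integrable[OF assms(1,3)]])
       (use assms(4) in \<open>auto intro!: mult_left_mono\<close>)
  then show ?thesis using Gamma_pos by (auto simp: frac_int_def intro!: divide_right_mono)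
qed

lemma frac_int_scale_time:
  fixes q :: "real \<Rightarrow> real"
  assumes "0 \<le> t" "0 \<le> c" "continuous_on {0..} q"
  shows "J q (c * t) = c powr \<alpha> * J (\<lambda>s. q (c * s)) t"
proof -
  have 1: "continuous_on {0..c * t} q" using assms by (auto intro: continuous_on_subset)
  have 2: "continuous_on {0..t} (\<lambda>s. q (c * s))"
    by (rule continuous_on_compose2[OF assms(3)]) (use assms in \<open>auto intro!: continuous_intros\<close>)
  show ?thesis
    using frac_int_regularised[OF _ 1] frac_int_regularised[OF assms(1) 2] assms
    by (simp add: powr_mult mult.assoc)
qed

text \<open>The quotient of the two kernels is \<open>((t - s) / (t1 - s)) powr (1 - \<alpha>)\<close>, which decreases in \<open>s\<close>,
so its value at \<open>s = 0\<close> is a bound.\<close>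

lemma kernel_ratio:
  assumes "0 \<le> s" "s < t" "t \<le> t1"
  shows "(t1 - s) powr (\<alpha> - 1) \<le> (t / t1) powr (1 - \<alpha>) * (t - s) powr (\<alpha> - 1)"
proof -
  have "(t - s) / (t1 - s) \<le> t / t1"
  proof -
    have "s * (t / t1) \<le> s" using assms by (intro mult_left_le) auto
    moreover have "t / t1 * (t1 - s) = t - s * (t / t1)"
      using assms by (simp add: right_diff_distrib)
    ultimately show ?thesis using assms by (intro mult_imp_div_pos_le) auto
  qed
  then have "((t - s) / (t1 - s)) powr (1 - \<alpha>) \<le> (t / t1) powr (1 - \<alpha>)"
    using assms less_one by (intro powr_mono2) auto
  then have "((t - s) / (t1 - s)) powr (1 - \<alpha>) * (t - s) powr (\<alpha> - 1) \<le> (t / t1) powr (1 - \<alpha>) * (t - s) powr (\<alpha> - 1)"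
    by (intro mult_right_mono) auto
  moreover have "((t - s) / (t1 - s)) powr (1 - \<alpha>) * (t - s) powr (\<alpha> - 1) = (t1 - s) powr (\<alpha> - 1)"
  proof -
    have 1: "(t - s) powr (1 - \<alpha>) * (t - s) powr (\<alpha> - 1) = 1"
      using assms by (simp add: powr_add[symmetric])
    have 2: "(t1 - s) powr (\<alpha> - 1) = 1 / (t1 - s) powr (1 - \<alpha>)"
      using powr_minus_divide[of "t1 - s" "1 - \<alpha>"] by simp
    have "((t - s) / (t1 - s)) powr (1 - \<alpha>) = (t - s) powr (1 - \<alpha>) / (t1 - s) powr (1 - \<alpha>)"
      using assms by (simp add: powr_divide)
    then show ?thesis unfolding 2 using 1 by simp
  qed
  ultimately show ?thesis by simp
qed

text \<open>What has accumulated up to time \<open>t\<close> is forgotten by time \<open>t1\<close> at least by the factor that the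
kernel loses at \<open>s = 0\<close>. This quantifies fading memory, both for small \<open>t1 - t\<close> (positivity of
solutions) and for large \<open>t1 / t\<close> (lower decay rate).\<close>

lemma frac_int_split:
  fixes q :: "real \<Rightarrow> real"
  assumes t: "0 < t" "t \<le> t1" and q: "continuous_on {0..t1} q"
    and nonneg: "\<And>s. 0 \<le> s \<Longrightarrow> s \<le> t1 \<Longrightarrow> 0 \<le> q s"
    and bound: "\<And>s. t \<le> s \<Longrightarrow> s \<le> t1 \<Longrightarrow> q s \<le> M"
  shows "J q t1 \<le> (t / t1) powr (1 - \<alpha>) * J q t + M * (t1 - t) powr \<alpha> / Gamma (\<alpha> + 1)"
proof -
  define k where "k = (\<lambda>s. (t1 - s) powr (\<alpha> - 1) * q s)"
  define c where "c = (t / t1) powr (1 - \<alpha>)"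
  have qt: "continuous_on {0..t} q" using q by (rule continuous_on_subset) (use t in auto)
  have k: "k integrable_on {0..t1}"
    using kernel_integrable[OF _ q] t unfolding k_def by simp
  have k1: "k integrable_on {0..t}" and k2: "k integrable_on {t..t1}"
    using integrable_on_subinterval[OF k] t by auto
  have split: "integral {0..t1} k = integral {0..t} k + integral {t..t1} k"
    using Henstock_Kurzweil_Integration.integral_combine[OF _ _ k, of t] t by simp
  have "integral {0..t} k \<le> integral {0..t} (\<lambda>s. c * ((t - s) powr (\<alpha> - 1) * q s))"
  proof -
    \<comment> \<open>At \<open>s = t\<close> the kernel on the right has the value \<open>0\<close>, so this point is excluded.\<close>
    define k' where "k' = (\<lambda>s. if s = t then 0 else k s)"
    have eq: "integral {0..t} k' = integral {0..t} k"
      by (rule integral_spike[of "{t}"]) (auto simp: k'_def)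
    have "k' integrable_on {0..t}"
      using integrable_spike[OF k1, of "{t}" k'] by (auto simp: k'_def)
    moreover have "(\<lambda>s. c * ((t - s) powr (\<alpha> - 1) * q s)) integrable_on {0..t}"
      using integrable_cmul[OF kernel_integrable[OF _ qt], of c] t by simp
    moreover have "k' s \<le> c * ((t - s) powr (\<alpha> - 1) * q s)" if "s \<in> {0..t}" for s
    proof (cases "s = t")
      case False
      then have "(t1 - s) powr (\<alpha> - 1) * q s \<le> (c * (t - s) powr (\<alpha> - 1)) * q s"
        using kernel_ratio[of s t t1] nonneg[of s] that t unfolding c_def
        by (intro mult_right_mono) auto
      then show ?thesis using False by (simp add: k'_def k_def mult.assoc)
    qed (simp add: k'_def)
    ultimately have "integral {0..t} k' \<le> integral {0..t} (\<lambda>s. c * ((t - s) powr (\<alpha> - 1) * q s))"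
      by (rule integral_le)
    then show ?thesis using eq by simp
  qed
  then have a: "integral {0..t} k \<le> c * integral {0..t} (\<lambda>s. (t - s) powr (\<alpha> - 1) * q s)"
    by simp
  have "integral {t..t1} k \<le> M * ((t1 - t) powr \<alpha> / \<alpha>)"
  proof -
    have "((\<lambda>s. (t1 - s) powr (\<alpha> - 1)) has_integral ((t1 - t) powr \<alpha> / \<alpha>)) {t..t1}"
    proof -
      have "((\<lambda>s. ((t1 - t) - s) powr (\<alpha> - 1) *\<^sub>R (1::real)) has_integral ((t1 - t) powr \<alpha> / \<alpha>)) {0..t1 - t}"
        using kernel_has_integral[of "t1 - t" "\<lambda>_. 1::real"] t by simp
      then show ?thesis
        by (subst has_integral_shift_real_ivl_iff[of _ _ t t1 t]) (simp add: algebra_simps)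
    qed
    from has_integral_mult_right[OF this, of M]
    have "((\<lambda>s. M * (t1 - s) powr (\<alpha> - 1)) has_integral M * ((t1 - t) powr \<alpha> / \<alpha>)) {t..t1}" .
    from integrable_integral[OF k2] this show ?thesis
    proof (rule has_integral_le)
      fix s assume "s \<in> {t..t1}"
      then show "k s \<le> M * (t1 - s) powr (\<alpha> - 1)"
        unfolding k_def mult.commute[of M] using bound[of s] by (intro mult_left_mono) auto
    qed
  qed
  then have "integral {0..t1} k \<le> c * integral {0..t} (\<lambda>s. (t - s) powr (\<alpha> - 1) * q s) + M * ((t1 - t) powr \<alpha> / \<alpha>)"
    using a split by simp
  then have "integral {0..t1} k / Gamma \<alpha> \<le> (c * integral {0..t} (\<lambda>s. (t - s) powr (\<alpha> - 1) * q s) + M * ((t1 - t) powr \<alpha> / \<alpha>)) / Gamma \<alpha>"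
    using Gamma_pos by (intro divide_right_mono) auto
  then show ?thesis
    using Gamma_pos Gamma_Suc by (simp add: frac_int_def k_def c_def add_divide_distrib)
qed

text \<open>Extending the integral to the half-line gives the Gamma integral. With respect to the weight
\<open>exp (\<mu> * t)\<close> the operator \<open>J\<close> therefore has norm at most \<open>\<mu> powr (- \<alpha>)\<close>, uniformly in time,
which is small for large \<open>\<mu>\<close>.\<close>

lemma weighted_kernel_le:
  assumes t: "0 \<le> t" and mu: "0 < \<mu>"
  shows "J (\<lambda>s. exp (\<mu> * s)) t \<le> exp (\<mu> * t) * \<mu> powr (- \<alpha>)"
proof -
  define f where "f = (\<lambda>u::real. u powr (\<alpha> - 1) / exp u)"
  define I where "I = integral {0..\<mu> * t} f"
  have G: "(f has_integral Gamma \<alpha>) {0..}"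
    unfolding f_def by (rule Gamma_integral_real[OF pos])
  have f_int: "f integrable_on {0..\<mu> * t}"
    using integrable_on_subinterval[OF has_integral_integrable[OF G]] by auto
  have "I \<le> Gamma \<alpha>"
    unfolding I_def using G
    by (intro has_integral_subset_le[OF _ integrable_integral[OF f_int] G]) (auto simp: f_def)
  have img: "(\<lambda>x. (1 / - \<mu>) *\<^sub>R x + - ((1 / - \<mu>) *\<^sub>R (\<mu> * t))) ` cbox 0 (\<mu> * t) = {0..t}" (is "?h ` _ = _")
  proof (intro set_eqI iffI)
    fix y assume y: "y \<in> {0..t}"
    then have "y = ?h (\<mu> * (t - y))" "\<mu> * (t - y) \<in> cbox 0 (\<mu> * t)"
      using mu by (auto simp: field_simps)
    then show "y \<in> ?h ` cbox 0 (\<mu> * t)" by blast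
  qed (use mu t in \<open>auto simp: field_simps\<close>)
  have "((\<lambda>s. f (- \<mu> *\<^sub>R s + \<mu> * t)) has_integral (1 / \<mu>) *\<^sub>R I) {0..t}"
    using has_integral_affinity[of f I 0 "\<mu> * t" "- \<mu>" "\<mu> * t", unfolded img]
      integrable_integral[OF f_int] mu by (simp add: I_def)
  from has_integral_mult_right[OF this, of "exp (\<mu> * t) * \<mu> powr (1 - \<alpha>)"]
  have "((\<lambda>s. exp (\<mu> * t) * \<mu> powr (1 - \<alpha>) * f (- \<mu> *\<^sub>R s + \<mu> * t)) has_integral
      exp (\<mu> * t) * \<mu> powr (1 - \<alpha>) * ((1 / \<mu>) *\<^sub>R I)) {0..t}" .
  moreover have "exp (\<mu> * t) * \<mu> powr (1 - \<alpha>) * f (- \<mu> *\<^sub>R s + \<mu> * t) = (t - s) powr (\<alpha> - 1) *\<^sub>R exp (\<mu> * s)"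
    if "s \<in> {0..t}" for s
  proof -
    have 1: "- \<mu> *\<^sub>R s + \<mu> * t = \<mu> * (t - s)" by (simp add: algebra_simps)
    have 2: "\<mu> powr (1 - \<alpha>) * \<mu> powr (\<alpha> - 1) = 1" using mu by (simp add: powr_add[symmetric])
    have 3: "exp (\<mu> * t) / exp (\<mu> * (t - s)) = exp (\<mu> * s)"
      by (simp add: exp_diff[symmetric] algebra_simps)
    have 4: "(\<mu> * (t - s)) powr (\<alpha> - 1) = \<mu> powr (\<alpha> - 1) * (t - s) powr (\<alpha> - 1)"
      using that mu by (simp add: powr_mult)
    have "exp (\<mu> * t) * \<mu> powr (1 - \<alpha>) * (\<mu> powr (\<alpha> - 1) * (t - s) powr (\<alpha> - 1) / exp (\<mu> * (t - s))) =
        (\<mu> powr (1 - \<alpha>) * \<mu> powr (\<alpha> - 1)) * (t - s) powr (\<alpha> - 1) * (exp (\<mu> * t) / exp (\<mu> * (t - s)))"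
      by simp
    then show ?thesis
      unfolding 1 f_def 4 2 3 by simp
  qed
  ultimately have "((\<lambda>s. (t - s) powr (\<alpha> - 1) *\<^sub>R exp (\<mu> * s)) has_integral
      exp (\<mu> * t) * \<mu> powr (1 - \<alpha>) * ((1 / \<mu>) *\<^sub>R I)) {0..t}"
    by (rule has_integral_eq[rotated])
  then have "J (\<lambda>s. exp (\<mu> * s)) t = exp (\<mu> * t) * \<mu> powr (1 - \<alpha>) * (1 / \<mu>) * (I / Gamma \<alpha>)"
    by (simp add: frac_int_def integral_unique)
  also have "\<dots> \<le> exp (\<mu> * t) * \<mu> powr (1 - \<alpha>) * (1 / \<mu>) * 1"
    using \<open>I \<le> Gamma \<alpha>\<close> Gamma_pos mu by (intro mult_left_mono) auto
  also have "\<dots> = exp (\<mu> * t) * \<mu> powr (- \<alpha>)"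
    using mu by (simp add: powr_diff powr_minus_divide)
  finally show ?thesis .
qed

end

section \<open>Gronwall inequality, existence and first zeros\<close>

lemma first_exit:
  fixes v :: "real \<Rightarrow> 'a::topological_space"
  assumes t: "0 \<le> t" and v: "continuous_on {0..t} v" and U: "open U" and exit: "v t \<notin> U"
  shows "\<exists>t1\<in>{0..t}. v t1 \<notin> U \<and> (\<forall>s\<in>{0..<t1}. v s \<in> U)"
proof -
  define Z where "Z = {0..t} \<inter> v -` (- U)"
  have "closed Z" unfolding Z_def
    by (intro continuous_closed_preimage v) (use U in auto)
  moreover have ne: "t \<in> Z" "bdd_below Z" using t exit unfolding Z_def by auto
  ultimately have "Inf Z \<in> Z" using closed_contains_Inf by blast
  moreover have "v s \<in> U" if "0 \<le> s" "s < Inf Z" for s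
  proof (rule ccontr)
    assume "v s \<notin> U"
    then have "s \<in> Z" using that calculation unfolding Z_def by auto
    then show False using cInf_lower[OF _ ne(2)] that by fastforce
  qed
  ultimately show ?thesis unfolding Z_def by (intro bexI[of _ "Inf Z"]) (auto simp: Z_def)
qed

context fractional_order
begin

text \<open>The function \<open>exp (- \<mu> * t) * w t\<close> attains its maximum. There the weighted norm of \<open>J\<close> makes the
integral term at most half of this maximum, so \<open>2 * A\<close> bounds it.\<close>

lemma gronwall:
  fixes w :: "real \<Rightarrow> real"
  assumes T: "0 \<le> T" and w: "continuous_on {0..T} w"
    and mu: "0 < \<mu>" "2 * B \<le> \<mu> powr \<alpha>" and B: "0 \<le> B" and A: "0 \<le> A"
    and le: "\<And>t. 0 \<le> t \<Longrightarrow> t \<le> T \<Longrightarrow> w t \<le> A + B * J w t"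
    and t: "0 \<le> t" "t \<le> T"
  shows "w t \<le> 2 * A * exp (\<mu> * t)"
proof -
  define u where "u = (\<lambda>t. exp (- \<mu> * t) * w t)"
  have "continuous_on {0..T} u" unfolding u_def by (intro continuous_intros w)
  from continuous_attains_sup[OF _ _ this] T
  obtain t0 where t0: "t0 \<in> {0..T}" and max: "\<And>s. s \<in> {0..T} \<Longrightarrow> u s \<le> u t0" by auto
  define m where "m = max 0 (u t0)"
  have w_le: "w s \<le> m * exp (\<mu> * s)" if "s \<in> {0..T}" for s
  proof -
    have "w s = u s * exp (\<mu> * s)" unfolding u_def by (simp add: exp_minus field_simps)
    also have "\<dots> \<le> m * exp (\<mu> * s)"
      using max[OF that] unfolding m_def by (intro mult_right_mono) auto
    finally show ?thesis .
  qed
  have "J w t0 \<le> J (\<lambda>s. m * exp (\<mu> * s)) t0"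
    by (rule frac_int_mono) (use t0 w_le in \<open>auto intro!: continuous_intros continuous_on_subset[OF w]\<close>)
  also have "\<dots> = m * J (\<lambda>s. exp (\<mu> * s)) t0" by (rule frac_int_cmult)
  also have "\<dots> \<le> m * (exp (\<mu> * t0) * \<mu> powr (- \<alpha>))"
    by (rule mult_left_mono[OF weighted_kernel_le]) (use t0 mu m_def in auto)
  finally have "B * J w t0 \<le> B * (m * (exp (\<mu> * t0) * \<mu> powr (- \<alpha>)))"
    using B by (rule mult_left_mono)
  also have "\<dots> = m * exp (\<mu> * t0) * (B / \<mu> powr \<alpha>)"
    by (simp add: powr_minus_divide)
  also have "\<dots> \<le> m * exp (\<mu> * t0) * (1 / 2)"
    using mu B by (intro mult_left_mono) (auto simp: m_def divide_simps)
  finally have "w t0 \<le> A + m * exp (\<mu> * t0) * (1 / 2)"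
    using le[of t0] t0 by auto
  then have "exp (- \<mu> * t0) * w t0 \<le> exp (- \<mu> * t0) * (A + m * exp (\<mu> * t0) * (1 / 2))"
    by (intro mult_left_mono) auto
  also have "\<dots> = exp (- \<mu> * t0) * A + m * (1 / 2)"
    by (simp add: distrib_left exp_minus)
  also have "\<dots> \<le> 1 * A + m * (1 / 2)"
    using t0 mu A by (intro add_right_mono mult_right_mono) auto
  finally have "u t0 \<le> A + m * (1 / 2)" unfolding u_def by simp
  then have "m \<le> 2 * A" unfolding m_def using A by auto
  have "w t \<le> m * exp (\<mu> * t)" using w_le t by auto
  also have "\<dots> \<le> 2 * A * exp (\<mu> * t)" using \<open>m \<le> 2 * A\<close> by (intro mult_right_mono) auto
  finally show ?thesis .
qed

lemma gronwall_exponent: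
  assumes "0 \<le> B" obtains \<mu> where "0 < \<mu>" "2 * B \<le> \<mu> powr \<alpha>"
proof
  show "0 < (2 * B + 1) powr (1 / \<alpha>)" using assms by auto
  show "2 * B \<le> ((2 * B + 1) powr (1 / \<alpha>)) powr \<alpha>" using assms pos by (simp add: powr_powr)
qed

text \<open>In the unknown \<open>y t = exp (- \<mu> * t) *\<^sub>R x t\<close> the equation is a contraction of the bounded continuous
functions, on all of \<open>[0,\<infinity>)\<close> at once. Functions on the whole line are obtained by freezing the time
at \<open>0\<close> for negative arguments.\<close>

lemma solution_exists:
  fixes G :: "'a::euclidean_space \<Rightarrow> 'a" and F :: "real \<Rightarrow> 'a"
  assumes F: "continuous_on {0..} F" and F_bound: "\<And>t. 0 \<le> t \<Longrightarrow> norm (F t) \<le> C"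
    and L: "0 \<le> L" and lipschitz: "\<And>x y. norm (G x - G y) \<le> L * norm (x - y)"
  obtains x where "continuous_on {0..} x" "\<And>t. 0 \<le> t \<Longrightarrow> x t = F t + J (\<lambda>s. G (x s)) t"
proof -
  obtain \<mu> where mu: "0 < \<mu>" "2 * L \<le> \<mu> powr \<alpha>" using gronwall_exponent[OF L] .
  have contG: "continuous_on UNIV G"
    by (rule lipschitz_on_continuous_on[of L])
       (use L lipschitz in \<open>auto intro!: lipschitz_onI simp: dist_norm\<close>)
  define S where "S = (\<lambda>(y::real \<Rightarrow>\<^sub>C 'a) t. G (exp (\<mu> * t) *\<^sub>R y t))"
  define P where "P = (\<lambda>(y::real \<Rightarrow>\<^sub>C 'a) t. exp (- \<mu> * t) *\<^sub>R (F t + J (S y) t))"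
  have contS: "continuous_on {0..} (S y)" for y
    unfolding S_def
    by (rule continuous_on_compose2[OF contG]) (auto intro!: continuous_intros)
  have contS': "continuous_on {0..t} (S y)" for y t
    by (rule continuous_on_subset[OF contS]) auto
  have contP: "continuous_on {0..} (P y)" for y
    unfolding P_def by (intro continuous_intros F continuous_on_frac_int contS)
  have weight: "exp (- \<mu> * t) * (c * J (\<lambda>s. exp (\<mu> * s)) t) \<le> c * \<mu> powr (- \<alpha>)" if "0 \<le> t" "0 \<le> c" for t c
  proof -
    have "exp (- \<mu> * t) * (c * J (\<lambda>s. exp (\<mu> * s)) t) \<le> exp (- \<mu> * t) * (c * (exp (\<mu> * t) * \<mu> powr (- \<alpha>)))"
      by (intro mult_left_mono weighted_kernel_le) (use that mu in auto)
    also have "\<dots> = c * \<mu> powr (- \<alpha>)" by (simp add: exp_minus)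
    finally show ?thesis .
  qed
  have boundP: "norm (P y t) \<le> C + (norm (G 0) + L * norm y) * \<mu> powr (- \<alpha>)" if "0 \<le> t" for y t
  proof -
    have "norm (S y s) \<le> (norm (G 0) + L * norm y) * exp (\<mu> * s)" if "0 \<le> s" for s
    proof -
      have "norm (S y s) \<le> norm (G 0) + norm (S y s - G 0)" by norm
      also have "norm (S y s - G 0) \<le> L * (exp (\<mu> * s) * norm (y s))"
        unfolding S_def using lipschitz[of "exp (\<mu> * s) *\<^sub>R y s" 0] by simp
      also have "\<dots> \<le> L * (exp (\<mu> * s) * norm y)"
        by (intro mult_left_mono norm_bounded L) auto
      also have "norm (G 0) \<le> norm (G 0) * exp (\<mu> * s)"
        using mult_left_mono[of 1 "exp (\<mu> * s)" "norm (G 0)"] that mu by simp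
      finally show ?thesis by (simp add: algebra_simps)
    qed
    then have "norm (J (S y) t) \<le> J (\<lambda>s. (norm (G 0) + L * norm y) * exp (\<mu> * s)) t"
      by (intro norm_frac_int_le contS') (auto intro!: continuous_intros simp: that)
    also have "\<dots> = (norm (G 0) + L * norm y) * J (\<lambda>s. exp (\<mu> * s)) t" by (rule frac_int_cmult)
    finally have "norm (F t + J (S y) t) \<le> C + (norm (G 0) + L * norm y) * J (\<lambda>s. exp (\<mu> * s)) t"
      using F_bound[OF that] norm_triangle_ineq[of "F t" "J (S y) t"] by linarith
    then have "norm (P y t) \<le> exp (- \<mu> * t) * (C + (norm (G 0) + L * norm y) * J (\<lambda>s. exp (\<mu> * s)) t)"
      unfolding P_def by simp
    also have "\<dots> = exp (- \<mu> * t) * C + exp (- \<mu> * t) * ((norm (G 0) + L * norm y) * J (\<lambda>s. exp (\<mu> * s)) t)"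
      by (simp add: distrib_left)
    also have "\<dots> \<le> 1 * C + (norm (G 0) + L * norm y) * \<mu> powr (- \<alpha>)"
      using that mu L order_trans[OF norm_ge_zero F_bound[of 0]]
      by (intro add_mono mult_right_mono weight) auto
    finally show ?thesis by simp
  qed
  define Q where "Q = (\<lambda>y. Bcontfun (\<lambda>t. P y (max 0 t)))"
  have "(\<lambda>t. P y (max 0 t)) \<in> bcontfun" for y
  proof (rule bcontfun_normI)
    show "continuous_on UNIV (\<lambda>t. P y (max 0 t))"
      by (rule continuous_on_compose2[OF contP]) (auto intro!: continuous_intros)
    show "norm (P y (max 0 t)) \<le> C + (norm (G 0) + L * norm y) * \<mu> powr (- \<alpha>)" for t
      by (rule boundP) auto
  qed
  then have Q: "apply_bcontfun (Q y) t = P y (max 0 t)" for y t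
    unfolding Q_def by (simp add: Bcontfun_inverse)
  have contraction: "dist (Q y) (Q z) \<le> (1 / 2) * dist y z" for y z
  proof (rule dist_bound)
    fix t0 :: real
    define t where "t = max 0 t0"
    have t: "0 \<le> t" by (simp add: t_def)
    have "norm (S y s - S z s) \<le> (L * dist y z) * exp (\<mu> * s)" for s
    proof -
      have "norm (S y s - S z s) \<le> L * norm (exp (\<mu> * s) *\<^sub>R y s - exp (\<mu> * s) *\<^sub>R z s)"
        unfolding S_def by (rule lipschitz)
      also have "norm (exp (\<mu> * s) *\<^sub>R y s - exp (\<mu> * s) *\<^sub>R z s) = exp (\<mu> * s) * dist (y s) (z s)"
        by (simp add: dist_norm flip: scaleR_diff_right)
      also have "L * \<dots> \<le> L * (exp (\<mu> * s) * dist y z)"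
        by (intro mult_left_mono dist_bounded L) auto
      finally show ?thesis by (simp add: mult_ac)
    qed
    then have "norm (J (\<lambda>s. S y s - S z s) t) \<le> J (\<lambda>s. (L * dist y z) * exp (\<mu> * s)) t"
      by (intro norm_frac_int_le) (auto intro!: continuous_intros contS' simp: t)
    also have "\<dots> = (L * dist y z) * J (\<lambda>s. exp (\<mu> * s)) t" by (rule frac_int_cmult)
    finally have J_le: "norm (J (\<lambda>s. S y s - S z s) t) \<le> (L * dist y z) * J (\<lambda>s. exp (\<mu> * s)) t" .
    have "P y t - P z t = exp (- \<mu> * t) *\<^sub>R J (\<lambda>s. S y s - S z s) t"
      unfolding P_def frac_int_diff[OF t contS' contS'] by (simp add: algebra_simps)
    then have "dist (P y t) (P z t) = exp (- \<mu> * t) * norm (J (\<lambda>s. S y s - S z s) t)"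
      by (simp add: dist_norm)
    also have "\<dots> \<le> exp (- \<mu> * t) * ((L * dist y z) * J (\<lambda>s. exp (\<mu> * s)) t)"
      by (intro mult_left_mono J_le) auto
    also have "\<dots> \<le> (L * dist y z) * \<mu> powr (- \<alpha>)"
      by (rule weight) (use L t in auto)
    also have "\<dots> = dist y z * (L / \<mu> powr \<alpha>)"
      by (simp add: powr_minus_divide)
    also have "\<dots> \<le> dist y z * (1 / 2)"
      using mu by (intro mult_left_mono) (auto simp: divide_simps)
    finally show "dist (Q y t0) (Q z t0) \<le> 1 / 2 * dist y z"
      by (simp add: Q t_def)
  qed
  obtain y where y: "Q y = y"
    using banach_fix_type[of "1 / 2" Q] contraction by auto
  define x where "x = (\<lambda>t. exp (\<mu> * t) *\<^sub>R y t)"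
  have "continuous_on {0..} x" unfolding x_def by (auto intro!: continuous_intros)
  moreover have "x t = F t + J (\<lambda>s. G (x s)) t" if "0 \<le> t" for t
  proof -
    have "y t = P y t" using Q[of y t] y that by simp
    then have "x t = exp (\<mu> * t) *\<^sub>R (exp (- \<mu> * t) *\<^sub>R (F t + J (S y) t))"
      unfolding x_def P_def by simp
    also have "\<dots> = F t + J (S y) t" by (simp add: exp_minus)
    finally show ?thesis unfolding S_def x_def .
  qed
  ultimately show ?thesis using that by blast
qed

text \<open>Let \<open>t1\<close> be the first zero of \<open>x\<close> and \<open>t < t1\<close>. The hypothesis on \<open>F\<close> says that \<open>F\<close> loses at most
the factor that, by \<open>frac_int_split\<close>, the memory of \<open>[0,t]\<close> loses between \<open>t\<close> and \<open>t1\<close>. Thus only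
the influence of \<open>[t,t1]\<close> can bring \<open>x\<close> from \<open>x t\<close> down to \<open>0\<close>. If \<open>t\<close> is the maximum point of \<open>x\<close>
on a short interval before \<open>t1\<close>, this influence is less than \<open>x t / 2\<close>, whereas the fading factor
\<open>c\<close> leaves at least \<open>x t / 2\<close> to be removed.\<close>

lemma volterra_positive:
  fixes x q F :: "real \<Rightarrow> real"
  assumes T: "0 \<le> T" and x: "continuous_on {0..T} x" and q: "continuous_on {0..T} q"
    and L: "0 \<le> L" and q_range: "\<And>t. 0 \<le> t \<Longrightarrow> t \<le> T \<Longrightarrow> 0 \<le> x t \<Longrightarrow> 0 \<le> q t \<and> q t \<le> L * x t"
    and F0: "0 < F 0"
    and F_mono: "\<And>s t. 0 < s \<Longrightarrow> s \<le> t \<Longrightarrow> t \<le> T \<Longrightarrow> (s / t) powr (1 - \<alpha>) * F s \<le> F t"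
    and eq: "\<And>t. 0 \<le> t \<Longrightarrow> t \<le> T \<Longrightarrow> x t + J q t = F t"
  shows "0 < x T"
proof (rule ccontr)
  assume "\<not> 0 < x T"
  then have "x T \<notin> {0<..}" by simp
  from first_exit[OF T x open_greaterThan this]
  obtain t1 where "t1 \<in> {0..T}" "x t1 \<le> 0" and before': "\<forall>s\<in>{0..<t1}. x s \<in> {0<..}"
    by auto
  have before: "0 < x t" if "0 \<le> t" "t < t1" for t
    using before' that by auto
  have "x 0 > 0" using eq[of 0] F0 T by simp
  then have t1: "0 < t1" "t1 \<le> T" "x t1 \<le> 0"
    using \<open>t1 \<in> {0..T}\<close> \<open>x t1 \<le> 0\<close> by (auto simp: le_less)
  have x1: "continuous_on {0..t1} x" and q1: "continuous_on {0..t1} q"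
    using x q t1 by (auto intro: continuous_on_subset)
  have "x t1 = 0"
  proof (rule ccontr)
    assume "x t1 \<noteq> 0"
    then have "x t1 < 0" using t1 by auto
    then obtain s where "0 \<le> s" "s \<le> t1" "x s = 0"
      using IVT2'[of x t1 0 0] x1 \<open>x 0 > 0\<close> t1 by auto
    then show False using before[of s] \<open>x t1 \<noteq> 0\<close> by (cases "s = t1") auto
  qed
  have x_nonneg: "0 \<le> x s" if "0 \<le> s" "s \<le> t1" for s
    using before[of s] \<open>x t1 = 0\<close> that by (cases "s = t1") auto
  have q1_range: "0 \<le> q s" "q s \<le> L * x s" if "0 \<le> s" "s \<le> t1" for s
    using q_range[of s] x_nonneg[of s] that t1 by auto
  \<comment> \<open>The stretch of length \<open>d\<close> before \<open>t1\<close> can remove less than half of the maximum of \<open>x\<close> on it.\<close>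
  have "((\<lambda>d. L * d powr \<alpha> / Gamma (\<alpha> + 1)) \<longlongrightarrow> L * 0 powr \<alpha> / Gamma (\<alpha> + 1)) (at_right 0)"
    using pos Gamma_nonzero by (intro tendsto_intros tendsto_powr') (auto simp: eventually_at_filter)
  then have "eventually (\<lambda>d. L * d powr \<alpha> / Gamma (\<alpha> + 1) < 1 / 2) (at_right 0)"
    by (rule order_tendstoD) auto
  moreover have "eventually (\<lambda>d. d \<in> {0<..<t1 / 2}) (at_right 0)"
    by (rule eventually_at_right_real) (use t1 in auto)
  ultimately have "eventually (\<lambda>d. L * d powr \<alpha> / Gamma (\<alpha> + 1) < 1 / 2 \<and> d \<in> {0<..<t1 / 2}) (at_right (0::real))"
    by (rule eventually_conj)
  then obtain d where d: "L * d powr \<alpha> / Gamma (\<alpha> + 1) < 1 / 2" "0 < d" "d < t1 / 2"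
    using eventually_happens[of _ "at_right (0::real)"] by auto
  have "continuous_on {t1 - d..t1} x" using x1 by (rule continuous_on_subset) (use d in auto)
  from continuous_attains_sup[OF _ _ this] d
  obtain t where t: "t1 - d \<le> t" "t \<le> t1" and max: "\<And>s. t1 - d \<le> s \<Longrightarrow> s \<le> t1 \<Longrightarrow> x s \<le> x t" by auto
  have "0 < x (t1 - d)" using before[of "t1 - d"] d by auto
  then have xt: "0 < x t" using max[of "t1 - d"] d by auto
  have t0: "0 < t" using t d by auto
  define c where "c = (t / t1) powr (1 - \<alpha>)"
  have "F t1 = J q t1" using eq[of t1] \<open>x t1 = 0\<close> t1 by auto
  also have "\<dots> \<le> c * J q t + (L * x t) * (t1 - t) powr \<alpha> / Gamma (\<alpha> + 1)"
    unfolding c_def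
  proof (rule frac_int_split[OF t0 t(2) q1])
    fix s assume s: "t \<le> s" "s \<le> t1"
    then have "q s \<le> L * x s" using q1_range[of s] t0 by auto
    also have "\<dots> \<le> L * x t" using max[of s] s t L by (intro mult_left_mono) auto
    finally show "q s \<le> L * x t" .
  qed (use q1_range in auto)
  also have "J q t = F t - x t" using eq[of t] t t1 t0 by auto
  finally have "c * x t \<le> c * F t - F t1 + (L * x t) * (t1 - t) powr \<alpha> / Gamma (\<alpha> + 1)"
    by (simp add: algebra_simps)
  also have "\<dots> \<le> (L * x t) * (t1 - t) powr \<alpha> / Gamma (\<alpha> + 1)"
    using F_mono[of t t1] t t0 t1 unfolding c_def by auto
  also have "\<dots> \<le> (L * x t) * d powr \<alpha> / Gamma (\<alpha> + 1)"
    using L xt Gamma_pos t pos by (intro divide_right_mono mult_left_mono powr_mono2) auto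
  also have "\<dots> = x t * (L * d powr \<alpha> / Gamma (\<alpha> + 1))" by simp
  also have "\<dots> < x t * (1 / 2)" using d xt by (intro mult_strict_left_mono) auto
  finally have "c < 1 / 2" using xt by (simp add: mult.commute)
  have "1 / 2 \<le> t / t1" using t d t1 by (simp add: field_simps)
  then have "1 / 2 \<le> (1 / 2 :: real) powr (1 - \<alpha>)"
    using powr_mono'[of "1 - \<alpha>" 1 "1 / 2 :: real"] pos by auto
  also have "\<dots> \<le> c" unfolding c_def using \<open>1 / 2 \<le> t / t1\<close> less_one by (intro powr_mono2) auto
  finally show False using \<open>c < 1 / 2\<close> by auto
qed

end

section \<open>Comparison with fractional relaxation\<close>

context fractional_order
begin

lemma frac_int_delay:
  fixes r :: "real \<Rightarrow> real"
  assumes s: "0 \<le> s" "s \<le> t" and r0: "\<And>u. u \<le> 0 \<Longrightarrow> r u = 0"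
  shows "J (\<lambda>u. r (u - s)) t = J r (t - s)"
proof -
  define k where "k = (\<lambda>u. (t - u) powr (\<alpha> - 1) * r (u - s))"
  have "integral {0..t} k = integral {s..t} k"
    by (rule integral_spike_set; rule negligible_subset[of "{}"])
       (use s r0 in \<open>auto simp: k_def\<close>)
  also have "\<dots> = integral {0..t - s} (\<lambda>u. k (u + s))"
    using integral_shift_real_ivl[of s s t k] by simp
  also have "\<dots> = integral {0..t - s} (\<lambda>u. (t - s - u) powr (\<alpha> - 1) * r u)"
    unfolding k_def by (simp add: algebra_simps)
  finally show ?thesis unfolding frac_int_def k_def by simp
qed

text \<open>Since \<open>R 0 = 0\<close>, extending \<open>R\<close> by \<open>0\<close> to negative times is continuous. The range of integration
then no longer depends on \<open>u\<close>.\<close>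

lemma conv_eq_fixed_window:
  fixes R p :: "real \<Rightarrow> real"
  assumes u: "0 \<le> u" "u \<le> T" and R0: "R 0 = 0"
  shows "integral {0..u} (\<lambda>s. R (u - s) * p s) = integral {0..T} (\<lambda>s. R (max 0 (u - s)) * p s)"
proof -
  have "integral {0..T} (\<lambda>s. R (max 0 (u - s)) * p s) = integral {0..u} (\<lambda>s. R (max 0 (u - s)) * p s)"
    by (rule integral_spike_set; rule negligible_subset[of "{}"])
       (use u R0 in \<open>auto simp: max_def split: if_splits\<close>)
  also have "\<dots> = integral {0..u} (\<lambda>s. R (u - s) * p s)"
    by (rule integral_cong) auto
  finally show ?thesis by simp
qed

text \<open>Time-invariance: \<open>J\<close> commutes with delays, hence also with superpositions of delays, that is, with
convolutions. In the regularised form of \<open>J\<close> the integrals of a continuous function over a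
rectangle are exchanged.\<close>

lemma
  fixes R p :: "real \<Rightarrow> real"
  assumes T: "0 \<le> T" and R: "continuous_on {0..} R" "R 0 = 0" and p: "continuous_on {0..} p"
  shows continuous_on_conv: "continuous_on {0..T} (\<lambda>u. integral {0..u} (\<lambda>s. R (u - s) * p s))"
    and frac_int_conv: "J (\<lambda>u. integral {0..u} (\<lambda>s. R (u - s) * p s)) T = integral {0..T} (\<lambda>s. J R (T - s) * p s)"
proof -
  define r where "r = (\<lambda>u. R (max 0 u))"
  define z where "z = (\<lambda>u. integral {0..u} (\<lambda>s. R (u - s) * p s))"
  define \<tau> where "\<tau> = (\<lambda>\<rho>. T * (1 - \<rho> powr (1 / \<alpha>)))"
  have z: "z u = integral {0..T} (\<lambda>s. r (u - s) * p s)" if "0 \<le> u" "u \<le> T" for u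
    unfolding z_def r_def using conv_eq_fixed_window[where R = R, OF that R(2)] .
  have contr: "continuous_on UNIV r"
    unfolding r_def by (rule continuous_on_compose2[OF R(1)]) (auto intro!: continuous_intros)
  have contp: "continuous_on {0..T} p" using p by (rule continuous_on_subset) auto
  have "continuous_on {0..T} (\<lambda>u. integral (cbox 0 T) (\<lambda>s. r (u - s) * p s))"
    by (rule integral_continuous_on_param)
       (auto simp: case_prod_unfold intro!: continuous_intros continuous_on_compose2[OF contr]
         continuous_on_compose2[OF contp])
  then have contz: "continuous_on {0..T} z"
    by (rule continuous_on_eq) (use z in auto)
  then show "continuous_on {0..T} (\<lambda>u. integral {0..u} (\<lambda>s. R (u - s) * p s))"
    unfolding z_def .
  have cont\<tau>: "continuous_on {0..1} \<tau>"
    unfolding \<tau>_def using pos by (auto intro!: continuous_intros continuous_on_powr')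
  have \<tau>_range: "\<tau> \<rho> \<in> {0..T}" if "\<rho> \<in> {0..1}" for \<rho>
    unfolding \<tau>_def using reparam_range that T by auto
  define c where "c = T powr \<alpha> / Gamma (\<alpha> + 1)"
  have contr2: "continuous_on {0..T} (\<lambda>u. r (u - s))" for s
    by (auto intro!: continuous_intros continuous_on_compose2[OF contr])
  have "J z T = c * integral {0..1} (\<lambda>\<rho>. z (\<tau> \<rho>))"
    unfolding frac_int_regularised[OF T contz] c_def \<tau>_def by simp
  also have "integral {0..1} (\<lambda>\<rho>. z (\<tau> \<rho>)) = integral {0..1} (\<lambda>\<rho>. integral {0..T} (\<lambda>s. r (\<tau> \<rho> - s) * p s))"
    by (rule integral_cong) (use z \<tau>_range in auto)
  also have "\<dots> = integral {0..T} (\<lambda>s. integral {0..1} (\<lambda>\<rho>. r (\<tau> \<rho> - s) * p s))"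
  proof -
    have "continuous_on (cbox (0, 0) (1, T)) (\<lambda>(\<rho>, s). r (\<tau> \<rho> - s) * p s)"
      unfolding case_prod_unfold
      by (intro continuous_intros continuous_on_compose2[OF contr] continuous_on_compose2[OF contp]
          continuous_on_compose2[OF cont\<tau>]) (auto simp: cbox_Pair_eq)
    from integral_swap_continuous[OF this] show ?thesis by simp
  qed
  also have "\<dots> = integral {0..T} (\<lambda>s. integral {0..1} (\<lambda>\<rho>. r (\<tau> \<rho> - s)) * p s)"
    by simp
  also have "c * \<dots> = integral {0..T} (\<lambda>s. (c * integral {0..1} (\<lambda>\<rho>. r (\<tau> \<rho> - s))) * p s)"
    by (subst integral_mult_right[symmetric]) (simp only: mult.assoc)
  also have "\<dots> = integral {0..T} (\<lambda>s. J R (T - s) * p s)"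
  proof (rule integral_cong)
    fix s assume s: "s \<in> {0..T}"
    have "c * integral {0..1} (\<lambda>\<rho>. r (\<tau> \<rho> - s)) = J (\<lambda>u. r (u - s)) T"
      unfolding frac_int_regularised[OF T contr2] c_def \<tau>_def by simp
    also have "\<dots> = J r (T - s)"
      by (rule frac_int_delay) (use s R(2) in \<open>auto simp: r_def\<close>)
    also have "\<dots> = J R (T - s)"
      by (rule frac_int_cong) (auto simp: r_def)
    finally show "c * integral {0..1} (\<lambda>\<rho>. r (\<tau> \<rho> - s)) * p s = J R (T - s) * p s" by simp
  qed
  finally show "J (\<lambda>u. integral {0..u} (\<lambda>s. R (u - s) * p s)) T = integral {0..T} (\<lambda>s. J R (T - s) * p s)"
    unfolding z_def .
qed

text \<open>On \<open>[0,\<infinity>)\<close> this is the Mittag-Leffler function \<open>E_\<alpha>(- \<kappa> * t powr \<alpha>)\<close>. It is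
characterised by its integral equation, from which positivity, monotonicity and the rate of decay
are derived below.\<close>

definition relaxation :: "real \<Rightarrow> (real \<Rightarrow> real) \<Rightarrow> bool" where
  "relaxation \<kappa> e \<longleftrightarrow> continuous_on {0..} e \<and> (\<forall>t\<ge>0. e t = 1 - \<kappa> * J e t)"

lemma linear_solution_exists:
  fixes F :: "real \<Rightarrow> real"
  assumes "continuous_on {0..} F" "\<And>t. 0 \<le> t \<Longrightarrow> \<bar>F t\<bar> \<le> C" "0 \<le> \<kappa>"
  obtains x where "continuous_on {0..} x" "\<And>t. 0 \<le> t \<Longrightarrow> x t = F t - \<kappa> * J x t"
proof -
  have "\<bar>- \<kappa> * x - - \<kappa> * y\<bar> \<le> \<kappa> * \<bar>x - y\<bar>" for x y :: real
    using assms(3) by (simp add: abs_mult flip: right_diff_distrib') (simp add: abs_minus_commute)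
  then obtain x where "continuous_on {0..} x" "\<And>t. 0 \<le> t \<Longrightarrow> x t = F t + J (\<lambda>s. - \<kappa> * x s) t"
    using solution_exists[of F C \<kappa> "\<lambda>x. - \<kappa> * x"] assms by auto
  then show ?thesis using that frac_int_cmult[of "- \<kappa>"] by auto
qed

lemma relaxation_exists:
  assumes "0 \<le> \<kappa>" obtains e where "relaxation \<kappa> e"
  using linear_solution_exists[of "\<lambda>_. 1" 1 \<kappa>] assms unfolding relaxation_def by auto

lemma linear_positive:
  fixes x F :: "real \<Rightarrow> real"
  assumes x: "continuous_on {0..} x" "\<And>t. 0 \<le> t \<Longrightarrow> x t = F t - \<kappa> * J x t" and lam: "0 \<le> \<kappa>"
    and F0: "0 < F 0"
    and F_mono: "\<And>s t. 0 < s \<Longrightarrow> s \<le> t \<Longrightarrow> (s / t) powr (1 - \<alpha>) * F s \<le> F t"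
    and t: "0 \<le> t"
  shows "0 < x t"
proof (rule volterra_positive[OF t, where q = "\<lambda>s. \<kappa> * x s" and F = F and L = \<kappa>])
  have "continuous_on {0..t} x" using x(1) by (rule continuous_on_subset) auto
  then show "continuous_on {0..t} x" "continuous_on {0..t} (\<lambda>s. \<kappa> * x s)"
    by (auto intro!: continuous_intros)
  show "x s + J (\<lambda>s. \<kappa> * x s) s = F s" if "0 \<le> s" for s
    using x(2)[OF that] by (simp add: frac_int_cmult)
qed (use assms in auto)

lemma relaxation_pos:
  assumes e: "relaxation \<kappa> e" and lam: "0 \<le> \<kappa>" and t: "0 \<le> t"
  shows "0 < e t"
  by (rule linear_positive[of e "\<lambda>_. 1" \<kappa>])
     (use e lam t less_one in \<open>auto simp: relaxation_def intro!: powr_le1\<close>)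

text \<open>For \<open>t > 0\<close> this is the kernel \<open>t powr (\<alpha> - 1)\<close> damped by the factor \<open>(t / (t + a)) powr (2 - \<alpha>)\<close>,
which increases to \<open>1\<close> as \<open>a \<rightarrow> 0\<close>. The exponent \<open>2 - \<alpha>\<close> makes it vanish continuously at \<open>0\<close>,
and since the factor increases in \<open>t\<close> it decays no faster than the kernel itself.\<close>

definition soft_kernel :: "real \<Rightarrow> real \<Rightarrow> real" where
  "soft_kernel a t = t * (t + a) powr (\<alpha> - 2)"

lemma continuous_on_soft_kernel: "0 < a \<Longrightarrow> continuous_on {0..} (soft_kernel a)"
  unfolding soft_kernel_def by (intro continuous_intros) auto

lemma soft_kernel_eq:
  assumes "0 < a" "0 < t"
  shows "soft_kernel a t = t powr (\<alpha> - 1) * (t / (t + a)) powr (2 - \<alpha>)"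
proof -
  have "(t / (t + a)) powr (2 - \<alpha>) = t powr (2 - \<alpha>) * (t + a) powr (\<alpha> - 2)"
    using assms powr_minus_divide[of "t + a" "2 - \<alpha>"] by (simp add: powr_divide)
  moreover have "t powr (\<alpha> - 1) * t powr (2 - \<alpha>) = t"
    using assms by (simp flip: powr_add)
  ultimately show ?thesis unfolding soft_kernel_def by (simp flip: mult.assoc)
qed

lemma soft_kernel_mono:
  assumes a: "0 < a" and st: "0 < s" "s \<le> t"
  shows "(s / t) powr (1 - \<alpha>) * soft_kernel a s \<le> soft_kernel a t"
proof -
  have st': "(s / t) powr (1 - \<alpha>) * s powr (\<alpha> - 1) = t powr (\<alpha> - 1)"
  proof -
    have 1: "(s / t) powr (1 - \<alpha>) = s powr (1 - \<alpha>) * t powr (\<alpha> - 1)"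
      using st powr_minus_divide[of t "1 - \<alpha>"] by (simp add: powr_divide)
    have 2: "s powr (1 - \<alpha>) * s powr (\<alpha> - 1) = 1" using st by (simp flip: powr_add)
    have "(s / t) powr (1 - \<alpha>) * s powr (\<alpha> - 1) = (s powr (1 - \<alpha>) * s powr (\<alpha> - 1)) * t powr (\<alpha> - 1)"
      unfolding 1 by (simp only: mult_ac)
    then show ?thesis unfolding 2 by simp
  qed
  have "s / (s + a) \<le> t / (t + a)"
    using a st by (simp add: divide_simps distrib_left mult.commute)
  then have "(s / (s + a)) powr (2 - \<alpha>) \<le> (t / (t + a)) powr (2 - \<alpha>)"
    using a st less_one by (intro powr_mono2) auto
  then have "t powr (\<alpha> - 1) * (s / (s + a)) powr (2 - \<alpha>) \<le> t powr (\<alpha> - 1) * (t / (t + a)) powr (2 - \<alpha>)"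
    by (intro mult_left_mono) auto
  then show ?thesis
    using soft_kernel_eq[OF a st(1)] soft_kernel_eq[OF a, of t] st st'
    by (simp flip: mult.assoc)
qed

lemma soft_kernel_range:
  assumes a: "0 < a" and t: "0 \<le> t"
  shows "0 \<le> soft_kernel a t" "soft_kernel a t \<le> t powr (\<alpha> - 1)" "soft_kernel a t \<le> a powr (\<alpha> - 1)"
proof -
  show "0 \<le> soft_kernel a t" using assms unfolding soft_kernel_def by auto
  show "soft_kernel a t \<le> t powr (\<alpha> - 1)"
  proof (cases "t = 0")
    case False
    have "(t / (t + a)) powr (2 - \<alpha>) \<le> 1" using assms less_one by (intro powr_le1) auto
    then show ?thesis
      using soft_kernel_eq[OF a, of t] False t mult_left_le[of "(t / (t + a)) powr (2 - \<alpha>)" "t powr (\<alpha> - 1)"] by auto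
  qed (simp add: soft_kernel_def)
  have "soft_kernel a t \<le> (t + a) * (t + a) powr (\<alpha> - 2)"
    unfolding soft_kernel_def using assms by (intro mult_right_mono) auto
  also have "\<dots> = (t + a) powr (\<alpha> - 1)"
    using powr_mult_base[of "t + a" "\<alpha> - 2"] assms by simp
  also have "\<dots> \<le> a powr (\<alpha> - 1)"
    using assms less_one by (intro powr_mono2') auto
  finally show "soft_kernel a t \<le> a powr (\<alpha> - 1)" .
qed

lemma soft_kernel_has_integral:
  assumes a: "0 < a" and t: "0 \<le> t"
  shows "((\<lambda>s. soft_kernel a (t - s)) has_integral
     ((t + a) powr \<alpha> - a powr \<alpha>) / \<alpha> - a * ((t + a) powr (\<alpha> - 1) - a powr (\<alpha> - 1)) / (\<alpha> - 1)) {0..t}"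
proof -
  define P where "P = (\<lambda>s. - ((t - s + a) powr \<alpha> / \<alpha> - a * (t - s + a) powr (\<alpha> - 1) / (\<alpha> - 1)))"
  have "((\<lambda>s. soft_kernel a (t - s)) has_integral (P t - P 0)) {0..t}"
  proof (rule fundamental_theorem_of_calculus[OF t])
    fix s assume s: "s \<in> {0..t}"
    have b: "0 < t - s + a" using s a by auto
    have D: "((\<lambda>s. (t - s + a) powr \<beta>) has_real_derivative - (\<beta> * (t - s + a) powr (\<beta> - 1))) (at s)" for \<beta>
      using b by (auto intro!: derivative_eq_intros)
    have "(P has_real_derivative - (- (\<alpha> * (t - s + a) powr (\<alpha> - 1)) / \<alpha>
        - a * - ((\<alpha> - 1) * (t - s + a) powr (\<alpha> - 1 - 1)) / (\<alpha> - 1))) (at s)"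
      unfolding P_def by (intro DERIV_minus DERIV_diff DERIV_cdivide DERIV_cmult D)
    moreover have "- (- (\<alpha> * (t - s + a) powr (\<alpha> - 1)) / \<alpha>
        - a * - ((\<alpha> - 1) * (t - s + a) powr (\<alpha> - 1 - 1)) / (\<alpha> - 1))
        = (t - s + a) powr (\<alpha> - 1) - a * (t - s + a) powr (\<alpha> - 2)"
      using pos less_one by simp
    ultimately have "(P has_real_derivative (t - s + a) powr (\<alpha> - 1) - a * (t - s + a) powr (\<alpha> - 2)) (at s)"
      by simp
    moreover have "(t - s + a) powr (\<alpha> - 1) - a * (t - s + a) powr (\<alpha> - 2) = soft_kernel a (t - s)"
      using powr_mult_base[of "t - s + a" "\<alpha> - 2"] b
      unfolding soft_kernel_def by (simp add: algebra_simps)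
    ultimately show "(P has_vector_derivative soft_kernel a (t - s)) (at s within {0..t})"
      by (simp add: has_real_derivative_iff_has_vector_derivative has_vector_derivative_at_within)
  qed
  moreover have "P t - P 0 = ((t + a) powr \<alpha> - a powr \<alpha>) / \<alpha> - a * ((t + a) powr (\<alpha> - 1) - a powr (\<alpha> - 1)) / (\<alpha> - 1)"
    unfolding P_def by (simp add: diff_divide_distrib right_diff_distrib)
  ultimately show ?thesis by simp
qed

text \<open>The soft kernel lies below the true one, and the integral of the difference is explicit and of order
\<open>a powr \<alpha>\<close> uniformly in \<open>t\<close>.\<close>

lemma soft_kernel_deficit:
  assumes a: "0 < a" and t: "0 \<le> t" and p: "continuous_on {0..t} p"
    and p_range: "\<And>s. 0 \<le> s \<Longrightarrow> s \<le> t \<Longrightarrow> 0 \<le> p s \<and> p s \<le> M" and M: "0 \<le> M"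
  shows "\<bar>integral {0..t} (\<lambda>s. soft_kernel a (t - s) * p s) - Gamma \<alpha> * J p t\<bar>
          \<le> M * (1 / \<alpha> + 1 / (1 - \<alpha>)) * a powr \<alpha>"
proof -
  define k where "k = (\<lambda>s. (t - s) powr (\<alpha> - 1))"
  have cont: "continuous_on {0..t} (\<lambda>s. soft_kernel a (t - s))"
    by (rule continuous_on_compose2[OF continuous_on_soft_kernel[OF a]]) (auto intro!: continuous_intros)
  have k_int: "((\<lambda>s. k s) has_integral (t powr \<alpha> / \<alpha>)) {0..t}"
    using kernel_has_integral[OF t, of "\<lambda>_. 1::real"] unfolding k_def by simp
  have kp: "(\<lambda>s. k s * p s) integrable_on {0..t}"
    using kernel_integrable[OF t p] unfolding k_def by simp
  have sp: "(\<lambda>s. soft_kernel a (t - s) * p s) integrable_on {0..t}"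
    by (intro integrable_continuous_interval continuous_intros cont p)
  have le: "soft_kernel a (t - s) \<le> k s" if "0 \<le> s" "s \<le> t" for s
    using soft_kernel_range(2)[OF a, of "t - s"] that unfolding k_def by auto
  have "integral {0..t} (\<lambda>s. k s * p s) - integral {0..t} (\<lambda>s. soft_kernel a (t - s) * p s)
      = integral {0..t} (\<lambda>s. k s * p s - soft_kernel a (t - s) * p s)"
    by (rule integral_diff[OF kp sp, symmetric])
  also have "\<dots> = integral {0..t} (\<lambda>s. (k s - soft_kernel a (t - s)) * p s)"
    by (simp add: left_diff_distrib)
  finally have eq: "integral {0..t} (\<lambda>s. k s * p s) - integral {0..t} (\<lambda>s. soft_kernel a (t - s) * p s)
      = integral {0..t} (\<lambda>s. (k s - soft_kernel a (t - s)) * p s)" .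
  have int1: "(\<lambda>s. (k s - soft_kernel a (t - s)) * p s) integrable_on {0..t}"
    unfolding left_diff_distrib by (rule integrable_diff[OF kp sp])
  have int2: "((\<lambda>s. M * (k s - soft_kernel a (t - s))) has_integral
      M * (t powr \<alpha> / \<alpha> - (((t + a) powr \<alpha> - a powr \<alpha>) / \<alpha> - a * ((t + a) powr (\<alpha> - 1) - a powr (\<alpha> - 1)) / (\<alpha> - 1)))) {0..t}"
    by (intro has_integral_mult_right has_integral_diff k_int soft_kernel_has_integral a t)
  have ge: "0 \<le> integral {0..t} (\<lambda>s. (k s - soft_kernel a (t - s)) * p s)"
    by (rule integral_nonneg[OF int1]) (use le p_range in auto)
  have "integral {0..t} (\<lambda>s. (k s - soft_kernel a (t - s)) * p s) \<le>
     M * (t powr \<alpha> / \<alpha> - (((t + a) powr \<alpha> - a powr \<alpha>) / \<alpha> - a * ((t + a) powr (\<alpha> - 1) - a powr (\<alpha> - 1)) / (\<alpha> - 1)))"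
    using integrable_integral[OF int1] int2
  proof (rule has_integral_le)
    fix s assume "s \<in> {0..t}"
    then show "(k s - soft_kernel a (t - s)) * p s \<le> M * (k s - soft_kernel a (t - s))"
      using le[of s] p_range[of s] by (subst mult.commute, intro mult_right_mono) auto
  qed
  also have "\<dots> \<le> M * ((1 / \<alpha> + 1 / (1 - \<alpha>)) * a powr \<alpha>)"
  proof (rule mult_left_mono[OF _ M])
    have "t powr \<alpha> \<le> (t + a) powr \<alpha>" using a t pos by (intro powr_mono2) auto
    then have 1: "t powr \<alpha> / \<alpha> - ((t + a) powr \<alpha> - a powr \<alpha>) / \<alpha> \<le> (1 / \<alpha>) * a powr \<alpha>"
      using pos by (simp add: divide_simps)
    have "a * ((t + a) powr (\<alpha> - 1) - a powr (\<alpha> - 1)) / (\<alpha> - 1)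
        = (a * a powr (\<alpha> - 1) - a * (t + a) powr (\<alpha> - 1)) / (1 - \<alpha>)"
      using less_one by (simp add: divide_simps) (simp add: algebra_simps)
    also have "\<dots> \<le> (a * a powr (\<alpha> - 1)) / (1 - \<alpha>)"
      using less_one a t by (intro divide_right_mono) auto
    also have "\<dots> = (1 / (1 - \<alpha>)) * a powr \<alpha>"
      using powr_mult_base[of a "\<alpha> - 1"] a by simp
    finally have 2: "a * ((t + a) powr (\<alpha> - 1) - a powr (\<alpha> - 1)) / (\<alpha> - 1) \<le> (1 / (1 - \<alpha>)) * a powr \<alpha>" .
    show "t powr \<alpha> / \<alpha> - (((t + a) powr \<alpha> - a powr \<alpha>) / \<alpha> - a * ((t + a) powr (\<alpha> - 1) - a powr (\<alpha> - 1)) / (\<alpha> - 1)) \<le> (1 / \<alpha> + 1 / (1 - \<alpha>)) * a powr \<alpha>"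
      using 1 2 unfolding distrib_right by linarith
  qed
  moreover have "Gamma \<alpha> * J p t = integral {0..t} (\<lambda>s. k s * p s)"
    unfolding frac_int_def k_def using Gamma_nonzero by simp
  ultimately show ?thesis using eq ge by (simp add: mult.assoc abs_if)
qed

text \<open>As \<open>soft_kernel a\<close> vanishes at \<open>0\<close>, positivity is first obtained for the inhomogeneity
\<open>soft_kernel a + \<epsilon>\<close>, whose response is \<open>R + \<epsilon> * e\<close> with the relaxation function \<open>e\<close>.\<close>

lemma soft_kernel_response:
  assumes a: "0 < a" and lam: "0 \<le> \<kappa>"
  obtains R where "continuous_on {0..} R" "\<And>t. 0 \<le> t \<Longrightarrow> R t = soft_kernel a t - \<kappa> * J R t"
    "\<And>t. 0 \<le> t \<Longrightarrow> 0 \<le> R t"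
proof -
  obtain R where R: "continuous_on {0..} R" "\<And>t. 0 \<le> t \<Longrightarrow> R t = soft_kernel a t - \<kappa> * J R t"
  proof (rule linear_solution_exists[of "soft_kernel a" "a powr (\<alpha> - 1)" \<kappa>])
    show "\<bar>soft_kernel a t\<bar> \<le> a powr (\<alpha> - 1)" if "0 \<le> t" for t
      using soft_kernel_range[OF a that] by auto
  qed (use continuous_on_soft_kernel a lam in auto)
  obtain e where e: "relaxation \<kappa> e" using relaxation_exists[OF lam] .
  have "0 \<le> R t" if t: "0 \<le> t" for t
  proof (rule ccontr)
    assume "\<not> 0 \<le> R t"
    \<comment> \<open>So small that \<open>R t + \<epsilon> * e t\<close> is still negative.\<close>
    define \<epsilon> where "\<epsilon> = - R t / (2 * e t)"
    have et: "0 < e t" by (rule relaxation_pos[OF e lam t])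
    have eps: "0 < \<epsilon>" unfolding \<epsilon>_def using \<open>\<not> 0 \<le> R t\<close> et by (simp add: divide_neg_pos)
    have "0 < R t + \<epsilon> * e t"
    proof (rule linear_positive[where x = "\<lambda>s. R s + \<epsilon> * e s" and F = "\<lambda>s. soft_kernel a s + \<epsilon>" and \<kappa> = \<kappa>])
      show "continuous_on {0..} (\<lambda>s. R s + \<epsilon> * e s)"
        using R e unfolding relaxation_def by (auto intro!: continuous_intros)
      fix s :: real assume s: "0 \<le> s"
      have "J (\<lambda>s. R s + \<epsilon> * e s) s = J R s + \<epsilon> * J e s"
        using R(1) e s unfolding relaxation_def
        by (subst frac_int_add) (auto intro!: continuous_intros simp: frac_int_cmult intro: continuous_on_subset)
      moreover have "e s = 1 - \<kappa> * J e s" using e s unfolding relaxation_def by auto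
      then have "R s + \<epsilon> * e s = soft_kernel a s - \<kappa> * J R s + \<epsilon> * (1 - \<kappa> * J e s)"
        using R(2)[OF s] by simp
      ultimately show "R s + \<epsilon> * e s = soft_kernel a s + \<epsilon> - \<kappa> * J (\<lambda>s. R s + \<epsilon> * e s) s"
        by (simp add: algebra_simps)
    next
      fix s t :: real assume st: "0 < s" "s \<le> t"
      have "(s / t) powr (1 - \<alpha>) \<le> 1" using st less_one by (intro powr_le1) auto
      then have "(s / t) powr (1 - \<alpha>) * \<epsilon> \<le> \<epsilon>" using eps by simp
      then show "(s / t) powr (1 - \<alpha>) * (soft_kernel a s + \<epsilon>) \<le> soft_kernel a t + \<epsilon>"
        using soft_kernel_mono[OF a st] by (simp add: distrib_left)
    qed (use lam t eps in \<open>auto simp: soft_kernel_def\<close>)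
    then show False unfolding \<epsilon>_def using et \<open>\<not> 0 \<le> R t\<close> by (simp add: field_simps)
  qed
  then show ?thesis using that R by blast
qed

text \<open>By linearity the contribution \<open>b * e\<close> of the constant, which is nonnegative, can be subtracted. The
remainder, scaled by \<open>Gamma \<alpha>\<close>, is the response \<open>W\<close> to the convolution of \<open>p\<close> with the kernel.
Replacing the kernel by a soft one gives the response \<open>z\<close>, a convolution of nonnegative functions.
By the Gronwall inequality \<open>W\<close> and \<open>z\<close> differ by \<open>O(a powr \<alpha>)\<close>.\<close>

lemma comparison:
  fixes w p :: "real \<Rightarrow> real"
  assumes w: "continuous_on {0..} w" and p: "continuous_on {0..} p"
    and p_nonneg: "\<And>t. 0 \<le> t \<Longrightarrow> 0 \<le> p t" and b: "0 \<le> b" and lam: "0 \<le> \<kappa>"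
    and eq: "\<And>t. 0 \<le> t \<Longrightarrow> w t = b + J (\<lambda>s. p s - \<kappa> * w s) t"
    and T: "0 \<le> T"
  shows "0 \<le> w T"
proof -
  obtain e where e: "relaxation \<kappa> e" using relaxation_exists[OF lam] .
  have conte: "continuous_on {0..} e" and eq_e: "\<And>t. 0 \<le> t \<Longrightarrow> e t = 1 - \<kappa> * J e t"
    using e unfolding relaxation_def by auto
  define W where "W = (\<lambda>t. Gamma \<alpha> * (w t - b * e t))"
  have contW: "continuous_on {0..} W"
    unfolding W_def by (intro continuous_intros w conte)
  have sub: "continuous_on {0..t} f" if "continuous_on {0..} f" for f :: "real \<Rightarrow> real" and t
    by (rule continuous_on_subset[OF that]) auto
  have eq_W: "W t = Gamma \<alpha> * J p t - \<kappa> * J W t" if t: "0 \<le> t" for t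
  proof -
    have JW: "J W t = Gamma \<alpha> * (J w t - b * J e t)"
      unfolding W_def frac_int_cmult
      by (subst frac_int_diff) (auto simp: frac_int_cmult t intro!: continuous_intros sub w conte)
    have w: "w t = b + (J p t - \<kappa> * J w t)"
      unfolding eq[OF t]
      by (subst frac_int_diff) (auto simp: frac_int_cmult t intro!: continuous_intros sub w p)
    have "W t = Gamma \<alpha> * (b + (J p t - \<kappa> * J w t) - b * (1 - \<kappa> * J e t))"
      unfolding W_def w[symmetric] eq_e[OF t, symmetric] by (rule refl)
    then show ?thesis
      unfolding JW by (simp add: algebra_simps)
  qed
  have "continuous_on {0..T} p" by (rule sub[OF p])
  from continuous_attains_sup[OF _ _ this] T
  obtain tm where "tm \<in> {0..T}" "\<And>s. s \<in> {0..T} \<Longrightarrow> p s \<le> p tm" by auto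
  then obtain M where M: "0 \<le> M" "\<And>s. s \<in> {0..T} \<Longrightarrow> p s \<le> M" using p_nonneg[of tm] by auto
  obtain \<mu> where mu: "0 < \<mu>" "2 * \<kappa> \<le> \<mu> powr \<alpha>" using gronwall_exponent[OF lam] .
  define c where "c = 2 * (M * (1 / \<alpha> + 1 / (1 - \<alpha>))) * exp (\<mu> * T)"
  have W_ge: "- (c * a powr \<alpha>) \<le> W T" if a: "0 < a" for a
  proof -
    obtain R where R: "continuous_on {0..} R" "\<And>t. 0 \<le> t \<Longrightarrow> R t = soft_kernel a t - \<kappa> * J R t"
      "\<And>t. 0 \<le> t \<Longrightarrow> 0 \<le> R t"
      using soft_kernel_response[OF a lam] by blast
    have R0: "R 0 = 0" using R(2)[of 0] by (simp add: soft_kernel_def)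
    define z where "z = (\<lambda>u. integral {0..u} (\<lambda>s. R (u - s) * p s))"
    define \<epsilon> where "\<epsilon> = M * (1 / \<alpha> + 1 / (1 - \<alpha>)) * a powr \<alpha>"
    have contz: "continuous_on {0..t} z" if "0 \<le> t" for t
      unfolding z_def by (rule continuous_on_conv[OF that R(1) R0 p])
    have rev: "continuous_on {0..t} (\<lambda>s. f (t - s))" if "continuous_on {0..} f" for f :: "real \<Rightarrow> real" and t
      by (rule continuous_on_compose2[OF that]) (auto intro!: continuous_intros)
    have z_nonneg: "0 \<le> z t" for t
      unfolding z_def
    proof (rule integral_nonneg)
      show "(\<lambda>s. R (t - s) * p s) integrable_on {0..t}"
        by (intro integrable_continuous_interval continuous_on_mult rev R sub p)
      show "0 \<le> R (t - s) * p s" if "s \<in> {0..t}" for s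
        using that R(3)[of "t - s"] p_nonneg[of s] by auto
    qed
    have eq_z: "z t = integral {0..t} (\<lambda>s. soft_kernel a (t - s) * p s) - \<kappa> * J z t" if t: "0 \<le> t" for t
    proof -
      have "z t + \<kappa> * J z t = integral {0..t} (\<lambda>s. R (t - s) * p s) + integral {0..t} (\<lambda>s. \<kappa> * (J R (t - s) * p s))"
        unfolding z_def frac_int_conv[OF t R(1) R0 p] by simp
      also have "\<dots> = integral {0..t} (\<lambda>s. R (t - s) * p s + \<kappa> * (J R (t - s) * p s))"
        by (rule integral_add[symmetric])
           (intro integrable_continuous_interval continuous_on_mult continuous_on_const rev R sub p
              continuous_on_frac_int)+
      also have "\<dots> = integral {0..t} (\<lambda>s. soft_kernel a (t - s) * p s)"
      proof (rule integral_cong)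
        fix s assume "s \<in> {0..t}"
        then have "soft_kernel a (t - s) = R (t - s) + \<kappa> * J R (t - s)" using R(2)[of "t - s"] by simp
        then show "R (t - s) * p s + \<kappa> * (J R (t - s) * p s) = soft_kernel a (t - s) * p s"
          by (simp add: distrib_right)
      qed
      finally show ?thesis by simp
    qed
    have "\<bar>z T - W T\<bar> \<le> 2 * \<epsilon> * exp (\<mu> * T)"
    proof (rule gronwall[OF T, where B = \<kappa>])
      show cont: "continuous_on {0..T} (\<lambda>t. \<bar>z t - W t\<bar>)"
        by (intro continuous_intros contz[OF T] sub contW)
      show "0 \<le> \<epsilon>" unfolding \<epsilon>_def using M pos less_one by auto
      fix t assume t: "0 \<le> t" "t \<le> T"
      have c1: "continuous_on {0..t} (\<lambda>t. z t - W t)"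
        by (intro continuous_intros contz[OF t(1)] sub contW)
      have "z t - W t = (integral {0..t} (\<lambda>s. soft_kernel a (t - s) * p s) - Gamma \<alpha> * J p t) - \<kappa> * J (\<lambda>s. z s - W s) t"
        unfolding frac_int_diff[OF t(1) contz[OF t(1)] sub[OF contW]]
        using eq_z[OF t(1)] eq_W[OF t(1)] by (simp add: algebra_simps)
      moreover have "\<bar>integral {0..t} (\<lambda>s. soft_kernel a (t - s) * p s) - Gamma \<alpha> * J p t\<bar> \<le> \<epsilon>"
        unfolding \<epsilon>_def
        by (rule soft_kernel_deficit) (use a t M p_nonneg in \<open>auto intro: sub p\<close>)
      moreover have "\<bar>J (\<lambda>s. z s - W s) t\<bar> \<le> J (\<lambda>s. \<bar>z s - W s\<bar>) t"
        using norm_frac_int_le[OF t(1) c1 continuous_on_rabs[OF c1]] by simp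
      then have "\<bar>\<kappa> * J (\<lambda>s. z s - W s) t\<bar> \<le> \<kappa> * J (\<lambda>s. \<bar>z s - W s\<bar>) t"
        using lam by (simp add: abs_mult mult_left_mono)
      ultimately show "\<bar>z t - W t\<bar> \<le> \<epsilon> + \<kappa> * J (\<lambda>s. \<bar>z s - W s\<bar>) t"
        by linarith
    qed (use mu lam T in auto)
    moreover have "2 * \<epsilon> * exp (\<mu> * T) = c * a powr \<alpha>"
      unfolding c_def \<epsilon>_def by simp
    ultimately show ?thesis using z_nonneg[of T] by linarith
  qed
  have "((\<lambda>a. - (c * a powr \<alpha>)) \<longlongrightarrow> - (c * 0 powr \<alpha>)) (at_right 0)"
    using pos by (intro tendsto_intros tendsto_powr') (auto simp: eventually_at_filter)
  then have "- (c * 0 powr \<alpha>) \<le> W T"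
    by (rule tendsto_upperbound) (use W_ge in \<open>auto simp: eventually_at_filter\<close>)
  then have "0 \<le> W T" by simp
  then have "b * e T \<le> w T"
    unfolding W_def using Gamma_pos by (simp add: zero_le_mult_iff)
  moreover have "0 \<le> b * e T" using relaxation_pos[OF e lam T] b by auto
  ultimately show ?thesis by linarith
qed

text \<open>For \<open>c \<ge> 1\<close> the dilated function \<open>e (c * t)\<close> is the relaxation function with the larger rate
\<open>\<kappa> * c powr \<alpha>\<close>, so it lies below \<open>e\<close> by comparison.\<close>

lemma relaxation_antimono:
  assumes e: "relaxation \<kappa> e" and lam: "0 \<le> \<kappa>" and ts: "0 < s" "s \<le> t"
  shows "e t \<le> e s"
proof -
  define c where "c = t / s"
  have c: "1 \<le> c" "c * s = t" using ts unfolding c_def by auto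
  have conte: "continuous_on {0..} e" and eq_e: "\<And>t. 0 \<le> t \<Longrightarrow> e t = 1 - \<kappa> * J e t"
    using e unfolding relaxation_def by auto
  define ec where "ec = (\<lambda>u. e (c * u))"
  have contec: "continuous_on {0..} ec"
    unfolding ec_def by (rule continuous_on_compose2[OF conte]) (use c in \<open>auto intro!: continuous_intros\<close>)
  have sub: "continuous_on {0..t} f" if "continuous_on {0..} f" for f :: "real \<Rightarrow> real" and t
    by (rule continuous_on_subset[OF that]) auto
  have c1: "1 \<le> c powr \<alpha>" using c pos by (simp add: ge_one_powr_ge_zero)
  have "0 \<le> e s - ec s"
  proof (rule comparison[where w = "\<lambda>u. e u - ec u" and b = 0 and p = "\<lambda>u. (\<kappa> * (c powr \<alpha> - 1)) * ec u" and \<kappa> = \<kappa>])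
    show "0 \<le> (\<kappa> * (c powr \<alpha> - 1)) * ec u" if "0 \<le> u" for u
      using relaxation_pos[OF e lam, of "c * u"] that c c1 lam unfolding ec_def
      by (intro mult_nonneg_nonneg) auto
    fix u :: real assume u: "0 \<le> u"
    have "ec u = 1 - \<kappa> * (c powr \<alpha> * J ec u)"
      unfolding ec_def using eq_e[of "c * u"] frac_int_scale_time[OF u _ conte, of c] u c by auto
    moreover have "e u = 1 - \<kappa> * J e u" by (rule eq_e[OF u])
    moreover have "(\<lambda>s. (\<kappa> * (c powr \<alpha> - 1)) * ec s - \<kappa> * (e s - ec s))
        = (\<lambda>s. (\<kappa> * c powr \<alpha>) * ec s - \<kappa> * e s)" by (simp add: fun_eq_iff algebra_simps)
    moreover have "J (\<lambda>s. (\<kappa> * c powr \<alpha>) * ec s - \<kappa> * e s) u = (\<kappa> * c powr \<alpha>) * J ec u - \<kappa> * J e u"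
      by (subst frac_int_diff) (auto simp: frac_int_cmult u intro!: continuous_intros sub conte contec)
    ultimately show "e u - ec u = 0 + J (\<lambda>s. (\<kappa> * (c powr \<alpha> - 1)) * ec s - \<kappa> * (e s - ec s)) u"
      by simp
  qed (use lam ts in \<open>auto intro!: continuous_intros conte contec\<close>)
  then show ?thesis unfolding ec_def c by simp
qed

lemma frac_int_relaxation_le:
  assumes "relaxation \<kappa> e" "0 \<le> \<kappa>" "0 \<le> t" shows "\<kappa> * J e t \<le> 1"
  using relaxation_pos[OF assms] assms unfolding relaxation_def by auto

text \<open>As \<open>e\<close> is positive, \<open>\<kappa> * J e t \<le> 1\<close>; as it is decreasing, \<open>J e t\<close> is at least \<open>e t\<close> times the
fractional integral of \<open>1\<close>.\<close>

lemma relaxation_upper: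
  assumes e: "relaxation \<kappa> e" and lam: "0 < \<kappa>" and t: "0 < t"
  shows "e t \<le> Gamma (\<alpha> + 1) / \<kappa> * t powr (- \<alpha>)"
proof -
  have conte: "continuous_on {0..t} e"
    using e unfolding relaxation_def by (auto intro: continuous_on_subset)
  have le: "e t \<le> e s" if "0 \<le> s" "s \<le> t" for s
  proof (cases "s = 0")
    case True
    have "0 \<le> \<kappa> * J e t"
      using lam conte relaxation_pos[OF e] t by (intro mult_nonneg_nonneg frac_int_nonneg) (auto simp: less_imp_le)
    then show ?thesis using e t True unfolding relaxation_def by auto
  qed (use relaxation_antimono[OF e] lam that in auto)
  have "t powr \<alpha> / Gamma (\<alpha> + 1) * e t = J (\<lambda>_. e t) t"
    using frac_int_const[of t "e t"] t by simp
  also have "\<dots> \<le> J e t"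
    by (rule frac_int_mono) (use t conte le in auto)
  finally have "\<kappa> * (t powr \<alpha> / Gamma (\<alpha> + 1) * e t) \<le> 1"
    using frac_int_relaxation_le[OF e, of t] lam t mult_left_mono[of _ "J e t" \<kappa>] by fastforce
  then show ?thesis
    using lam t Gamma_pos by (simp add: powr_minus_divide divide_simps mult_ac)
qed

text \<open>For large times \<open>e \<le> 1 / 2\<close>, that is, \<open>\<kappa> * J e (K * t) \<ge> 1 / 2\<close>. With \<open>K\<close> chosen such that
\<open>K powr (\<alpha> - 1) = 1 / 4\<close>, the part of the integral over \<open>[0,t]\<close> contributes at most \<open>1 / 4\<close>. The
rest must come from \<open>[t, K * t]\<close>, where \<open>e \<le> e t\<close>.\<close>

lemma relaxation_lower:
  assumes e: "relaxation \<kappa> e" and lam: "0 < \<kappa>"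
  obtains c T where "0 < c" "0 < T" "\<And>t. T \<le> t \<Longrightarrow> c * t powr (- \<alpha>) \<le> e t"
proof -
  define C where "C = Gamma (\<alpha> + 1) / \<kappa>"
  have C: "0 < C" unfolding C_def using lam Gamma_pos by auto
  define K where "K = (4::real) powr (1 / (1 - \<alpha>))"
  have K1: "1 < K" unfolding K_def using less_one powr_less_mono[of 0 "1 / (1 - \<alpha>)" "4::real"] by simp
  have K: "(1 / K) powr (1 - \<alpha>) = 1 / 4"
    unfolding K_def using less_one by (simp add: powr_divide powr_powr)
  \<comment> \<open>From this time on the upper bound \<open>C * t powr (- \<alpha>)\<close> is at most \<open>1 / 2\<close>.\<close>
  define T where "T = max 1 ((2 * C) powr (1 / \<alpha>))"
  have T: "1 \<le> T" "(2 * C) powr (1 / \<alpha>) \<le> T" unfolding T_def by auto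
  have half: "e t \<le> 1 / 2" if "T \<le> t" for t
  proof -
    have "2 * C = ((2 * C) powr (1 / \<alpha>)) powr \<alpha>" using C pos by (simp add: powr_powr)
    also have "\<dots> \<le> t powr \<alpha>" using T that pos by (intro powr_mono2) auto
    finally have "C * t powr (- \<alpha>) \<le> 1 / 2"
      using T that by (simp add: powr_minus_divide divide_simps)
    moreover have "e t \<le> C * t powr (- \<alpha>)"
      unfolding C_def using relaxation_upper[OF e lam, of t] T that by simp
    ultimately show ?thesis by linarith
  qed
  have "C / (4 * K powr \<alpha>) * t powr (- \<alpha>) \<le> e t" if t: "T \<le> t" for t
  proof -
    have t0: "0 < t" using t T by auto
    have Kt: "t \<le> K * t" using K1 t0 by simp
    have contK: "continuous_on {0..K * t} e"
      using e unfolding relaxation_def by (auto intro: continuous_on_subset)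
    have "J e (K * t) \<le> (t / (K * t)) powr (1 - \<alpha>) * J e t + e t * (K * t - t) powr \<alpha> / Gamma (\<alpha> + 1)"
    proof (rule frac_int_split[OF t0 Kt contK])
      show "0 \<le> e s" if "0 \<le> s" for s using relaxation_pos[OF e _ that] lam by auto
      show "e s \<le> e t" if "t \<le> s" for s using relaxation_antimono[OF e _ t0 that] lam by auto
    qed
    also have "t / (K * t) = 1 / K" using t0 by simp
    finally have "J e (K * t) \<le> 1 / 4 * J e t + e t * (K * t - t) powr \<alpha> / Gamma (\<alpha> + 1)"
      unfolding K .
    also have "\<dots> \<le> 1 / 4 * J e t + e t * (K * t) powr \<alpha> / Gamma (\<alpha> + 1)"
      using relaxation_pos[OF e, of t] lam t0 Kt pos Gamma_pos
      by (intro add_left_mono divide_right_mono mult_left_mono powr_mono2) auto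
    finally have "\<kappa> * J e (K * t) \<le> \<kappa> * (1 / 4 * J e t + e t * (K * t) powr \<alpha> / Gamma (\<alpha> + 1))"
      using lam by (intro mult_left_mono) auto
    also have "\<dots> = 1 / 4 * (\<kappa> * J e t) + e t * (K * t) powr \<alpha> / C"
      unfolding C_def by (simp add: algebra_simps)
    finally have "\<kappa> * J e (K * t) \<le> 1 / 4 * (\<kappa> * J e t) + e t * (K * t) powr \<alpha> / C" .
    moreover have "\<kappa> * J e t \<le> 1" using frac_int_relaxation_le[OF e, of t] lam t0 by auto
    moreover have "1 / 2 \<le> \<kappa> * J e (K * t)"
      using half[of "K * t"] t Kt e t0 K1 unfolding relaxation_def by auto
    ultimately have "1 / 4 \<le> e t * (K * t) powr \<alpha> / C" by linarith
    also have "\<dots> = e t * (K powr \<alpha> * t powr \<alpha>) / C" using K1 t0 by (simp add: powr_mult)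
    finally show ?thesis
      using C K1 t0 by (simp add: powr_minus_divide divide_simps mult_ac)
  qed
  then show ?thesis using that[of "C / (4 * K powr \<alpha>)" T] C K1 T by auto
qed

text \<open>The differences \<open>v0 * e - v\<close> and \<open>v - v0 * e\<close> satisfy the equation of the comparison principle with
\<open>b = 0\<close> and the forcing terms \<open>q - \<kappa> * v\<close> and \<open>\<kappa> * v - q\<close>.\<close>

lemma
  fixes v q :: "real \<Rightarrow> real"
  assumes v: "continuous_on {0..} v" and q: "continuous_on {0..} q"
    and eq: "\<And>t. 0 \<le> t \<Longrightarrow> v t = v0 - J q t"
    and e: "relaxation \<kappa> e" and lam: "0 \<le> \<kappa>" and t: "0 \<le> t"
  shows below_relaxation: "(\<And>s. 0 \<le> s \<Longrightarrow> \<kappa> * v s \<le> q s) \<Longrightarrow> v t \<le> v0 * e t"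
    and above_relaxation: "(\<And>s. 0 \<le> s \<Longrightarrow> q s \<le> \<kappa> * v s) \<Longrightarrow> v0 * e t \<le> v t"
proof -
  have conte: "continuous_on {0..} e" and eq_e: "\<And>t. 0 \<le> t \<Longrightarrow> e t = 1 - \<kappa> * J e t"
    using e unfolding relaxation_def by auto
  have sub: "continuous_on {0..t} f" if "continuous_on {0..} f" for f :: "real \<Rightarrow> real" and t
    by (rule continuous_on_subset[OF that]) auto
  have J: "J (\<lambda>s. q s - (\<kappa> * v0) * e s) s = J q s - (\<kappa> * v0) * J e s" if "0 \<le> s" for s
    by (subst frac_int_diff) (auto simp: frac_int_cmult that intro!: continuous_intros sub conte q)
  have J': "J (\<lambda>s. (\<kappa> * v0) * e s - q s) s = (\<kappa> * v0) * J e s - J q s" if "0 \<le> s" for s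
    by (subst frac_int_diff) (auto simp: frac_int_cmult that intro!: continuous_intros sub conte q)
  {
    assume le: "\<And>s. 0 \<le> s \<Longrightarrow> \<kappa> * v s \<le> q s"
    have "0 \<le> v0 * e t - v t"
    proof (rule comparison[where w = "\<lambda>s. v0 * e s - v s" and b = 0 and p = "\<lambda>s. q s - \<kappa> * v s" and \<kappa> = \<kappa>])
      fix s :: real assume s: "0 \<le> s"
      have "(\<lambda>s. q s - \<kappa> * v s - \<kappa> * (v0 * e s - v s)) = (\<lambda>s. q s - (\<kappa> * v0) * e s)"
        by (simp add: fun_eq_iff algebra_simps)
      then show "v0 * e s - v s = 0 + J (\<lambda>s. q s - \<kappa> * v s - \<kappa> * (v0 * e s - v s)) s"
        unfolding eq_e[OF s] eq[OF s] using J[OF s] by (simp add: algebra_simps)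
    qed (use le lam t in \<open>auto intro!: continuous_intros conte v q\<close>)
    then show "v t \<le> v0 * e t" by simp
  next
    assume le: "\<And>s. 0 \<le> s \<Longrightarrow> q s \<le> \<kappa> * v s"
    have "0 \<le> v t - v0 * e t"
    proof (rule comparison[where w = "\<lambda>s. v s - v0 * e s" and b = 0 and p = "\<lambda>s. \<kappa> * v s - q s" and \<kappa> = \<kappa>])
      fix s :: real assume s: "0 \<le> s"
      have "(\<lambda>s. \<kappa> * v s - q s - \<kappa> * (v s - v0 * e s)) = (\<lambda>s. (\<kappa> * v0) * e s - q s)"
        by (simp add: fun_eq_iff algebra_simps)
      then show "v s - v0 * e s = 0 + J (\<lambda>s. \<kappa> * v s - q s - \<kappa> * (v s - v0 * e s)) s"
        unfolding eq_e[OF s] eq[OF s] using J'[OF s] by (simp add: algebra_simps)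
    qed (use le lam t in \<open>auto intro!: continuous_intros conte v q\<close>)
    then show "v0 * e t \<le> v t" by simp
  }
qed

end

section \<open>Scalar solutions near simple zeros\<close>

text \<open>The quotient \<open>\<phi> x / (x - u)\<close>, completed by the derivative at \<open>u\<close>, is continuous; linear bounds for
\<open>\<phi>\<close> near its zero follow from bounds of the quotient on compact sets.\<close>

lemma continuous_divided_difference:
  fixes \<phi> :: "real \<Rightarrow> real"
  assumes cont: "continuous_on UNIV \<phi>" and zero: "\<phi> u = 0" and deriv: "(\<phi> has_real_derivative D) (at u)"
  shows "\<exists>h. continuous_on UNIV h \<and> (\<forall>x. \<phi> x = h x * (x - u)) \<and> h u = D"
proof (intro exI conjI allI)
  define h where "h = (\<lambda>x. if x = u then D else \<phi> x / (x - u))"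
  have "isCont h x" for x
  proof (cases "x = u")
    case True
    have "((\<lambda>x. (\<phi> x - \<phi> u) / (x - u)) \<longlongrightarrow> D) (at u)"
      using deriv by (simp add: has_field_derivative_iff)
    then have "(h \<longlongrightarrow> D) (at u)"
      by (rule Lim_transform_within[OF _ zero_less_one]) (auto simp: h_def zero)
    then show ?thesis using True by (simp add: isCont_def h_def)
  next
    case False
    have "isCont (\<lambda>x. \<phi> x / (x - u)) x"
      using cont False by (intro continuous_intros) (auto simp: continuous_on_eq_continuous_at)
    moreover have "eventually (\<lambda>y. h y = \<phi> y / (y - u)) (nhds x)"
      using False by (intro eventually_mono[OF t1_space_nhds[of x u]]) (auto simp: h_def)
    ultimately show ?thesis by (subst isCont_cong)
  qed
  then show "continuous_on UNIV h" by (simp add: continuous_at_imp_continuous_on)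
  show "\<phi> x = h x * (x - u)" for x by (simp add: h_def zero)
  show "h u = D" by (simp add: h_def)
qed

text \<open>The zero \<open>u\<close> is the destination of solutions that start at \<open>y\<close>: on the segment between them, where
\<open>x\<close> is the distance to \<open>u\<close>, the field points towards \<open>u\<close> and is comparable to \<open>x\<close>. For \<open>y = u\<close> the
segment is a point.\<close>

definition attracts :: "(real \<Rightarrow> real) \<Rightarrow> real \<Rightarrow> real \<Rightarrow> real \<Rightarrow> real \<Rightarrow> bool" where
  "attracts \<phi> u y k1 k2 \<longleftrightarrow> \<phi> u = 0 \<and> 0 < k1 \<and> k1 \<le> k2 \<and>
     (\<forall>x\<in>{0..\<bar>y - u\<bar>}. k1 * x \<le> - sgn (y - u) * \<phi> (u + sgn (y - u) * x) \<and>
                       - sgn (y - u) * \<phi> (u + sgn (y - u) * x) \<le> k2 * x)"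

lemma attracts_nearer:
  assumes "attracts \<phi> u y k1 k2" "sgn (z - u) = sgn (y - u)" "\<bar>z - u\<bar> \<le> \<bar>y - u\<bar>"
  shows "attracts \<phi> u z k1 k2"
  using assms unfolding attracts_def by auto

lemma attracts_cong:
  assumes "attracts \<phi> u y k1 k2" "\<And>z. z \<in> closed_segment u y \<Longrightarrow> \<phi>' z = \<phi> z"
  shows "attracts \<phi>' u y k1 k2"
proof -
  have "u + sgn (y - u) * x \<in> closed_segment u y" if "x \<in> {0..\<bar>y - u\<bar>}" for x
    using that by (auto simp: closed_segment_eq_real_ivl sgn_real_def split: if_splits)
  then show ?thesis using assms unfolding attracts_def by auto
qed

text \<open>The quotient of the inward component of \<open>\<phi>\<close> by the distance \<open>x\<close> is positive for \<open>x > 0\<close> by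
hypothesis, and at \<open>x = 0\<close> because its limit there is \<open>\<bar>D\<bar> \<noteq> 0\<close>. On a compact interval it has
a positive minimum.\<close>

lemma attracts_of_sign:
  fixes \<phi> :: "real \<Rightarrow> real"
  assumes cont: "continuous_on UNIV \<phi>" and zero: "\<phi> u = 0" and deriv: "(\<phi> has_real_derivative D) (at u)"
    and D: "D \<noteq> 0" and sign: "\<And>x. 0 < x \<Longrightarrow> x \<le> \<bar>y - u\<bar> \<Longrightarrow> 0 < - sgn (y - u) * \<phi> (u + sgn (y - u) * x)"
  shows "\<exists>k1 k2. attracts \<phi> u y k1 k2"
proof (cases "y = u")
  case True
  then show ?thesis using zero unfolding attracts_def by (auto intro!: exI[of _ 1])
next
  case False
  define \<sigma> where "\<sigma> = sgn (y - u)"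
  have \<sigma>: "\<sigma> * \<sigma> = 1" using False unfolding \<sigma>_def by (auto simp: sgn_real_def)
  obtain h where h: "continuous_on UNIV h" "\<And>x. \<phi> x = h x * (x - u)" "h u = D"
    using continuous_divided_difference[OF cont zero deriv] by auto
  define r where "r = (\<lambda>x. - h (u + \<sigma> * x))"
  have contr: "continuous_on UNIV r"
    unfolding r_def by (intro continuous_intros continuous_on_compose2[OF h(1)]) auto
  have \<psi>: "- \<sigma> * \<phi> (u + \<sigma> * x) = r x * x" for x
  proof -
    have "- \<sigma> * \<phi> (u + \<sigma> * x) = (\<sigma> * \<sigma>) * (- h (u + \<sigma> * x) * x)"
      unfolding h(2)[of "u + \<sigma> * x"] by (simp add: algebra_simps)
    then show ?thesis unfolding \<sigma> r_def by simp
  qed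
  have r_pos: "0 < r x" if "0 < x" "x \<le> \<bar>y - u\<bar>" for x
  proof -
    have "0 < r x * x" using sign[OF that] unfolding \<sigma>_def[symmetric] \<psi> .
    then show ?thesis using that(1) by (simp add: zero_less_mult_iff)
  qed
  have "0 \<le> r 0"
  proof (rule tendsto_lowerbound)
    show "(r \<longlongrightarrow> r 0) (at_right 0)"
      using contr by (auto simp: continuous_on_def intro: tendsto_within_subset)
    have "eventually (\<lambda>x. x \<in> {0<..<\<bar>y - u\<bar>}) (at_right 0)"
      by (rule eventually_at_right_real) (use False in auto)
    then show "eventually (\<lambda>x. 0 \<le> r x) (at_right 0)"
      by eventually_elim (use r_pos in \<open>auto intro: less_imp_le\<close>)
  qed simp
  moreover have "r 0 = - D" unfolding r_def using h(3) by simp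
  ultimately have r_pos': "0 < r x" if "x \<in> {0..\<bar>y - u\<bar>}" for x
    using that r_pos[of x] D by (cases "x = 0") auto
  have contr': "continuous_on {0..\<bar>y - u\<bar>} r" using contr by (rule continuous_on_subset) auto
  obtain x1 where x1: "x1 \<in> {0..\<bar>y - u\<bar>}" "\<And>x. x \<in> {0..\<bar>y - u\<bar>} \<Longrightarrow> r x1 \<le> r x"
    using continuous_attains_inf[OF _ _ contr'] by auto
  obtain x2 where x2: "x2 \<in> {0..\<bar>y - u\<bar>}" "\<And>x. x \<in> {0..\<bar>y - u\<bar>} \<Longrightarrow> r x \<le> r x2"
    using continuous_attains_sup[OF _ _ contr'] by auto
  have "attracts \<phi> u y (r x1) (r x2)"
    unfolding attracts_def \<sigma>_def[symmetric] \<psi>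
    using zero r_pos'[OF x1(1)] x1 x2 by (auto intro!: mult_right_mono)
  then show ?thesis by blast
qed

lemma attracting_zero_above:
  fixes \<phi> :: "real \<Rightarrow> real"
  assumes cont: "continuous_on UNIV \<phi>" and y: "0 < \<phi> y" and R: "\<And>u. R \<le> u \<Longrightarrow> \<phi> u < 0"
  obtains u where "\<phi> u = 0" "y < u" "\<And>z. y \<le> z \<Longrightarrow> z < u \<Longrightarrow> 0 < \<phi> z"
proof -
  have "\<phi> (max R y) < 0" using R by auto
  then have "max R y \<noteq> y" using y by auto
  then have "y \<le> max R y" by auto
  have c0: "continuous_on {0..max R y - y} (\<lambda>s. \<phi> (y + s))"
    by (rule continuous_on_compose2[OF cont]) (auto intro!: continuous_intros)
  have "\<phi> (y + (max R y - y)) \<notin> {0<..}" using \<open>\<phi> (max R y) < 0\<close> by simp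
  from first_exit[OF _ c0 open_greaterThan this] \<open>y \<le> max R y\<close>
  obtain s where s: "0 \<le> s" "\<phi> (y + s) \<notin> {0<..}" "\<forall>s'\<in>{0..<s}. \<phi> (y + s') \<in> {0<..}"
    by auto
  have "s \<noteq> 0" using s y by auto
  have below: "0 < \<phi> z" if "y \<le> z" "z < y + s" for z
    using bspec[OF s(3), of "z - y"] that by auto
  have "0 \<le> \<phi> (y + s)"
  proof (rule tendsto_lowerbound)
    show "(\<phi> \<longlongrightarrow> \<phi> (y + s)) (at_left (y + s))"
      using cont by (auto simp: continuous_on_def intro: tendsto_within_subset)
    have "eventually (\<lambda>z. z \<in> {y<..<y + s}) (at_left (y + s))"
      by (rule eventually_at_left_real) (use s \<open>s \<noteq> 0\<close> in auto)
    then show "eventually (\<lambda>z. 0 \<le> \<phi> z) (at_left (y + s))"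
      by eventually_elim (use below in \<open>auto intro: less_imp_le\<close>)
  qed simp
  then show ?thesis using that[of "y + s"] s \<open>s \<noteq> 0\<close> below by auto
qed

lemma attracting_zero_exists:
  fixes \<phi> :: "real \<Rightarrow> real"
  assumes cont: "continuous_on UNIV \<phi>"
    and deriv: "\<And>u. \<phi> u = 0 \<Longrightarrow> \<exists>D. D \<noteq> 0 \<and> (\<phi> has_real_derivative D) (at u)"
    and R: "\<And>u. R \<le> u \<Longrightarrow> \<phi> u < 0" "\<And>u. u \<le> - R \<Longrightarrow> 0 < \<phi> u"
  obtains u k1 k2 where "attracts \<phi> u y k1 k2"
proof -
  have "\<exists>u. \<phi> u = 0 \<and> (\<forall>x. 0 < x \<and> x \<le> \<bar>y - u\<bar> \<longrightarrow> 0 < - sgn (y - u) * \<phi> (u + sgn (y - u) * x))"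
  proof -
    consider "\<phi> y = 0" | "0 < \<phi> y" | "\<phi> y < 0" by linarith
    then show ?thesis
    proof cases
      case 1 then show ?thesis by (auto intro!: exI[of _ y])
    next
      case 2
      from attracting_zero_above[OF cont this R(1)]
      obtain u where "\<phi> u = 0" "y < u" "\<And>z. y \<le> z \<Longrightarrow> z < u \<Longrightarrow> 0 < \<phi> z" by metis
      then show ?thesis by (auto intro!: exI[of _ u])
    next
      case 3
      have "continuous_on UNIV (\<lambda>z. - \<phi> (- z))"
        by (intro continuous_intros continuous_on_compose2[OF cont]) auto
      from attracting_zero_above[OF this, of "- y" R] 3 R(2)
      obtain u where u: "\<phi> (- u) = 0" "- y < u" "\<And>z. - y \<le> z \<Longrightarrow> z < u \<Longrightarrow> \<phi> (- z) < 0" by auto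
      have "\<phi> (- u + x) < 0" if "0 < x" "x \<le> y + u" for x
        using u(3)[of "u - x"] that by auto
      then show ?thesis using u by (auto intro!: exI[of _ "- u"])
    qed
  qed
  then show ?thesis using attracts_of_sign[OF cont] deriv that by metis
qed

context fractional_order
begin

text \<open>Here \<open>v\<close> is the distance to the attracting zero. Until it leaves a neighbourhood of \<open>(0, v0]\<close> on
which \<open>\<psi> > 0\<close>, the integral is nonnegative and \<open>v \<le> v0\<close>, so the only exit is through \<open>0\<close>. There
\<open>\<psi>\<close> is at most linear and \<open>volterra_positive\<close> applies with the constant inhomogeneity \<open>v0\<close>.\<close>

lemma trapped:
  fixes v Q :: "real \<Rightarrow> real"
  assumes v: "continuous_on {0..} v" and Q: "continuous_on {0..} Q" "\<And>t. 0 \<le> t \<Longrightarrow> 0 < Q t"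
    and \<psi>: "continuous_on UNIV \<psi>" and v0: "0 < v0" and k1: "0 < k1"
    and \<psi>_range: "\<And>x. 0 \<le> x \<Longrightarrow> x \<le> v0 \<Longrightarrow> k1 * x \<le> \<psi> x \<and> \<psi> x \<le> k2 * x"
    and eq: "\<And>t. 0 \<le> t \<Longrightarrow> v t = v0 - J (\<lambda>s. Q s * \<psi> (v s)) t"
    and t: "0 \<le> t"
  shows "0 < v t \<and> v t \<le> v0"
proof -
  have cq: "continuous_on {0..} (\<lambda>s. Q s * \<psi> (v s))"
    by (intro continuous_intros Q continuous_on_compose2[OF \<psi> v]) auto
  have cq': "continuous_on {0..t} (\<lambda>s. Q s * \<psi> (v s))" and v': "continuous_on {0..t} v" for t
    using cq v by (auto intro: continuous_on_subset)
  have k12: "0 < k2"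
  proof -
    have "k1 * v0 \<le> k2 * v0" using \<psi>_range[of v0] v0 by linarith
    then show ?thesis using k1 v0 by simp
  qed
  have "0 < \<psi> v0" using \<psi>_range[of v0] mult_pos_pos[OF k1 v0] v0 by linarith
  have "eventually (\<lambda>x. 0 < \<psi> x) (nhds v0)"
    using \<psi> \<open>0 < \<psi> v0\<close> order_tendstoD(1)[of \<psi> "\<psi> v0" "nhds v0" 0]
    by (simp add: continuous_on_eq_continuous_at isCont_def tendsto_at_iff_tendsto_nhds)
  then obtain d where d: "0 < d" "\<And>x. \<bar>x - v0\<bar> < d \<Longrightarrow> 0 < \<psi> x"
    unfolding eventually_nhds_metric dist_real_def by auto
  define U where "U = {0<..<v0 + d}"
  have openU: "open U" unfolding U_def by simp
  have \<psi>_pos: "0 < \<psi> x" if "x \<in> U" for x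
  proof (cases "x \<le> v0")
    case True
    then have "k1 * x \<le> \<psi> x" "0 < k1 * x" using \<psi>_range[of x] that k1 unfolding U_def by auto
    then show ?thesis by linarith
  next
    case False
    then show ?thesis using that d(2)[of x] unfolding U_def by auto
  qed
  have decreasing: "v s \<le> v0" if "0 \<le> s" "\<And>r. 0 \<le> r \<Longrightarrow> r \<le> s \<Longrightarrow> 0 \<le> \<psi> (v r)" for s
  proof -
    have "0 \<le> J (\<lambda>s. Q s * \<psi> (v s)) s"
      by (rule frac_int_nonneg[OF that(1) cq'], rule mult_nonneg_nonneg[OF less_imp_le[OF Q(2)] that(2)])
    then show ?thesis using eq[OF that(1)] by simp
  qed
  have inU: "v t \<in> U" if t: "0 \<le> t" for t
  proof (rule ccontr)
    assume "v t \<notin> U"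
    from first_exit[OF t v' openU this]
    obtain t1 where t1: "0 \<le> t1" "v t1 \<notin> U" and t1_before: "\<forall>s\<in>{0..<t1}. v s \<in> U"
      by auto
    have "v 0 = v0" using eq[of 0] by simp
    then have "t1 \<noteq> 0" using t1 v0 d unfolding U_def by auto
    have contv: "continuous_on {0..t1} v" by (rule v')
    have closure: "\<psi> (v s) \<ge> 0 \<and> v s \<ge> 0" if "0 \<le> s" "s \<le> t1" for s
    proof (cases "s = t1")
      case True
      have "(v \<longlongrightarrow> v t1) (at_left t1)"
        using contv \<open>t1 \<noteq> 0\<close> t1(1) continuous_on_Icc_at_leftD[of 0 t1 v] by auto
      moreover have "isCont \<psi> (v t1)" using \<psi> by (simp add: continuous_on_eq_continuous_at)
      ultimately have "((\<lambda>s. \<psi> (v s)) \<longlongrightarrow> \<psi> (v t1)) (at_left t1)" "(v \<longlongrightarrow> v t1) (at_left t1)"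
        by (auto intro: isCont_tendsto_compose)
      moreover have "eventually (\<lambda>z. z \<in> {0<..<t1}) (at_left t1)"
        by (rule eventually_at_left_real) (use t1 \<open>t1 \<noteq> 0\<close> in auto)
      then have "eventually (\<lambda>s. 0 \<le> \<psi> (v s)) (at_left t1)" "eventually (\<lambda>s. 0 \<le> v s) (at_left t1)"
        using t1_before \<psi>_pos unfolding U_def by (auto elim!: eventually_mono intro!: less_imp_le)
      ultimately show ?thesis using True by (auto intro: tendsto_lowerbound)
    next
      case False
      then show ?thesis using \<psi>_pos[of "v s"] bspec[OF t1_before, of s] that unfolding U_def by auto
    qed
    have v_range: "0 \<le> v s" "v s \<le> v0" if "0 \<le> s" "s \<le> t1" for s
      using closure[OF that] decreasing[of s] closure that by auto
    have cQ: "continuous_on {0..t1} Q" using Q by (auto intro: continuous_on_subset)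
    obtain m where m: "m \<in> {0..t1}" "\<And>s. s \<in> {0..t1} \<Longrightarrow> Q s \<le> Q m"
      using continuous_attains_sup[OF _ _ cQ] t1 by auto
    have "0 < v t1"
    proof (rule volterra_positive[OF t1(1) contv cq', where L = "Q m * k2" and F = "\<lambda>_. v0"])
      fix s assume s: "0 \<le> s" "s \<le> t1"
      have "Q s * \<psi> (v s) \<le> Q m * (k2 * v s)"
        using s m(2)[of s] Q(2)[of s] Q(2)[of m] closure[OF s] \<psi>_range[OF v_range[OF s]]
        by (intro mult_mono) auto
      then show "0 \<le> Q s * \<psi> (v s) \<and> Q s * \<psi> (v s) \<le> Q m * k2 * v s"
        using closure[OF s] Q(2)[of s] s by (simp add: mult.assoc)
      show "v s + J (\<lambda>s. Q s * \<psi> (v s)) s = v0" using eq[of s] s by simp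
    next
      fix s t :: real assume "0 < s" "s \<le> t"
      then have "(s / t) powr (1 - \<alpha>) \<le> 1" using less_one by (intro powr_le1) auto
      then show "(s / t) powr (1 - \<alpha>) * v0 \<le> v0" using v0 by simp
    qed (use v0 k12 Q(2)[of m] m in auto)
    then show False using v_range(2)[of t1] t1 d unfolding U_def by auto
  qed
  show ?thesis
    using inU[OF t] decreasing[OF t] inU \<psi>_pos unfolding U_def by (auto intro: less_imp_le)
qed

lemma constant_at_zero:
  fixes y Q :: "real \<Rightarrow> real"
  assumes y: "continuous_on {0..} y" and Q: "continuous_on {0..} Q"
    and \<phi>: "continuous_on UNIV \<phi>" and lip: "\<And>M. \<exists>L. \<forall>z. \<bar>z\<bar> \<le> M \<longrightarrow> \<bar>\<phi> z\<bar> \<le> L * \<bar>z - u\<bar>"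
    and eq: "\<And>t. 0 \<le> t \<Longrightarrow> y t = u + J (\<lambda>s. Q s * \<phi> (y s)) t"
    and t: "0 \<le> t"
  shows "y t = u"
proof -
  have sub: "continuous_on {0..t} f" if "continuous_on {0..} f" for f :: "real \<Rightarrow> real" and t
    by (rule continuous_on_subset[OF that]) auto
  have ne: "{0..t} \<noteq> {}" using t by simp
  obtain ty where ty: "\<And>s. s \<in> {0..t} \<Longrightarrow> \<bar>y s\<bar> \<le> \<bar>y ty\<bar>"
    using continuous_attains_sup[OF compact_Icc ne continuous_on_rabs[OF sub[OF y]]] by blast
  obtain tQ where tQ: "\<And>s. s \<in> {0..t} \<Longrightarrow> \<bar>Q s\<bar> \<le> \<bar>Q tQ\<bar>"
    using continuous_attains_sup[OF compact_Icc ne continuous_on_rabs[OF sub[OF Q]]] by blast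
  obtain L where "\<And>z. \<bar>z\<bar> \<le> \<bar>y ty\<bar> \<Longrightarrow> \<bar>\<phi> z\<bar> \<le> L * \<bar>z - u\<bar>" using lip by blast
  then have L: "\<bar>\<phi> z\<bar> \<le> \<bar>L\<bar> * \<bar>z - u\<bar>" if "\<bar>z\<bar> \<le> \<bar>y ty\<bar>" for z
    using that mult_right_mono[of L "\<bar>L\<bar>" "\<bar>z - u\<bar>"] by force
  define B where "B = \<bar>Q tQ\<bar> * \<bar>L\<bar>"
  have B: "0 \<le> B" unfolding B_def by simp
  obtain \<mu> where mu: "0 < \<mu>" "2 * B \<le> \<mu> powr \<alpha>" using gronwall_exponent[OF B] .
  have "\<bar>y t - u\<bar> \<le> 2 * 0 * exp (\<mu> * t)"
  proof (rule gronwall[OF t _ mu B])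
    show c: "continuous_on {0..t} (\<lambda>s. \<bar>y s - u\<bar>)" by (intro continuous_intros sub y)
    fix s assume s: "0 \<le> s" "s \<le> t"
    have "norm (J (\<lambda>s. Q s * \<phi> (y s)) s) \<le> J (\<lambda>s. B * \<bar>y s - u\<bar>) s"
    proof (rule norm_frac_int_le[OF s(1)])
      show "continuous_on {0..s} (\<lambda>s. Q s * \<phi> (y s))"
        by (intro continuous_intros sub Q continuous_on_compose2[OF \<phi> y]) auto
      show "continuous_on {0..s} (\<lambda>s. B * \<bar>y s - u\<bar>)" by (intro continuous_intros sub y)
      fix r assume "0 \<le> r" "r \<le> s"
      then show "norm (Q r * \<phi> (y r)) \<le> B * \<bar>y r - u\<bar>"
        using ty[of r] tQ[of r] L[of "y r"] s
        unfolding B_def real_norm_def abs_mult mult.assoc by (intro mult_mono) auto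
    qed
    then show "\<bar>y s - u\<bar> \<le> 0 + B * J (\<lambda>s. \<bar>y s - u\<bar>) s"
      using eq[OF s(1)] by (simp add: frac_int_cmult)
  qed (use t in auto)
  then show ?thesis by simp
qed

text \<open>All statements are obtained for the distance \<open>v = \<bar>y - u\<bar>\<close>, which satisfies
\<open>v = \<bar>y0 - u\<bar> - J (Q * \<psi>(v))\<close> where \<open>\<psi>\<close> is the component of the field towards \<open>u\<close>. The reflection
by \<open>\<sigma> = sgn (y0 - u)\<close> treats both sides of \<open>u\<close> at once.\<close>

lemma
  fixes y Q :: "real \<Rightarrow> real"
  assumes y: "continuous_on {0..} y" and Q: "continuous_on {0..} Q" "\<And>t. 0 \<le> t \<Longrightarrow> 0 < Q t"
    and \<phi>: "continuous_on UNIV \<phi>" and lip: "\<And>M. \<exists>L. \<forall>z. \<bar>z\<bar> \<le> M \<longrightarrow> \<bar>\<phi> z\<bar> \<le> L * \<bar>z - u\<bar>"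
    and attr: "attracts \<phi> u y0 k1 k2"
    and eq: "\<And>t. 0 \<le> t \<Longrightarrow> y t = y0 + J (\<lambda>s. Q s * \<phi> (y s)) t"
    and t: "0 \<le> t"
  shows attracted_side: "sgn (y t - u) = sgn (y0 - u)"
    and attracted_nearer: "\<bar>y t - u\<bar> \<le> \<bar>y0 - u\<bar>"
    and attracted_upper: "(\<And>t. 0 \<le> t \<Longrightarrow> Q1 \<le> Q t) \<Longrightarrow> 0 \<le> Q1 \<Longrightarrow> relaxation (Q1 * k1) e \<Longrightarrow> \<bar>y t - u\<bar> \<le> \<bar>y0 - u\<bar> * e t"
    and attracted_lower: "(\<And>t. 0 \<le> t \<Longrightarrow> Q t \<le> Q2) \<Longrightarrow> relaxation (Q2 * k2) e' \<Longrightarrow> \<bar>y0 - u\<bar> * e' t \<le> \<bar>y t - u\<bar>"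
proof -
  have "sgn (y t - u) = sgn (y0 - u) \<and> \<bar>y t - u\<bar> \<le> \<bar>y0 - u\<bar> \<and>
    ((\<forall>t\<ge>0. Q1 \<le> Q t) \<and> 0 \<le> Q1 \<and> relaxation (Q1 * k1) e \<longrightarrow> \<bar>y t - u\<bar> \<le> \<bar>y0 - u\<bar> * e t) \<and>
    ((\<forall>t\<ge>0. Q t \<le> Q2) \<and> relaxation (Q2 * k2) e' \<longrightarrow> \<bar>y0 - u\<bar> * e' t \<le> \<bar>y t - u\<bar>)"
  proof (cases "y0 = u")
    case True
    then show ?thesis using constant_at_zero[OF y Q(1) \<phi> lip eq[unfolded True] t] by simp
  next
    case False
    define \<sigma> where "\<sigma> = sgn (y0 - u)"
    define v where "v = (\<lambda>t. \<sigma> * (y t - u))"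
    define \<psi> where "\<psi> = (\<lambda>x. - \<sigma> * \<phi> (u + \<sigma> * x))"
    have \<sigma>: "\<sigma> * \<sigma> = 1" "\<bar>\<sigma>\<bar> = 1" "\<sigma> * (y0 - u) = \<bar>y0 - u\<bar>"
      using False unfolding \<sigma>_def by (auto simp: sgn_real_def)
    have y_v: "u + \<sigma> * v t = y t" for t
      unfolding v_def using \<sigma>(1) by (simp flip: mult.assoc)
    have contv: "continuous_on {0..} v" unfolding v_def by (intro continuous_intros y)
    have cont\<psi>: "continuous_on UNIV \<psi>"
      unfolding \<psi>_def by (intro continuous_intros continuous_on_compose2[OF \<phi>]) auto
    have range: "k1 * x \<le> \<psi> x" "\<psi> x \<le> k2 * x" if "0 \<le> x" "x \<le> \<bar>y0 - u\<bar>" for x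
      using attr that unfolding attracts_def \<psi>_def \<sigma>_def by auto
    have k: "0 < k1" "0 < k2" using attr unfolding attracts_def by auto
    have eq_v: "v t = \<bar>y0 - u\<bar> - J (\<lambda>s. Q s * \<psi> (v s)) t" if "0 \<le> t" for t
    proof -
      have "(\<lambda>s. Q s * \<psi> (v s)) = (\<lambda>s. - \<sigma> * (Q s * \<phi> (y s)))"
        unfolding \<psi>_def y_v by (simp add: fun_eq_iff)
      then have "J (\<lambda>s. Q s * \<psi> (v s)) t = - \<sigma> * J (\<lambda>s. Q s * \<phi> (y s)) t"
        by (simp only: frac_int_cmult)
      then show ?thesis unfolding v_def eq[OF that] using \<sigma>(3) by (simp add: algebra_simps)
    qed
    have v: "0 < v t \<and> v t \<le> \<bar>y0 - u\<bar>" if "0 \<le> t" for t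
      by (rule trapped[OF contv Q cont\<psi> _ k(1) _ eq_v that, of k2]) (use False range in auto)
    have abs_v: "\<bar>y t - u\<bar> = v t" if "0 \<le> t" for t
      using v[OF that] \<sigma>(2) unfolding v_def by (metis abs_mult abs_of_pos mult_1)
    have cq: "continuous_on {0..} (\<lambda>s. Q s * \<psi> (v s))"
      by (intro continuous_intros Q continuous_on_compose2[OF cont\<psi> contv]) auto
    have "sgn (y t - u) = \<sigma>"
      using v[OF t] False unfolding v_def \<sigma>_def by (auto simp: sgn_real_def zero_less_mult_iff split: if_splits)
    moreover have "v t \<le> \<bar>y0 - u\<bar> * e t" if "\<forall>t\<ge>0. Q1 \<le> Q t" "0 \<le> Q1" "relaxation (Q1 * k1) e"
    proof (rule below_relaxation[OF contv cq eq_v that(3) _ t])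
      show "0 \<le> Q1 * k1" using that k by auto
      fix s :: real assume s: "0 \<le> s"
      have "Q1 * (k1 * v s) \<le> Q s * \<psi> (v s)"
        using that s v[OF s] range[of "v s"] k Q(2)[OF s] by (intro mult_mono) auto
      then show "Q1 * k1 * v s \<le> Q s * \<psi> (v s)" by (simp add: mult.assoc)
    qed
    moreover have "\<bar>y0 - u\<bar> * e' t \<le> v t" if "\<forall>t\<ge>0. Q t \<le> Q2" "relaxation (Q2 * k2) e'"
    proof (rule above_relaxation[OF contv cq eq_v that(2) _ t])
      have "0 \<le> Q2" using that(1) Q(2)[of 0] by force
      then show "0 \<le> Q2 * k2" using k by auto
      fix s :: real assume s: "0 \<le> s"
      have "0 \<le> k1 * v s" using k v[OF s] by auto
      then have "0 \<le> \<psi> (v s)" using range(1)[of "v s"] v[OF s] by auto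
      then have "Q s * \<psi> (v s) \<le> Q2 * (k2 * v s)"
        using that s v[OF s] range[of "v s"] k Q(2)[OF s] \<open>0 \<le> Q2\<close> by (intro mult_mono) auto
      then show "Q s * \<psi> (v s) \<le> Q2 * k2 * v s" by (simp add: mult.assoc)
    qed
    ultimately show ?thesis using abs_v[OF t] v[OF t] unfolding \<sigma>_def by simp
  qed
  then show "sgn (y t - u) = sgn (y0 - u)" "\<bar>y t - u\<bar> \<le> \<bar>y0 - u\<bar>"
    "(\<And>t. 0 \<le> t \<Longrightarrow> Q1 \<le> Q t) \<Longrightarrow> 0 \<le> Q1 \<Longrightarrow> relaxation (Q1 * k1) e \<Longrightarrow> \<bar>y t - u\<bar> \<le> \<bar>y0 - u\<bar> * e t"
    "(\<And>t. 0 \<le> t \<Longrightarrow> Q t \<le> Q2) \<Longrightarrow> relaxation (Q2 * k2) e' \<Longrightarrow> \<bar>y0 - u\<bar> * e' t \<le> \<bar>y t - u\<bar>"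
    by auto
qed

end

section \<open>Fields with positive factors\<close>

definition cube :: "real \<Rightarrow> (real ^ 'n::finite) set" where
  "cube R = cbox (\<chi> i. - R) (\<chi> i. R)"

lemma mem_cube: "x \<in> cube R \<longleftrightarrow> (\<forall>i. \<bar>x $ i\<bar> \<le> R)"
proof -
  have "\<bar>y\<bar> \<le> R \<longleftrightarrow> - R \<le> y \<and> y \<le> R" for y by auto
  then show ?thesis by (simp add: cube_def mem_box_cart)
qed

lemma compact_cube: "compact (cube R)"
  unfolding cube_def by (rule compact_cbox)

text \<open>The nearest-point projection onto the cube; composing a field with it makes a locally Lipschitz
field globally Lipschitz and leaves it unchanged on the cube.\<close>

definition clip :: "real \<Rightarrow> real ^ 'n::finite \<Rightarrow> real ^ 'n" where
  "clip R x = (\<chi> i. max (- R) (min R (x $ i)))"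

lemma clip_in_cube: "0 \<le> R \<Longrightarrow> clip R x \<in> cube R"
  by (auto simp: mem_cube clip_def)

lemma clip_eq: "x \<in> cube R \<Longrightarrow> clip R x = x"
  by (auto simp: cube_def mem_box_cart clip_def vec_eq_iff)

lemma norm_clip_diff_le: "norm (clip R x - clip R y) \<le> norm (x - y)"
  by (rule norm_le_componentwise_cart) (auto simp: clip_def)

lemma continuous_on_clip: "continuous_on S (clip R)"
  by (rule lipschitz_on_continuous_on[of 1])
     (auto intro!: lipschitz_onI simp: dist_norm norm_clip_diff_le)

lemma between_of_attracted:
  fixes y u z :: real
  assumes "sgn (y - u) = sgn (z - u)" "\<bar>y - u\<bar> \<le> \<bar>z - u\<bar>"
  shows "min u z \<le> y" "y \<le> max u z"
  using assms by (auto simp: sgn_real_def abs_if split: if_splits)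

lemma lipschitz_at_zero:
  fixes \<phi> :: "real \<Rightarrow> real"
  assumes "continuous_on UNIV \<phi>" "\<phi> u = 0" "(\<phi> has_real_derivative D) (at u)"
  shows "\<exists>L. 0 \<le> L \<and> (\<forall>z. \<bar>z\<bar> \<le> M \<longrightarrow> \<bar>\<phi> z\<bar> \<le> L * \<bar>z - u\<bar>)"
proof -
  obtain h where h: "continuous_on UNIV h" "\<And>x. \<phi> x = h x * (x - u)"
    using continuous_divided_difference[OF assms] by auto
  have "compact (h ` {- M..M})"
    by (rule compact_continuous_image) (use h in \<open>auto intro: continuous_on_subset\<close>)
  then obtain L where L: "0 < L" "\<forall>y\<in>h ` {- M..M}. norm y \<le> L"
    using compact_imp_bounded bounded_pos by blast
  have "\<bar>\<phi> z\<bar> \<le> L * \<bar>z - u\<bar>" if "\<bar>z\<bar> \<le> M" for z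
  proof -
    have "z \<in> {- M..M}" using that by auto
    then have "\<bar>h z\<bar> \<le> L" using L(2) by auto
    then show ?thesis unfolding h(2)[of z] abs_mult by (intro mult_right_mono) auto
  qed
  then show ?thesis using L by (intro exI[of _ L]) auto
qed

context fractional_order
begin

lemma frac_int_component:
  fixes q :: "real \<Rightarrow> real ^ 'n::finite"
  assumes "0 \<le> t" "continuous_on {0..t} q"
  shows "J q t $ i = J (\<lambda>s. q s $ i) t"
  using integral_component_eq_cart[OF kernel_integrable[OF assms], of i]
  by (simp add: frac_int_def)

lemma caputo_solution_iff:
  "caputo_solution \<alpha> g \<eta> x \<longleftrightarrow>
     continuous_on {0..} x \<and> (\<forall>t\<ge>0. x t = \<eta> + J (\<lambda>s. g (x s)) t)"
  unfolding caputo_solution_def frac_int_def ..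

end

text \<open>The constant \<open>R0\<close> bounds all zeros, and every cube
of half side \<open>R \<ge> R0\<close> is invariant.\<close>

locale product_field = fractional_order \<alpha> for \<alpha> +
  fixes P :: "'n::finite \<Rightarrow> real ^ 'n \<Rightarrow> real" and \<phi> :: "'n \<Rightarrow> real \<Rightarrow> real"
    and g :: "real ^ 'n \<Rightarrow> real ^ 'n" and R0 :: real
  assumes g_eq: "g x $ i = P i x * \<phi> i (x $ i)"
    and contP: "continuous_on UNIV (P i)" and P_pos: "0 < P i x"
    and cont\<phi>: "continuous_on UNIV (\<phi> i)"
    and nondegenerate: "\<phi> i u = 0 \<Longrightarrow> \<exists>D. D \<noteq> 0 \<and> (\<phi> i has_real_derivative D) (at u)"
    and R0: "0 < R0" "R0 \<le> u \<Longrightarrow> \<phi> i u < 0" "u \<le> - R0 \<Longrightarrow> 0 < \<phi> i u"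
    and lipschitz: "\<exists>L\<ge>0. \<forall>x\<in>cube R. \<forall>y\<in>cube R. norm (g x - g y) \<le> L * norm (x - y)"
begin

lemma contg: "continuous_on UNIV g"
proof -
  have "continuous_on UNIV (\<lambda>x. \<chi> i. P i x * \<phi> i (x $ i))"
    by (intro continuous_intros contP continuous_on_compose2[OF cont\<phi>]) auto
  moreover have "g = (\<lambda>x. \<chi> i. P i x * \<phi> i (x $ i))"
    by (simp add: fun_eq_iff vec_eq_iff g_eq)
  ultimately show ?thesis by (simp only:)
qed

lemma zero_bound: "\<phi> i u = 0 \<Longrightarrow> \<bar>u\<bar> < R0"
  using R0(2)[of u i] R0(3)[of u i] by (force simp: abs_less_iff not_le[symmetric])

lemma attracts_exists: obtains u k1 k2 where "attracts (\<phi> i) u y k1 k2"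
  using attracting_zero_exists[OF cont\<phi> nondegenerate R0(2,3)] by metis

lemma attracts_zero: "attracts (\<phi> i) u y k1 k2 \<Longrightarrow> \<phi> i u = 0"
  by (simp add: attracts_def)

lemma zero_lipschitz:
  assumes "\<phi> i u = 0" shows "\<exists>L. 0 \<le> L \<and> (\<forall>z. \<bar>z\<bar> \<le> M \<longrightarrow> \<bar>\<phi> i z\<bar> \<le> L * \<bar>z - u\<bar>)"
  using nondegenerate[OF assms] lipschitz_at_zero[OF cont\<phi> assms] by blast

lemma coordinate_equation:
  assumes x: "continuous_on {0..} x" and G: "continuous_on UNIV G"
    and eq: "\<And>t. 0 \<le> t \<Longrightarrow> x t = \<eta> + J (\<lambda>s. G (x s)) t" and t: "0 \<le> t"
  shows "x t $ i = \<eta> $ i + J (\<lambda>s. G (x s) $ i :: real) t"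
proof -
  have "continuous_on {0..t} (\<lambda>s. G (x s))"
    by (rule continuous_on_compose2[OF G continuous_on_subset[OF x]]) auto
  then show ?thesis using eq[OF t] frac_int_component[OF t] by simp
qed

lemma
  assumes x: "caputo_solution \<alpha> g \<eta> x" and attr: "attracts (\<phi> i) u (\<eta> $ i) k1 k2" and t: "0 \<le> t"
  shows solution_side: "sgn (x t $ i - u) = sgn (\<eta> $ i - u)"
    and solution_nearer: "\<bar>x t $ i - u\<bar> \<le> \<bar>\<eta> $ i - u\<bar>"
    and solution_upper: "(\<And>t. 0 \<le> t \<Longrightarrow> Q1 \<le> P i (x t)) \<Longrightarrow> 0 \<le> Q1 \<Longrightarrow> relaxation (Q1 * k1) e \<Longrightarrow> \<bar>x t $ i - u\<bar> \<le> \<bar>\<eta> $ i - u\<bar> * e t"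
    and solution_lower: "(\<And>t. 0 \<le> t \<Longrightarrow> P i (x t) \<le> Q2) \<Longrightarrow> relaxation (Q2 * k2) e' \<Longrightarrow> \<bar>\<eta> $ i - u\<bar> * e' t \<le> \<bar>x t $ i - u\<bar>"
proof -
  have contx: "continuous_on {0..} x" and eq: "\<And>t. 0 \<le> t \<Longrightarrow> x t = \<eta> + J (\<lambda>s. g (x s)) t"
    using x unfolding caputo_solution_iff by auto
  have y: "continuous_on {0..} (\<lambda>t. x t $ i)" by (intro continuous_intros contx)
  have Q: "continuous_on {0..} (\<lambda>t. P i (x t))"
    by (rule continuous_on_compose2[OF contP contx]) auto
  have lip: "\<exists>L. \<forall>z. \<bar>z\<bar> \<le> M \<longrightarrow> \<bar>\<phi> i z\<bar> \<le> L * \<bar>z - u\<bar>" for M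
    using zero_lipschitz[OF attracts_zero[OF attr]] by blast
  have eq': "x t $ i = \<eta> $ i + J (\<lambda>s. P i (x s) * \<phi> i (x s $ i)) t" if "0 \<le> t" for t
    using coordinate_equation[OF contx contg eq that] unfolding g_eq .
  note facts = y Q P_pos cont\<phi> lip attr eq' t
  show "sgn (x t $ i - u) = sgn (\<eta> $ i - u)" by (rule attracted_side[OF facts])
  show "\<bar>x t $ i - u\<bar> \<le> \<bar>\<eta> $ i - u\<bar>" by (rule attracted_nearer[OF facts])
  show "(\<And>t. 0 \<le> t \<Longrightarrow> Q1 \<le> P i (x t)) \<Longrightarrow> 0 \<le> Q1 \<Longrightarrow> relaxation (Q1 * k1) e \<Longrightarrow> \<bar>x t $ i - u\<bar> \<le> \<bar>\<eta> $ i - u\<bar> * e t"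
    by (rule attracted_upper[OF facts])
  show "(\<And>t. 0 \<le> t \<Longrightarrow> P i (x t) \<le> Q2) \<Longrightarrow> relaxation (Q2 * k2) e' \<Longrightarrow> \<bar>\<eta> $ i - u\<bar> * e' t \<le> \<bar>x t $ i - u\<bar>"
    by (rule attracted_lower[OF facts])
qed

lemma solution_in_cube:
  assumes "R0 \<le> R" "\<eta> \<in> cube R" "caputo_solution \<alpha> g \<eta> x" "0 \<le> t"
  shows "x t \<in> cube R"
  unfolding mem_cube
proof
  fix i
  obtain u k1 k2 where attr: "attracts (\<phi> i) u (\<eta> $ i) k1 k2" by (rule attracts_exists)
  have "\<bar>u\<bar> \<le> R" using zero_bound[OF attracts_zero[OF attr]] assms(1) by simp
  moreover have "\<bar>\<eta> $ i\<bar> \<le> R" using assms(2) by (simp add: mem_cube)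
  ultimately show "\<bar>x t $ i\<bar> \<le> R"
    using between_of_attracted[OF solution_side[OF assms(3) attr assms(4)] solution_nearer[OF assms(3) attr assms(4)]]
    by linarith
qed

text \<open>The clipped field is globally Lipschitz. Its solution never leaves the cube, because its coordinates
move between their initial value and a zero, where clipping changes nothing; so it solves the original
equation.\<close>

lemma solution_exists_from:
  fixes \<eta> :: "real ^ 'n" obtains x where "caputo_solution \<alpha> g \<eta> x"
proof -
  define R where "R = R0 + norm \<eta>"
  have R: "R0 \<le> R" "0 \<le> R" using R0 unfolding R_def by auto
  have \<eta>: "\<bar>\<eta> $ i\<bar> \<le> R" for i
    unfolding R_def using component_le_norm_cart[of \<eta> i] R0 by linarith
  obtain L where L: "0 \<le> L" "\<forall>x\<in>cube R. \<forall>y\<in>cube R. norm (g x - g y) \<le> L * norm (x - y)"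
    using lipschitz by blast
  define G where "G = (\<lambda>x. g (clip R x))"
  have lipG: "norm (G x - G y) \<le> L * norm (x - y)" for x y
  proof -
    have "norm (G x - G y) \<le> L * norm (clip R x - clip R y)"
      unfolding G_def using L(2) clip_in_cube[OF R(2)] by blast
    also have "\<dots> \<le> L * norm (x - y)" by (intro mult_left_mono norm_clip_diff_le L)
    finally show ?thesis .
  qed
  obtain x where x: "continuous_on {0..} x" "\<And>t. 0 \<le> t \<Longrightarrow> x t = \<eta> + J (\<lambda>s. G (x s)) t"
    using solution_exists[of "\<lambda>_. \<eta>" "norm \<eta>" L G] L(1) lipG by auto
  have contG: "continuous_on UNIV G"
    unfolding G_def by (rule continuous_on_compose2[OF contg continuous_on_clip]) auto
  have in_cube: "x t \<in> cube R" if t: "0 \<le> t" for t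
    unfolding mem_cube
  proof
    fix i
    define \<theta> where "\<theta> = (\<lambda>z. \<phi> i (max (- R) (min R z)))"
    obtain u k1 k2 where attr: "attracts (\<phi> i) u (\<eta> $ i) k1 k2" by (rule attracts_exists)
    have u: "\<bar>u\<bar> \<le> R" using zero_bound[OF attracts_zero[OF attr]] R(1) by simp
    have \<theta>_attr: "attracts \<theta> u (\<eta> $ i) k1 k2"
    proof (rule attracts_cong[OF attr])
      fix z assume "z \<in> closed_segment u (\<eta> $ i)"
      then have "- R \<le> z" "z \<le> R" using u \<eta>[of i] by (auto simp: closed_segment_eq_real_ivl split: if_splits)
      then show "\<theta> z = \<phi> i z" unfolding \<theta>_def by simp
    qed
    have cont\<theta>: "continuous_on UNIV \<theta>"
      unfolding \<theta>_def by (intro continuous_on_compose2[OF cont\<phi>] continuous_intros) auto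
    have lip\<theta>: "\<exists>K. \<forall>z. \<bar>z\<bar> \<le> M \<longrightarrow> \<bar>\<theta> z\<bar> \<le> K * \<bar>z - u\<bar>" for M
    proof -
      obtain K where K: "0 \<le> K" "\<And>z. \<bar>z\<bar> \<le> R \<Longrightarrow> \<bar>\<phi> i z\<bar> \<le> K * \<bar>z - u\<bar>"
        using zero_lipschitz[OF attracts_zero[OF attr]] by blast
      have "\<bar>\<theta> z\<bar> \<le> K * \<bar>z - u\<bar>" for z
      proof -
        have "\<bar>\<theta> z\<bar> \<le> K * \<bar>max (- R) (min R z) - u\<bar>"
          unfolding \<theta>_def by (rule K(2)) (use R in auto)
        also have "\<dots> \<le> K * \<bar>z - u\<bar>" using u K(1) by (intro mult_left_mono) auto
        finally show ?thesis .
      qed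
      then show ?thesis by blast
    qed
    have y: "continuous_on {0..} (\<lambda>t. x t $ i)" by (intro continuous_intros x)
    have Q: "continuous_on {0..} (\<lambda>t. P i (clip R (x t)))"
      by (rule continuous_on_compose2[OF contP continuous_on_compose2[OF continuous_on_clip x(1)]]) auto
    have eq: "x t $ i = \<eta> $ i + J (\<lambda>s. P i (clip R (x s)) * \<theta> (x s $ i)) t" if "0 \<le> t" for t
      using coordinate_equation[OF x(1) contG x(2) that] unfolding G_def g_eq \<theta>_def by (simp add: clip_def)
    note facts = y Q P_pos cont\<theta> lip\<theta> \<theta>_attr eq t
    show "\<bar>x t $ i\<bar> \<le> R"
      using between_of_attracted[OF attracted_side[OF facts] attracted_nearer[OF facts]] u \<eta>[of i] by linarith
  qed
  have "caputo_solution \<alpha> g \<eta> x"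
    unfolding caputo_solution_iff
  proof (intro conjI allI impI x(1))
    fix t :: real assume t: "0 \<le> t"
    have "J (\<lambda>s. G (x s)) t = J (\<lambda>s. g (x s)) t"
      by (rule frac_int_cong) (use in_cube in \<open>auto simp: G_def clip_eq\<close>)
    then show "x t = \<eta> + J (\<lambda>s. g (x s)) t" using x(2)[OF t] by simp
  qed
  then show ?thesis by (rule that)
qed

text \<open>Both solutions stay in the cube, on which \<open>g\<close> is Lipschitz, and the Gronwall inequality applies. The
case \<open>\<eta> = \<eta>'\<close> is uniqueness.\<close>

lemma solution_dependence:
  assumes R: "R0 \<le> R"
  shows "\<exists>\<mu>. \<forall>\<eta>\<in>cube R. \<forall>\<eta>'\<in>cube R. \<forall>x x'. caputo_solution \<alpha> g \<eta> x \<longrightarrow> caputo_solution \<alpha> g \<eta>' x' \<longrightarrow>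
    (\<forall>t\<ge>0. norm (x t - x' t) \<le> 2 * norm (\<eta> - \<eta>') * exp (\<mu> * t))"
proof -
  obtain L where L: "0 \<le> L" "\<And>x y. x \<in> cube R \<Longrightarrow> y \<in> cube R \<Longrightarrow> norm (g x - g y) \<le> L * norm (x - y)"
    using lipschitz by blast
  obtain \<mu> where mu: "0 < \<mu>" "2 * L \<le> \<mu> powr \<alpha>" using gronwall_exponent[OF L(1)] .
  have "norm (x t - x' t) \<le> 2 * norm (\<eta> - \<eta>') * exp (\<mu> * t)"
    if \<eta>: "\<eta> \<in> cube R" "\<eta>' \<in> cube R" and x: "caputo_solution \<alpha> g \<eta> x" and x': "caputo_solution \<alpha> g \<eta>' x'"
      and t: "0 \<le> t" for \<eta> \<eta>' x x' t
  proof (rule gronwall[OF t _ mu L(1) norm_ge_zero])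
    have sub: "continuous_on {0..s} x" "continuous_on {0..s} x'" for s
      using x x' unfolding caputo_solution_iff by (auto intro: continuous_on_subset)
    show "continuous_on {0..t} (\<lambda>s. norm (x s - x' s))" by (intro continuous_intros sub)
    fix s assume s: "0 \<le> s" "s \<le> t"
    have cg: "continuous_on {0..s} (\<lambda>s. g (x s))" "continuous_on {0..s} (\<lambda>s. g (x' s))"
      by (rule continuous_on_compose2[OF contg sub(1)], simp) (rule continuous_on_compose2[OF contg sub(2)], simp)
    have "x s - x' s = \<eta> - \<eta>' + J (\<lambda>s. g (x s) - g (x' s)) s"
      using x x' s unfolding caputo_solution_iff frac_int_diff[OF s(1) cg] by (auto simp: algebra_simps)
    then have "norm (x s - x' s) \<le> norm (\<eta> - \<eta>') + norm (J (\<lambda>s. g (x s) - g (x' s)) s)"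
      by (simp add: norm_triangle_ineq)
    also have "norm (J (\<lambda>s. g (x s) - g (x' s)) s) \<le> J (\<lambda>s. L * norm (x s - x' s)) s"
      by (rule norm_frac_int_le[OF s(1)])
         (auto intro!: continuous_intros cg sub L(2) solution_in_cube[OF R \<eta>(1) x] solution_in_cube[OF R \<eta>(2) x'])
    finally show "norm (x s - x' s) \<le> norm (\<eta> - \<eta>') + L * J (\<lambda>s. norm (x s - x' s)) s"
      by (simp add: frac_int_cmult)
  qed (use t in auto)
  then show ?thesis by blast
qed

lemma in_some_cube:
  fixes \<eta> \<eta>' :: "real ^ 'n"
  obtains R where "R0 \<le> R" "\<eta> \<in> cube R" "\<eta>' \<in> cube R"
proof
  show "R0 \<le> R0 + norm \<eta> + norm \<eta>'" by simp
  have "\<bar>\<eta> $ i\<bar> \<le> R0 + norm \<eta> + norm \<eta>'" "\<bar>\<eta>' $ i\<bar> \<le> R0 + norm \<eta> + norm \<eta>'" for i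
    using R0(1) component_le_norm_cart[of \<eta> i] component_le_norm_cart[of \<eta>' i]
      norm_ge_zero[of \<eta>] norm_ge_zero[of \<eta>'] by linarith+
  then show "\<eta> \<in> cube (R0 + norm \<eta> + norm \<eta>')" "\<eta>' \<in> cube (R0 + norm \<eta> + norm \<eta>')"
    unfolding mem_cube by auto
qed

lemma flow_eq:
  assumes x: "caputo_solution \<alpha> g \<eta> x" and t: "0 \<le> t"
  shows "caputo_flow \<alpha> g t \<eta> = x t"
  unfolding caputo_flow_def
proof (rule the_equality)
  fix y assume "\<exists>x'. caputo_solution \<alpha> g \<eta> x' \<and> x' t = y"
  then obtain x' where x': "caputo_solution \<alpha> g \<eta> x'" "x' t = y" by blast
  obtain R where R: "R0 \<le> R" "\<eta> \<in> cube R" using in_some_cube by blast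
  obtain \<mu> where "\<forall>\<eta>\<in>cube R. \<forall>\<eta>'\<in>cube R. \<forall>x x'. caputo_solution \<alpha> g \<eta> x \<longrightarrow> caputo_solution \<alpha> g \<eta>' x' \<longrightarrow>
    (\<forall>t\<ge>0. norm (x t - x' t) \<le> 2 * norm (\<eta> - \<eta>') * exp (\<mu> * t))"
    using solution_dependence[OF R(1)] by (rule exE)
  from this[rule_format, OF R(2) R(2) x x'(1) t]
  show "y = x t" using x'(2) by simp
qed (use x in blast)

lemma factor_bounds:
  "\<exists>Q1 Q2. 0 < Q1 \<and> (\<forall>x\<in>cube R. Q1 \<le> P i x \<and> P i x \<le> Q2)"
proof (cases "cube R = ({} :: (real ^ 'n) set)")
  case True
  then show ?thesis by (auto intro: exI[of _ 1])
next
  case False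
  have c: "continuous_on (cube R) (P i)" using contP by (rule continuous_on_subset) auto
  obtain x1 where "\<forall>x\<in>cube R. P i x1 \<le> P i x"
    using continuous_attains_inf[OF compact_cube False c] by blast
  moreover obtain x2 where "\<forall>x\<in>cube R. P i x \<le> P i x2"
    using continuous_attains_sup[OF compact_cube False c] by blast
  ultimately show ?thesis using P_pos[of i x1] by blast
qed

text \<open>The constants of an attracting segment serve all initial values on it, so one relaxation function
bounds all these solutions.\<close>

lemma uniform_upper_rate:
  assumes R: "R0 \<le> R" and attr: "attracts (\<phi> i) u Y k1 k2"
  obtains D where "0 \<le> D" "\<And>\<eta> x t. caputo_solution \<alpha> g \<eta> x \<Longrightarrow> \<eta> \<in> cube R \<Longrightarrow>
     sgn (\<eta> $ i - u) = sgn (Y - u) \<Longrightarrow> \<bar>\<eta> $ i - u\<bar> \<le> \<bar>Y - u\<bar> \<Longrightarrow> 0 < t \<Longrightarrow>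
     \<bar>x t $ i - u\<bar> \<le> D * t powr (- \<alpha>)"
proof -
  obtain Q1 Q2 where Q1: "0 < Q1" "\<And>x. x \<in> cube R \<Longrightarrow> Q1 \<le> P i x"
    using factor_bounds[of R i] by blast
  have k: "0 < Q1 * k1" using Q1 attr unfolding attracts_def by auto
  obtain e where e: "relaxation (Q1 * k1) e" using relaxation_exists[OF less_imp_le[OF k]] .
  define D where "D = \<bar>Y - u\<bar> * (Gamma (\<alpha> + 1) / (Q1 * k1))"
  show ?thesis
  proof (rule that[of D])
    show "0 \<le> D" unfolding D_def using k Gamma_pos by (intro mult_nonneg_nonneg divide_nonneg_pos) auto
    fix \<eta> x t
    assume x: "caputo_solution \<alpha> g \<eta> x" and \<eta>: "\<eta> \<in> cube R" "sgn (\<eta> $ i - u) = sgn (Y - u)" "\<bar>\<eta> $ i - u\<bar> \<le> \<bar>Y - u\<bar>"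
      and t: "0 < (t::real)"
    have attr': "attracts (\<phi> i) u (\<eta> $ i) k1 k2" by (rule attracts_nearer[OF attr \<eta>(2,3)])
    have "\<bar>x t $ i - u\<bar> \<le> \<bar>\<eta> $ i - u\<bar> * e t"
      using solution_upper[OF x attr' _ _ _ e] Q1 solution_in_cube[OF R \<eta>(1) x] t by auto
    also have "\<dots> \<le> \<bar>Y - u\<bar> * (Gamma (\<alpha> + 1) / (Q1 * k1) * t powr (- \<alpha>))"
      using relaxation_upper[OF e k t] relaxation_pos[OF e, of t] k t \<eta>(3) by (intro mult_mono) auto
    finally show "\<bar>x t $ i - u\<bar> \<le> D * t powr (- \<alpha>)" unfolding D_def by simp
  qed
qed

lemma lower_rate:
  assumes x: "caputo_solution \<alpha> g \<eta> x" and attr: "attracts (\<phi> i) u (\<eta> $ i) k1 k2" and ne: "\<eta> $ i \<noteq> u"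
  obtains c T where "0 < c" "0 < T" "\<And>t. T \<le> t \<Longrightarrow> c * t powr (- \<alpha>) \<le> \<bar>x t $ i - u\<bar>"
proof -
  obtain R where R: "R0 \<le> R" "\<eta> \<in> cube R" using in_some_cube by blast
  obtain Q1 Q2 where Q: "0 < Q1" "\<And>x. x \<in> cube R \<Longrightarrow> Q1 \<le> P i x" "\<And>x. x \<in> cube R \<Longrightarrow> P i x \<le> Q2"
    using factor_bounds[of R i] by blast
  have "0 < P i \<eta>" by (rule P_pos)
  then have "0 < Q2" using Q(3)[OF R(2)] by linarith
  then have k: "0 < Q2 * k2" using attr unfolding attracts_def by auto
  obtain e where e: "relaxation (Q2 * k2) e" using relaxation_exists[OF less_imp_le[OF k]] .
  obtain c T where cT: "0 < c" "0 < T" "\<And>t. T \<le> t \<Longrightarrow> c * t powr (- \<alpha>) \<le> e t"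
    using relaxation_lower[OF e k] by blast
  show ?thesis
  proof (rule that[of "\<bar>\<eta> $ i - u\<bar> * c" T])
    fix t assume t: "T \<le> t"
    have "\<bar>\<eta> $ i - u\<bar> * c * t powr (- \<alpha>) \<le> \<bar>\<eta> $ i - u\<bar> * e t"
      unfolding mult.assoc by (rule mult_left_mono[OF cT(3)[OF t]]) simp
    also have "\<dots> \<le> \<bar>x t $ i - u\<bar>"
      using solution_lower[OF x attr _ _ e] Q solution_in_cube[OF R x] t cT(2) by auto
    finally show "\<bar>\<eta> $ i - u\<bar> * c * t powr (- \<alpha>) \<le> \<bar>x t $ i - u\<bar>" .
  qed (use cT ne in auto)
qed

lemma sum_rates:
  fixes x z :: "real ^ 'n"
  assumes "\<And>i. \<bar>x $ i - z $ i\<bar> \<le> D i * \<rho>"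
  shows "norm (x - z) \<le> sum D UNIV * \<rho>"
proof -
  have "norm (x - z) \<le> (\<Sum>i\<in>UNIV. \<bar>(x - z) $ i\<bar>)" by (rule norm_le_l1_cart)
  also have "\<dots> \<le> (\<Sum>i\<in>UNIV. D i * \<rho>)" by (rule sum_mono) (use assms in auto)
  finally show ?thesis by (simp add: sum_distrib_right)
qed

lemma rate_tendsto_0: "((\<lambda>t. D * t powr (- \<alpha>)) \<longlongrightarrow> 0) at_top"
  using tendsto_mult_right_zero[OF tendsto_neg_powr[OF _ filterlim_ident]] pos by simp

text \<open>Each coordinate has its own limit \<open>u i\<close>. The upper rate is the sum of the coordinatewise rates; for
the lower one a single coordinate that does not start at a zero suffices.\<close>

theorem solution_converges:
  assumes x: "caputo_solution \<alpha> g \<eta> x"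
  shows "\<exists>l\<in>zero_product \<phi>. (x \<longlongrightarrow> l) at_top \<and> (\<eta> \<notin> zero_product \<phi> \<longrightarrow> exact_rate \<alpha> x l)"
proof -
  obtain R where R: "R0 \<le> R" "\<eta> \<in> cube R" using in_some_cube by blast
  have "\<forall>i. \<exists>u k1 k2. attracts (\<phi> i) u (\<eta> $ i) k1 k2" using attracts_exists by metis
  then obtain u k1 k2 where attr: "\<And>i. attracts (\<phi> i) (u i) (\<eta> $ i) (k1 i) (k2 i)" by metis
  define l where "l = (\<chi> i. u i)"
  have l: "l \<in> zero_product \<phi>"
    unfolding l_def zero_product_def zeros_def using attracts_zero[OF attr] by auto
  have "\<exists>D\<ge>0. \<forall>t>0. \<bar>x t $ i - u i\<bar> \<le> D * t powr (- \<alpha>)" for i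
    using uniform_upper_rate[OF R(1) attr[of i]] x R(2) by (metis order_refl)
  then obtain D where D: "\<And>i. 0 \<le> D i" "\<And>i t. 0 < t \<Longrightarrow> \<bar>x t $ i - u i\<bar> \<le> D i * t powr (- \<alpha>)" by metis
  define C where "C = sum D UNIV"
  have C: "norm (x t - l) \<le> C * t powr (- \<alpha>)" if "0 < t" for t
    unfolding C_def l_def by (rule sum_rates) (use D(2) that in auto)
  have "0 \<le> C" unfolding C_def by (rule sum_nonneg) (use D in auto)
  have "((\<lambda>t. norm (x t - l)) \<longlongrightarrow> 0) at_top"
    by (rule tendsto_sandwich[OF _ _ tendsto_const rate_tendsto_0])
       (auto intro: eventually_mono[OF eventually_gt_at_top[of 0]] C)
  then have "(x \<longlongrightarrow> l) at_top" by (simp add: tendsto_norm_zero_iff LIM_zero_iff)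
  moreover have "exact_rate \<alpha> x l" if \<eta>: "\<eta> \<notin> zero_product \<phi>"
  proof -
    obtain i where i: "\<phi> i (\<eta> $ i) \<noteq> 0" using \<eta> unfolding zero_product_def zeros_def by auto
    then have "\<eta> $ i \<noteq> u i" using attracts_zero[OF attr[of i]] by auto
    then obtain c T where cT: "0 < c" "0 < T" "\<And>t. T \<le> t \<Longrightarrow> c * t powr (- \<alpha>) \<le> \<bar>x t $ i - u i\<bar>"
      using lower_rate[OF x attr] by blast
    have "c * t powr (- \<alpha>) \<le> norm (x t - l) \<and> norm (x t - l) \<le> (C + 1) * t powr (- \<alpha>)" if "T \<le> t" for t
    proof
      have "\<bar>x t $ i - u i\<bar> \<le> norm (x t - l)"
        using component_le_norm_cart[of "x t - l" i] unfolding l_def by simp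
      then show "c * t powr (- \<alpha>) \<le> norm (x t - l)" using cT(3)[OF that] by linarith
      show "norm (x t - l) \<le> (C + 1) * t powr (- \<alpha>)"
        by (rule order_trans[OF C mult_right_mono]) (use that cT(2) in auto)
    qed
    moreover have "0 < C + 1" using \<open>0 \<le> C\<close> by simp
    ultimately show ?thesis unfolding exact_rate_def using cT(1,2) by blast
  qed
  ultimately show ?thesis using l by blast
qed

end

section \<open>The global attractor\<close>

lemma attracts_no_other_zero:
  assumes "attracts \<phi> u y k1 k2" "\<phi> z = 0" "min u y \<le> z" "z \<le> max u y"
  shows "z = u"
proof (rule ccontr)
  assume ne: "z \<noteq> u"
  have "u + sgn (y - u) * \<bar>z - u\<bar> = z" and mem: "\<bar>z - u\<bar> \<in> {0..\<bar>y - u\<bar>}"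
    using assms(3,4) ne by (auto simp: sgn_real_def abs_if min_def max_def split: if_splits)
  moreover have "k1 * \<bar>z - u\<bar> \<le> - sgn (y - u) * \<phi> (u + sgn (y - u) * \<bar>z - u\<bar>)"
    using assms(1) mem unfolding attracts_def by blast
  ultimately have "k1 * \<bar>z - u\<bar> \<le> 0" using assms(2) by simp
  moreover have "0 < k1 * \<bar>z - u\<bar>" using assms(1) ne unfolding attracts_def by auto
  ultimately show False by linarith
qed

lemma attracts_refl: "\<phi> u = 0 \<Longrightarrow> attracts \<phi> u u 1 1"
  by (simp add: attracts_def)

context product_field
begin

text \<open>The zeros form a bounded set without accumulation points, since the derivative at each of them is
nonzero. Thus the minimum and the maximum of the zeros are zeros.\<close>

lemma finite_zeros: "finite (zeros (\<phi> i))"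
proof (rule ccontr)
  assume inf: "infinite (zeros (\<phi> i))"
  have "zeros (\<phi> i) \<subseteq> {- R0..R0}"
    using zero_bound[of i] unfolding zeros_def by (force simp: abs_less_iff)
  then obtain z where z: "z islimpt zeros (\<phi> i)"
    using Heine_Borel_imp_Bolzano_Weierstrass[OF compact_Icc inf] by blast
  have "closed (zeros (\<phi> i))"
    unfolding zeros_def by (intro closed_Collect_eq cont\<phi> continuous_intros)
  then have "\<phi> i z = 0" using z closed_limpt unfolding zeros_def by auto
  then obtain D where D: "D \<noteq> 0" "(\<phi> i has_real_derivative D) (at z)" using nondegenerate by blast
  have "eventually (\<lambda>y. (\<phi> i y - \<phi> i z) / (y - z) \<noteq> 0) (at z)"
    using D by (intro tendsto_imp_eventually_ne) (auto simp: has_field_derivative_iff)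
  then have "eventually (\<lambda>y. y \<notin> zeros (\<phi> i)) (at z)"
    by eventually_elim (use \<open>\<phi> i z = 0\<close> in \<open>auto simp: zeros_def\<close>)
  then show False using z unfolding islimpt_iff_eventually by blast
qed

lemma zeros_nonempty: "zeros (\<phi> i) \<noteq> {}"
proof -
  obtain u k1 k2 where "attracts (\<phi> i) u 0 k1 k2" by (rule attracts_exists)
  then show ?thesis using attracts_zero unfolding zeros_def by blast
qed

abbreviation "lo i \<equiv> Min (zeros (\<phi> i))"
abbreviation "hi i \<equiv> Max (zeros (\<phi> i))"
abbreviation "attractor \<equiv> cbox (\<chi> i. lo i) (\<chi> i. hi i)"

lemma mem_attractor: "x \<in> attractor \<longleftrightarrow> (\<forall>i. lo i \<le> x $ i \<and> x $ i \<le> hi i)"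
  by (simp add: mem_box_cart)

lemma lo_hi_zero: "\<phi> i (lo i) = 0" "\<phi> i (hi i) = 0"
  using Min_in[OF finite_zeros zeros_nonempty, of i] Max_in[OF finite_zeros zeros_nonempty, of i]
  unfolding zeros_def by auto

lemma zero_range: "\<phi> i u = 0 \<Longrightarrow> lo i \<le> u \<and> u \<le> hi i"
  using finite_zeros[of i] by (auto simp: zeros_def)

lemma lo_le_hi: "lo i \<le> hi i"
  using zero_range[OF lo_hi_zero(1)] by auto

lemma attractor_in_cube: "attractor \<subseteq> cube R0"
proof
  fix x assume "x \<in> attractor"
  then have "lo i \<le> x $ i \<and> x $ i \<le> hi i" for i unfolding mem_attractor by blast
  moreover have "\<bar>lo i\<bar> < R0" "\<bar>hi i\<bar> < R0" for i using zero_bound[OF lo_hi_zero(1)] zero_bound[OF lo_hi_zero(2)] .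
  ultimately show "x \<in> cube R0" unfolding mem_cube by (smt (verit))
qed

lemma coordinate_stays_between:
  assumes x: "caputo_solution \<alpha> g \<eta> x" and \<eta>: "lo i \<le> \<eta> $ i" "\<eta> $ i \<le> hi i" and t: "0 \<le> t"
  shows "lo i \<le> x t $ i \<and> x t $ i \<le> hi i"
proof -
  obtain u k1 k2 where attr: "attracts (\<phi> i) u (\<eta> $ i) k1 k2" by (rule attracts_exists)
  show ?thesis
    using between_of_attracted[OF solution_side[OF x attr t] solution_nearer[OF x attr t]]
      zero_range[OF attracts_zero[OF attr]] \<eta> by auto
qed

lemma coordinate_constant:
  assumes x: "caputo_solution \<alpha> g \<eta> x" and "\<phi> i (\<eta> $ i) = 0" and t: "0 \<le> t"
  shows "x t $ i = \<eta> $ i"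
proof -
  have "attracts (\<phi> i) (\<eta> $ i) (\<eta> $ i) 1 1" using assms(2) by (rule attracts_refl)
  from solution_nearer[OF x this t] show ?thesis by simp
qed

text \<open>The nearest-point projection onto the attractor.\<close>

definition retract :: "real ^ 'n \<Rightarrow> real ^ 'n" where
  "retract x = (\<chi> i. max (lo i) (min (hi i) (x $ i)))"

lemma retract_in: "retract x \<in> attractor"
  unfolding mem_attractor retract_def using lo_le_hi by auto

text \<open>A coordinate that starts between the extreme zeros stays there. For surjectivity, let \<open>y\<close> be a point
of the attractor and apply Brouwer's theorem to \<open>\<eta> \<mapsto> retract (\<eta> - \<Phi> \<eta> + y)\<close>, where \<open>\<Phi>\<close> is the
flow at time \<open>t\<close>. At a fixed point, every coordinate that is not an extreme zero is unaffected by
the projection, hence \<open>\<Phi> \<eta> = y\<close> there; and coordinates that are zeros do not move under \<open>\<Phi>\<close>.\<close>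

lemma flow_image_attractor:
  assumes t: "0 \<le> t"
  shows "caputo_flow \<alpha> g t ` attractor = attractor"
proof
  show "caputo_flow \<alpha> g t ` attractor \<subseteq> attractor"
  proof
    fix y assume "y \<in> caputo_flow \<alpha> g t ` attractor"
    then obtain \<eta> where \<eta>: "\<eta> \<in> attractor" "y = caputo_flow \<alpha> g t \<eta>" by blast
    obtain x where x: "caputo_solution \<alpha> g \<eta> x" by (rule solution_exists_from)
    have "y = x t" using flow_eq[OF x t] \<eta>(2) by simp
    then show "y \<in> attractor"
      using coordinate_stays_between[OF x _ _ t] \<eta>(1) unfolding mem_attractor by auto
  qed
  show "attractor \<subseteq> caputo_flow \<alpha> g t ` attractor"
  proof
    fix y assume y: "y \<in> attractor"
    define \<Phi> where "\<Phi> = caputo_flow \<alpha> g t"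
    define F where "F = (\<lambda>\<eta>. retract (\<eta> - \<Phi> \<eta> + y))"
    obtain \<mu> where \<mu>: "\<forall>\<eta>\<in>cube R0. \<forall>\<eta>'\<in>cube R0. \<forall>x x'. caputo_solution \<alpha> g \<eta> x \<longrightarrow> caputo_solution \<alpha> g \<eta>' x' \<longrightarrow>
      (\<forall>t\<ge>0. norm (x t - x' t) \<le> 2 * norm (\<eta> - \<eta>') * exp (\<mu> * t))"
      using solution_dependence[OF order_refl] by (rule exE)
    have "norm (\<Phi> \<eta> - \<Phi> \<eta>') \<le> (2 * exp (\<mu> * t)) * norm (\<eta> - \<eta>')" if "\<eta> \<in> attractor" "\<eta>' \<in> attractor" for \<eta> \<eta>'
    proof -
      obtain x where x: "caputo_solution \<alpha> g \<eta> x" by (rule solution_exists_from)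
      obtain x' where x': "caputo_solution \<alpha> g \<eta>' x'" by (rule solution_exists_from)
      have "\<eta> \<in> cube R0" "\<eta>' \<in> cube R0" using that attractor_in_cube by auto
      from \<mu>[rule_format, OF this x x' t] show ?thesis
        unfolding \<Phi>_def flow_eq[OF x t] flow_eq[OF x' t] by (simp add: mult_ac)
    qed
    then have cont\<Phi>: "continuous_on attractor \<Phi>"
      by (intro lipschitz_on_continuous_on[of "2 * exp (\<mu> * t)"] lipschitz_onI) (auto simp: dist_norm)
    have contF: "continuous_on attractor F"
      unfolding F_def retract_def by (intro continuous_intros cont\<Phi>)
    have ne: "attractor \<noteq> {}" using y by auto
    obtain \<eta> where \<eta>: "\<eta> \<in> attractor" "F \<eta> = \<eta>"
      using brouwer[OF compact_cbox convex_box(1) ne contF] retract_in unfolding F_def by blast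
    obtain x where x: "caputo_solution \<alpha> g \<eta> x" by (rule solution_exists_from)
    have \<Phi>\<eta>: "\<Phi> \<eta> = x t" unfolding \<Phi>_def by (rule flow_eq[OF x t])
    have "x t $ i = y $ i" for i
    proof -
      have fix_i: "max (lo i) (min (hi i) (\<eta> $ i - x t $ i + y $ i)) = \<eta> $ i"
        using arg_cong[OF \<eta>(2), of "\<lambda>v. v $ i"] unfolding F_def retract_def \<Phi>\<eta> by simp
      have y_i: "lo i \<le> y $ i" "y $ i \<le> hi i" using y unfolding mem_attractor by auto
      show ?thesis
      proof (cases "\<phi> i (\<eta> $ i) = 0")
        case True
        then have "x t $ i = \<eta> $ i" by (rule coordinate_constant[OF x _ t])
        then show ?thesis using fix_i y_i by auto
      next
        case False
        then have "\<eta> $ i \<noteq> lo i" "\<eta> $ i \<noteq> hi i" using lo_hi_zero by metis+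
        then show ?thesis using fix_i by (auto simp: max_def min_def split: if_splits)
      qed
    qed
    then have "\<Phi> \<eta> = y" unfolding \<Phi>\<eta> by (simp add: vec_eq_iff)
    then show "y \<in> caputo_flow \<alpha> g t ` attractor" using \<eta>(1) unfolding \<Phi>_def by blast
  qed
qed

lemma extreme_zeros_attract:
  assumes "R0 \<le> R"
  shows "\<exists>k1 k2. attracts (\<phi> i) (hi i) R k1 k2" "\<exists>k1 k2. attracts (\<phi> i) (lo i) (- R) k1 k2"
proof -
  have b: "\<bar>lo i\<bar> < R" "\<bar>hi i\<bar> < R"
    using zero_bound[OF lo_hi_zero(1), of i] zero_bound[OF lo_hi_zero(2), of i] assms by auto
  obtain u k1 k2 where attr: "attracts (\<phi> i) u R k1 k2" by (rule attracts_exists)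
  have "hi i = u"
    by (rule attracts_no_other_zero[OF attr lo_hi_zero(2)])
       (use zero_range[OF attracts_zero[OF attr]] b in auto)
  then show "\<exists>k1 k2. attracts (\<phi> i) (hi i) R k1 k2" using attr by blast
  obtain u k1 k2 where attr: "attracts (\<phi> i) u (- R) k1 k2" by (rule attracts_exists)
  have "lo i = u"
    by (rule attracts_no_other_zero[OF attr lo_hi_zero(1)])
       (use zero_range[OF attracts_zero[OF attr]] b in auto)
  then show "\<exists>k1 k2. attracts (\<phi> i) (lo i) (- R) k1 k2" using attr by blast
qed

text \<open>Outside the interval of the extreme zeros a coordinate approaches the nearer of them along one
attracting segment, which reaches to the boundary of the cube; inside it stays.\<close>

lemma uniform_attraction:
  assumes R: "R0 \<le> R"
  shows "\<exists>D. \<forall>\<eta>\<in>cube R. \<forall>x t. caputo_solution \<alpha> g \<eta> x \<longrightarrow> 0 < t \<longrightarrow> norm (x t - retract (x t)) \<le> D * t powr (- \<alpha>)"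
proof -
  have "\<exists>D\<ge>0. \<forall>\<eta> x t. caputo_solution \<alpha> g \<eta> x \<longrightarrow> \<eta> \<in> cube R \<longrightarrow> 0 < t \<longrightarrow>
      \<bar>x t $ i - retract (x t) $ i\<bar> \<le> D * t powr (- \<alpha>)" for i
  proof -
    obtain k1 k2 where up: "attracts (\<phi> i) (hi i) R k1 k2" using extreme_zeros_attract[OF R] by blast
    obtain k3 k4 where down: "attracts (\<phi> i) (lo i) (- R) k3 k4" using extreme_zeros_attract[OF R] by blast
    obtain D1 where D1: "0 \<le> D1" "\<And>\<eta> x t. caputo_solution \<alpha> g \<eta> x \<Longrightarrow> \<eta> \<in> cube R \<Longrightarrow>
       sgn (\<eta> $ i - hi i) = sgn (R - hi i) \<Longrightarrow> \<bar>\<eta> $ i - hi i\<bar> \<le> \<bar>R - hi i\<bar> \<Longrightarrow> 0 < t \<Longrightarrow>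
       \<bar>x t $ i - hi i\<bar> \<le> D1 * t powr (- \<alpha>)"
      using uniform_upper_rate[OF R up] by blast
    obtain D2 where D2: "0 \<le> D2" "\<And>\<eta> x t. caputo_solution \<alpha> g \<eta> x \<Longrightarrow> \<eta> \<in> cube R \<Longrightarrow>
       sgn (\<eta> $ i - lo i) = sgn (- R - lo i) \<Longrightarrow> \<bar>\<eta> $ i - lo i\<bar> \<le> \<bar>- R - lo i\<bar> \<Longrightarrow> 0 < t \<Longrightarrow>
       \<bar>x t $ i - lo i\<bar> \<le> D2 * t powr (- \<alpha>)"
      using uniform_upper_rate[OF R down] by blast
    have b: "\<bar>lo i\<bar> < R" "\<bar>hi i\<bar> < R"
      using zero_bound[OF lo_hi_zero(1), of i] zero_bound[OF lo_hi_zero(2), of i] R by auto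
    have "\<bar>x t $ i - retract (x t) $ i\<bar> \<le> (D1 + D2) * t powr (- \<alpha>)"
      if x: "caputo_solution \<alpha> g \<eta> x" and \<eta>: "\<eta> \<in> cube R" and t: "0 < t" for \<eta> x t
    proof -
      have \<eta>R: "\<bar>\<eta> $ i\<bar> \<le> R" using \<eta> by (simp add: mem_cube)
      have n: "0 \<le> D1 * t powr (- \<alpha>)" "0 \<le> D2 * t powr (- \<alpha>)" using D1 D2 by auto
      consider "hi i < \<eta> $ i" | "\<eta> $ i < lo i" | "lo i \<le> \<eta> $ i" "\<eta> $ i \<le> hi i" by linarith
      then have "\<bar>x t $ i - retract (x t) $ i\<bar> \<le> D1 * t powr (- \<alpha>) + D2 * t powr (- \<alpha>)"
      proof cases
        case 1
        have s: "sgn (\<eta> $ i - hi i) = sgn (R - hi i)" "\<bar>\<eta> $ i - hi i\<bar> \<le> \<bar>R - hi i\<bar>"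
          using 1 b \<eta>R by (auto simp: sgn_real_def)
        have "sgn (x t $ i - hi i) = sgn (\<eta> $ i - hi i)"
          using solution_side[OF x attracts_nearer[OF up s]] t by simp
        then have "hi i < x t $ i" using 1 by (auto simp: sgn_real_def split: if_splits)
        then have "retract (x t) $ i = hi i" using lo_le_hi[of i] by (simp add: retract_def)
        then show ?thesis using D1(2)[OF x \<eta> s t] n by simp
      next
        case 2
        have s: "sgn (\<eta> $ i - lo i) = sgn (- R - lo i)" "\<bar>\<eta> $ i - lo i\<bar> \<le> \<bar>- R - lo i\<bar>"
          using 2 b \<eta>R by (auto simp: sgn_real_def)
        have "sgn (x t $ i - lo i) = sgn (\<eta> $ i - lo i)"
          using solution_side[OF x attracts_nearer[OF down s]] t by simp
        then have "x t $ i < lo i" using 2 by (auto simp: sgn_real_def split: if_splits)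
        then have "retract (x t) $ i = lo i" using lo_le_hi[of i] by (simp add: retract_def)
        then show ?thesis using D2(2)[OF x \<eta> s t] n by simp
      next
        case 3
        then show ?thesis
          using coordinate_stays_between[OF x 3, of t] t n by (simp add: retract_def)
      qed
      then show ?thesis by (simp add: distrib_right)
    qed
    then show ?thesis using D1(1) D2(1) by (intro exI[of _ "D1 + D2"]) auto
  qed
  then obtain D where D: "\<And>i \<eta> x t. caputo_solution \<alpha> g \<eta> x \<Longrightarrow> \<eta> \<in> cube R \<Longrightarrow> 0 < t \<Longrightarrow>
      \<bar>x t $ i - retract (x t) $ i\<bar> \<le> D i * t powr (- \<alpha>)" by metis
  show ?thesis
    by (rule exI[of _ "sum D UNIV"]) (auto intro!: sum_rates D)
qed

theorem attractor_is_global: "global_attractor (caputo_flow \<alpha> g) attractor"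
  unfolding global_attractor_def
proof (intro conjI allI impI)
  show "attractor \<noteq> {}" using retract_in by blast
  show "compact attractor" by (rule compact_cbox)
  show "caputo_flow \<alpha> g t ` attractor = attractor" if "0 \<le> t" for t
    by (rule flow_image_attractor[OF that])
  fix B :: "(real ^ 'n) set"
  assume B: "B \<noteq> {} \<and> bounded B"
  then obtain b where b: "\<And>\<eta>. \<eta> \<in> B \<Longrightarrow> norm \<eta> \<le> b" unfolding bounded_iff by blast
  define R where "R = R0 + \<bar>b\<bar>"
  have R: "R0 \<le> R" unfolding R_def by simp
  have BR: "\<eta> \<in> cube R" if "\<eta> \<in> B" for \<eta>
  proof -
    have "\<bar>\<eta> $ i\<bar> \<le> R" for i
      using component_le_norm_cart[of \<eta> i] b[OF that] R0(1) unfolding R_def by linarith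
    then show ?thesis by (simp add: mem_cube)
  qed
  obtain D where D: "\<And>\<eta> x t. \<eta> \<in> cube R \<Longrightarrow> caputo_solution \<alpha> g \<eta> x \<Longrightarrow> 0 < t \<Longrightarrow>
      norm (x t - retract (x t)) \<le> D * t powr (- \<alpha>)"
    using uniform_attraction[OF R] by blast
  define d where "d = (\<lambda>t \<eta>. INF z\<in>attractor. norm (caputo_flow \<alpha> g t \<eta> - z))"
  have ne: "attractor \<noteq> {}" using retract_in by blast
  have d_nonneg: "0 \<le> d t \<eta>" for t \<eta>
    unfolding d_def by (rule cINF_greatest[OF ne]) simp
  have d_le: "d t \<eta> \<le> D * t powr (- \<alpha>)" if "\<eta> \<in> B" "0 < t" for t \<eta>
  proof -
    obtain x where x: "caputo_solution \<alpha> g \<eta> x" by (rule solution_exists_from)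
    have "d t \<eta> \<le> norm (caputo_flow \<alpha> g t \<eta> - retract (x t))"
      unfolding d_def by (rule cINF_lower[OF _ retract_in]) (auto intro!: bdd_belowI2[of _ 0])
    also have "\<dots> \<le> D * t powr (- \<alpha>)"
      using flow_eq[OF x, of t] D[OF BR[OF that(1)] x that(2)] that(2) by simp
    finally show ?thesis .
  qed
  have "((\<lambda>t. SUP \<eta>\<in>B. ereal (d t \<eta>)) \<longlongrightarrow> ereal 0) at_top"
  proof (rule tendsto_sandwich)
    obtain \<eta>0 where "\<eta>0 \<in> B" using B by blast
    then show "eventually (\<lambda>t. ereal 0 \<le> (SUP \<eta>\<in>B. ereal (d t \<eta>))) at_top"
      using d_nonneg by (intro always_eventually allI SUP_upper2[of \<eta>0]) auto
    show "eventually (\<lambda>t. (SUP \<eta>\<in>B. ereal (d t \<eta>)) \<le> ereal (D * t powr (- \<alpha>))) at_top"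
      using eventually_gt_at_top[of 0]
      by eventually_elim (auto intro!: SUP_least d_le)
    show "((\<lambda>t. ereal (D * t powr (- \<alpha>))) \<longlongrightarrow> ereal 0) at_top"
      by (intro tendsto_ereal rate_tendsto_0)
  qed simp
  then show "((\<lambda>t. SUP \<eta>\<in>B. ereal (INF z\<in>attractor. norm (caputo_flow \<alpha> g t \<eta> - z))) \<longlongrightarrow> 0) at_top"
    unfolding d_def by (simp add: zero_ereal_def)
qed

end

section \<open>Triangular fields\<close>

lemma lipschitz_on_cube:
  fixes g :: "real ^ 'n::finite \<Rightarrow> real ^ 'n"
  assumes "continuously_differentiable g"
  shows "\<exists>L\<ge>0. \<forall>x\<in>cube R. \<forall>y\<in>cube R. norm (g x - g y) \<le> L * norm (x - y)"
proof -
  obtain g' :: "real ^ 'n \<Rightarrow> (real ^ 'n) \<Rightarrow>\<^sub>L (real ^ 'n)" where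
    g': "\<And>x. (g has_derivative blinfun_apply (g' x)) (at x)" "continuous_on UNIV g'"
    using assms unfolding continuously_differentiable_def by blast
  have "compact (g' ` cube R)"
    by (rule compact_continuous_image[OF continuous_on_subset[OF g'(2)] compact_cube]) auto
  then obtain L where L: "0 < L" "\<forall>y\<in>g' ` cube R. norm y \<le> L"
    using compact_imp_bounded bounded_pos by blast
  have "norm (g x - g y) \<le> L * norm (x - y)" if "x \<in> cube R" "y \<in> cube R" for x y
  proof (rule differentiable_bound[OF _ _ _ that])
    show "convex (cube R :: (real ^ 'n) set)" unfolding cube_def by (rule convex_box)
    show "(g has_derivative blinfun_apply (g' x)) (at x within cube R)" for x
      using g'(1) by (rule has_derivative_at_withinI)
    show "onorm (blinfun_apply (g' x)) \<le> L" if "x \<in> cube R" for x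
      using L(2) that by (auto simp: norm_blinfun.rep_eq[symmetric])
  qed
  then show ?thesis using L(1) by (intro exI[of _ L]) auto
qed

locale triangular_field =
  fixes g :: "real ^ 'n::{finite,linorder} \<Rightarrow> real ^ 'n::{finite,linorder}"
    and h :: "'n \<Rightarrow> ('n \<Rightarrow> real) \<Rightarrow> real" and f :: "'n \<Rightarrow> real \<Rightarrow> real"
  assumes smooth: "continuously_differentiable g"
    and form: "triangular_product_form g h f"
    and dissip: "dissipative g"
begin

definition H :: "'n \<Rightarrow> (real, 'n) vec \<Rightarrow> real" where
  "H i x = h i (restrict (($) x) {..<i})"

text \<open>Where a coordinate vanishes, the corresponding component of \<open>g\<close> drops out of the inner product in the
dissipativity condition; this isolates the \<open>i\<close>-th factor from the later ones.\<close>

definition probe :: "'n \<Rightarrow> (real, 'n) vec \<Rightarrow> real \<Rightarrow> (real, 'n) vec" where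
  "probe i x u = (\<chi> j. if j = i then u else if j < i then x $ j else 0)"

lemma g_eq: "g x $ i = H i x * f i (x $ i)"
  using form unfolding triangular_product_form_def H_def by blast

lemma H_probe: "j \<le> i \<Longrightarrow> H j (probe i x u) = H j x"
  unfolding H_def probe_def by (auto intro!: arg_cong[of _ _ "h j"] simp: restrict_def fun_eq_iff)

lemma g_probe: "g (probe i x u) $ i = H i x * f i u"
  using H_probe[of i i x u] unfolding g_eq by (simp add: probe_def)

lemma contg: "continuous_on UNIV g"
proof -
  obtain g' where "\<And>x. (g has_derivative blinfun_apply (g' x)) (at x)"
    using smooth unfolding continuously_differentiable_def by blast
  then show ?thesis
    by (intro differentiable_imp_continuous_on) (auto simp: differentiable_on_def differentiable_def intro: has_derivative_at_withinI)
qed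

text \<open>For \<open>probe i x u\<close> the terms of the coordinates before \<open>i\<close> do not depend on \<open>u\<close>, because \<open>g $ j\<close>
depends on the coordinates up to \<open>j\<close> only. So dissipativity bounds \<open>u * (H i x * f i u)\<close> by a
constant minus \<open>b * u\<^sup>2\<close>.\<close>

lemma sign_at_infinity: "\<exists>U>0. \<forall>u. U \<le> \<bar>u\<bar> \<longrightarrow> u * (H i x * f i u) < 0"
proof -
  obtain a b where ab: "0 < b" "\<And>x. inner x (g x) \<le> a - b * (norm x)\<^sup>2"
    using dissip unfolding dissipative_def by blast
  define c where "c = (\<Sum>j\<in>{..<i}. x $ j * g x $ j)"
  have le: "c + u * (H i x * f i u) \<le> a - b * u\<^sup>2" for u
  proof -
    have "inner (probe i x u) (g (probe i x u)) = (\<Sum>j\<in>UNIV. probe i x u $ j * g (probe i x u) $ j)"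
      by (simp add: inner_vec_def)
    also have "\<dots> = (\<Sum>j\<in>insert i {..<i}. probe i x u $ j * g (probe i x u) $ j)"
      by (rule sum.mono_neutral_right) (auto simp: probe_def)
    also have "\<dots> = u * (H i x * f i u) + (\<Sum>j\<in>{..<i}. probe i x u $ j * g (probe i x u) $ j)"
      by (subst sum.insert) (auto simp: g_probe, simp add: probe_def)
    also have "(\<Sum>j\<in>{..<i}. probe i x u $ j * g (probe i x u) $ j) = c"
      unfolding c_def
    proof (rule sum.cong)
      fix j assume j: "j \<in> {..<i}"
      then have "probe i x u $ j = x $ j" by (auto simp: probe_def)
      then show "probe i x u $ j * g (probe i x u) $ j = x $ j * g x $ j"
        using H_probe[of j i x u] j unfolding g_eq by simp
    qed simp
    finally have "c + u * (H i x * f i u) \<le> a - b * (norm (probe i x u))\<^sup>2" using ab(2) by (metis add.commute)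
    moreover have "u\<^sup>2 \<le> (norm (probe i x u))\<^sup>2"
      using component_le_norm_cart[of "probe i x u" i] unfolding probe_def by (simp add: abs_le_square_iff[symmetric])
    ultimately show ?thesis using mult_left_mono[of "u\<^sup>2" "(norm (probe i x u))\<^sup>2" b] ab(1) by linarith
  qed
  \<comment> \<open>Since \<open>U \<ge> 1\<close>, \<open>b * u\<^sup>2 \<ge> b * \<bar>u\<bar> > a - c\<close> beyond \<open>U\<close>.\<close>
  define U where "U = 1 + (\<bar>a\<bar> + \<bar>c\<bar>) / b"
  have U: "1 \<le> U" unfolding U_def using ab(1) by simp
  have "u * (H i x * f i u) < 0" if u: "U \<le> \<bar>u\<bar>" for u
  proof -
    have "b * U = b + (\<bar>a\<bar> + \<bar>c\<bar>)"
    proof -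
      have "b * U = b * 1 + b * ((\<bar>a\<bar> + \<bar>c\<bar>) / b)" unfolding U_def by (rule distrib_left)
      also have "b * ((\<bar>a\<bar> + \<bar>c\<bar>) / b) = \<bar>a\<bar> + \<bar>c\<bar>" using ab(1) by simp
      finally show ?thesis by simp
    qed
    moreover have "b * U \<le> b * \<bar>u\<bar>" using u ab(1) by simp
    moreover have "b * \<bar>u\<bar> \<le> b * u\<^sup>2"
    proof (rule mult_left_mono)
      have "1 * \<bar>u\<bar> \<le> \<bar>u\<bar> * \<bar>u\<bar>" using u U by (intro mult_right_mono) auto
      then show "\<bar>u\<bar> \<le> u\<^sup>2" by (simp add: power2_eq_square)
    qed (use ab(1) in simp)
    ultimately have "a - c < b * u\<^sup>2" using ab(1) by linarith
    then show ?thesis using le[of u] by linarith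
  qed
  then show ?thesis using U by (intro exI[of _ U]) auto
qed

lemma H_nonzero: "H i x \<noteq> 0"
proof -
  obtain U where "0 < U" "\<forall>u. U \<le> \<bar>u\<bar> \<longrightarrow> u * (H i x * f i u) < 0" using sign_at_infinity by blast
  then have "U * (H i x * f i U) < 0" by simp
  then show ?thesis by auto
qed

lemma continuous_on_probe: "continuous_on S (\<lambda>x. probe i x u)"
  unfolding probe_def
proof (intro continuous_on_vec_lambda)
  fix j show "continuous_on S (\<lambda>x. if j = i then u else if j < i then x $ j else 0)"
    by (cases "j = i"; cases "j < i") (auto intro!: continuous_intros)
qed

lemma contH: "continuous_on UNIV (H i)"
proof -
  \<comment> \<open>Dividing by \<open>f i U \<noteq> 0\<close> recovers \<open>H i\<close> from \<open>g\<close>.\<close>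
  obtain U where "0 < U" "\<forall>u. U \<le> \<bar>u\<bar> \<longrightarrow> u * (H i 0 * f i u) < 0" using sign_at_infinity by blast
  then have "U * (H i 0 * f i U) < 0" by simp
  then have fU: "f i U \<noteq> 0" by auto
  have "continuous_on UNIV (\<lambda>x. g (probe i x U) $ i / f i U)"
    using fU by (intro continuous_intros continuous_on_compose2[OF contg continuous_on_probe]) auto
  moreover have "H i = (\<lambda>x. g (probe i x U) $ i / f i U)"
    using fU by (simp add: fun_eq_iff g_probe)
  ultimately show ?thesis by (simp only:)
qed

lemma H_sign: "sgn (H i x) = sgn (H i 0)"
proof (rule ccontr)
  assume ne: "sgn (H i x) \<noteq> sgn (H i 0)"
  have conn: "connected (range (H i))"
    by (rule connected_continuous_image[OF contH connected_UNIV])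
  have "0 \<in> {min (H i x) (H i 0)..max (H i x) (H i 0)}"
    using ne H_nonzero[of i x] H_nonzero[of i 0] by (auto simp: sgn_real_def split: if_splits)
  moreover have "{min (H i x) (H i 0)..max (H i x) (H i 0)} \<subseteq> range (H i)"
    by (rule connected_contains_Icc[OF conn]) (auto simp: min_def max_def)
  ultimately obtain z where "H i z = 0" by (metis imageE subsetD)
  then show False using H_nonzero by blast
qed

lemma f_deriv: "(f i has_real_derivative deriv (f i) u) (at u)"
proof -
  obtain g' where g': "\<And>x. (g has_derivative blinfun_apply (g' x)) (at x)"
    using smooth unfolding continuously_differentiable_def by blast
  have eq: "f i = (\<lambda>u. g (u *\<^sub>R axis i 1) $ i / H i 0)"
  proof
    fix u
    have "probe i 0 u = u *\<^sub>R axis i 1"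
      by (simp add: probe_def axis_def vec_eq_iff)
    then show "f i u = g (u *\<^sub>R axis i 1) $ i / H i 0"
      using g_probe[of i 0 u] H_nonzero[of i 0] by simp
  qed
  have "((\<lambda>u. u *\<^sub>R axis i 1 :: (real, 'n) vec) has_derivative (\<lambda>u. u *\<^sub>R axis i 1)) (at u)"
    by (auto intro!: derivative_eq_intros)
  from has_derivative_compose[OF this g']
  have "((\<lambda>u. g (u *\<^sub>R axis i 1)) has_derivative (\<lambda>v. blinfun_apply (g' (u *\<^sub>R axis i 1)) (v *\<^sub>R axis i 1))) (at u)" .
  from bounded_linear.has_derivative[OF bounded_linear_vec_nth this, of i]
  have "((\<lambda>u. g (u *\<^sub>R axis i 1) $ i) has_derivative (\<lambda>v. blinfun_apply (g' (u *\<^sub>R axis i 1)) (v *\<^sub>R axis i 1) $ i)) (at u)" .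
  then have "(\<lambda>u. g (u *\<^sub>R axis i 1) $ i) differentiable at u" by (rule differentiableI)
  then have "f i differentiable at u"
    unfolding eq using H_nonzero by (intro differentiable_divide) auto
  then show ?thesis by (simp add: DERIV_deriv_iff_real_differentiable)
qed

text \<open>Since \<open>H i\<close> has a constant sign, this sign can be moved to \<open>f i\<close>.\<close>

lemma is_product_field:
  assumes \<alpha>: "0 < \<alpha>" "\<alpha> < 1" and nd: "\<And>i u. u \<in> zeros (f i) \<Longrightarrow> deriv (f i) u \<noteq> 0"
  shows "\<exists>R0. product_field \<alpha> (\<lambda>i x. \<bar>H i x\<bar>) (\<lambda>i u. sgn (H i 0) * f i u) g R0"
proof -
  have "\<forall>i. \<exists>U>0. \<forall>u. U \<le> \<bar>u\<bar> \<longrightarrow> u * (H i 0 * f i u) < 0" using sign_at_infinity by blast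
  then obtain U where U: "\<And>i. 0 < U i" "\<And>i u. U i \<le> \<bar>u\<bar> \<Longrightarrow> u * (H i 0 * f i u) < 0" by metis
  define R0 where "R0 = Max (range U)"
  have R0: "U i \<le> R0" for i
    unfolding R0_def by simp
  have "0 < R0" using U(1)[of undefined] R0[of undefined] by linarith
  have sgn_f: "u * (sgn (H i 0) * f i u) < 0" if "R0 \<le> \<bar>u\<bar>" for i u
  proof -
    have "sgn (u * (H i 0 * f i u)) = - 1" using U(2)[of i u] R0[of i] that by simp
    then have "sgn (u * (sgn (H i 0) * f i u)) = - 1" by (simp add: sgn_mult)
    then show ?thesis by (simp only: sgn_1_neg)
  qed
  have "product_field \<alpha> (\<lambda>i x. \<bar>H i x\<bar>) (\<lambda>i u. sgn (H i 0) * f i u) g R0"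
  proof
    show "g x $ i = \<bar>H i x\<bar> * (sgn (H i 0) * f i (x $ i))" for x i
    proof -
      have "\<bar>H i x\<bar> * sgn (H i 0) = H i x" unfolding H_sign[of i x, symmetric] by (rule abs_mult_sgn)
      then show ?thesis unfolding g_eq by (metis mult.assoc)
    qed
    show "continuous_on UNIV (\<lambda>x. \<bar>H i x\<bar>)" for i by (intro continuous_intros contH)
    show "continuous_on UNIV (\<lambda>u. sgn (H i 0) * f i u)" for i
      using f_deriv[of i] by (intro continuous_on_mult continuous_on_const) (meson DERIV_continuous_on DERIV_subset subset_UNIV)
    show "\<exists>D. D \<noteq> 0 \<and> ((\<lambda>u. sgn (H i 0) * f i u) has_real_derivative D) (at u)" if "sgn (H i 0) * f i u = 0" for i u
    proof (intro exI conjI)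
      show "((\<lambda>u. sgn (H i 0) * f i u) has_real_derivative sgn (H i 0) * deriv (f i) u) (at u)"
        by (rule DERIV_cmult[OF f_deriv])
      show "sgn (H i 0) * deriv (f i) u \<noteq> 0"
        using that nd[of u i] H_nonzero[of i 0] by (auto simp: zeros_def sgn_eq_0_iff)
    qed
    show "sgn (H i 0) * f i u < 0" if "R0 \<le> u" for i u
      using sgn_f[of u i] that \<open>0 < R0\<close> by (simp only: mult_less_0_iff) auto
    show "0 < sgn (H i 0) * f i u" if "u \<le> - R0" for i u
      using sgn_f[of u i] that \<open>0 < R0\<close> by (simp only: mult_less_0_iff) auto
  qed (use \<alpha> H_nonzero \<open>0 < R0\<close> lipschitz_on_cube[OF smooth] in auto)
  then show ?thesis by blast
qed

end

theorem theorem3p1: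
  fixes \<alpha> :: real
    and g :: "real ^ 'n::{finite,linorder} \<Rightarrow> real ^ 'n::{finite,linorder}"
    and h :: "'n \<Rightarrow> ('n \<Rightarrow> real) \<Rightarrow> real"
    and f :: "'n \<Rightarrow> real \<Rightarrow> real"
  assumes "0 < \<alpha>" and "\<alpha> < 1"
    and "continuously_differentiable g"
    and "triangular_product_form g h f"
    and "dissipative g"
    and "\<And>i u. u \<in> zeros (f i) \<Longrightarrow> deriv (f i) u \<noteq> 0"
  shows "global_attractor (caputo_flow \<alpha> g)
           (cbox (\<chi> i. Min (zeros (f i))) (\<chi> i. Max (zeros (f i)))) \<and>
         (\<forall>\<eta> x. caputo_solution \<alpha> g \<eta> x \<longrightarrow>
           (\<exists>l\<in>zero_product f. (x \<longlongrightarrow> l) at_top \<and>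
              (\<eta> \<notin> zero_product f \<longrightarrow> exact_rate \<alpha> x l)))"
proof -
  interpret T: triangular_field g h f
    by unfold_locales (use assms in auto)
  obtain R0 where "product_field \<alpha> (\<lambda>i x. \<bar>T.H i x\<bar>) (\<lambda>i u. sgn (T.H i 0) * f i u) g R0"
    using T.is_product_field[OF assms(1,2,6)] by blast
  then interpret F: product_field \<alpha> "\<lambda>i x. \<bar>T.H i x\<bar>" "\<lambda>i u. sgn (T.H i 0) * f i u" g R0 .
  have zeros: "zeros (\<lambda>u. sgn (T.H i 0) * f i u) = zeros (f i)" for i
    using T.H_nonzero[of i 0] by (auto simp: zeros_def sgn_eq_0_iff)
  have product: "zero_product (\<lambda>i u. sgn (T.H i 0) * f i u) = zero_product f"
    unfolding zero_product_def zeros ..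
  show ?thesis
    using F.attractor_is_global F.solution_converges unfolding zeros product by blast
qed

end
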